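(* Over $\mathsf{RCA}_0$, $\mathsf{RT}^2_2$ implies $\mathsf{AHT}_2$; that is, $\mathsf{RCA}_0 \vdash \mathsf{RT}^2_2 \rightarrow \mathsf{AHT}_2$.
   Context: $\mathsf{RCA}_0$ is the usual base system of reverse mathematics in second-order arithmetic; $\mathbf{N}$ denotes its first-order universe, and all principles below are statements in the language of second-order arithmetic. A map into $k$ means a map into $\{0,\dots,k-1\}$. $[\mathbf{N}]^2$ is the set of pairs $(x,y)$ of elements of $\mathbf{N}$ with $x<y$. $\mathsf{RT}^2_k$ (Ramsey's Theorem for pairs and $k$ colors): for every $f:[\mathbf{N}]^2\to k$ there is an infinite set $J\subseteq\mathbf{N}$ and a color $c<k$ such that $f(x,y)=c$ for all $x<y$ in $J$. For a positive integer $n=2^{t_1}+\dots+2^{t_p}$ with $t_1<\dots<t_p$, put $\lambda(n)=t_1$ and $\mu(n)=t_p$. A set $X$ of positive integers satisfies the Apartness Condition if for all $x,x'\in X$ with $x<x'$ we have $\mu(x)<\lambda(x')$. For an infinite set $H=\{h_1<h_2<h_3<\dots\}$, $AS(H)$ denotes the set of all finite sums of distinct adjacent elements of $H$, i.e. all sums $h_i+h_{i+1}+\dots+h_j$ with $i\le j$ (including single elements, $i=j$). $\mathsf{AHT}_k$ (Adjacent Hindman's Theorem for $k$ colors): for every $c:\mathbf{N}\to k$ there exists an infinite set $H$ of positive integers satisfying the Apartness Condition such that all elements of $AS(H)$ have the same $c$-color. *)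

theory Defs
  imports Main
begin

section \<open>The language of second-order arithmetic\<close>

text \<open>
  Two sorts of terms. Besides named variables, which may be bound, there are parameters (fresh
  constants that are never bound); they serve as eigenvariables of the deductive calculus and do
  not occur in the axioms of the theories considered. As in the usual presentation, the only
  terms of set sort are atomic, and there is no primitive equality between sets.
\<close>

type_synonym name = string

datatype ntm =
    Var name
  | Par nat
  | Zero ("\<^bold>0")
  | One ("\<^bold>1")
  | Add ntm ntm (infixl "\<^bold>+" 65)
  | Mul ntm ntm (infixl "\<^bold>*" 70)

datatype stm = SVar name | SPar nat

datatype fm =
    Eq ntm ntm (infix "\<^bold>=" 50)
  | Less ntm ntm (infix "\<^bold><" 50)
  | Mem ntm stm (infix "\<^bold>\<in>" 50)
  | Falsum ("\<^bold>\<bottom>")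
  | Imp fm fm (infixr "\<^bold>\<longrightarrow>" 25)
  | AllN name fm ("(3\<^bold>\<forall>_./ _)" [1000, 10] 10)
  | AllS name fm ("(3\<^bold>\<forall>\<^sub>s_./ _)" [1000, 10] 10)

abbreviation Neg :: "fm \<Rightarrow> fm" ("\<^bold>\<not> _" [40] 40) where
  "\<^bold>\<not> \<phi> \<equiv> \<phi> \<^bold>\<longrightarrow> \<^bold>\<bottom>"

abbreviation Conj :: "fm \<Rightarrow> fm \<Rightarrow> fm" (infixr "\<^bold>\<and>" 35) where
  "\<phi> \<^bold>\<and> \<psi> \<equiv> \<^bold>\<not> (\<phi> \<^bold>\<longrightarrow> \<^bold>\<not> \<psi>)"

abbreviation Disj :: "fm \<Rightarrow> fm \<Rightarrow> fm" (infixr "\<^bold>\<or>" 30) where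
  "\<phi> \<^bold>\<or> \<psi> \<equiv> \<^bold>\<not> \<phi> \<^bold>\<longrightarrow> \<psi>"

abbreviation Iff :: "fm \<Rightarrow> fm \<Rightarrow> fm" (infixr "\<^bold>\<longleftrightarrow>" 25) where
  "\<phi> \<^bold>\<longleftrightarrow> \<psi> \<equiv> (\<phi> \<^bold>\<longrightarrow> \<psi>) \<^bold>\<and> (\<psi> \<^bold>\<longrightarrow> \<phi>)"

abbreviation ExN :: "name \<Rightarrow> fm \<Rightarrow> fm" ("(3\<^bold>\<exists>_./ _)" [1000, 10] 10) where
  "\<^bold>\<exists>x. \<phi> \<equiv> \<^bold>\<not> (\<^bold>\<forall>x. \<^bold>\<not> \<phi>)"

abbreviation ExS :: "name \<Rightarrow> fm \<Rightarrow> fm" ("(3\<^bold>\<exists>\<^sub>s_./ _)" [1000, 10] 10) where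
  "\<^bold>\<exists>\<^sub>sX. \<phi> \<equiv> \<^bold>\<not> (\<^bold>\<forall>\<^sub>sX. \<^bold>\<not> \<phi>)"

abbreviation Verum :: fm ("\<^bold>\<top>") where
  "\<^bold>\<top> \<equiv> \<^bold>\<not> \<^bold>\<bottom>"

abbreviation Le :: "ntm \<Rightarrow> ntm \<Rightarrow> fm" (infix "\<^bold>\<le>" 50) where
  "s \<^bold>\<le> t \<equiv> s \<^bold>< t \<^bold>\<or> s \<^bold>= t"

primrec tvars :: "ntm \<Rightarrow> name set" where
  "tvars (Var x) = {x}"
| "tvars (Par a) = {}"
| "tvars \<^bold>0 = {}"
| "tvars \<^bold>1 = {}"
| "tvars (s \<^bold>+ t) = tvars s \<union> tvars t"
| "tvars (s \<^bold>* t) = tvars s \<union> tvars t"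

primrec tpars :: "ntm \<Rightarrow> nat set" where
  "tpars (Var x) = {}"
| "tpars (Par a) = {a}"
| "tpars \<^bold>0 = {}"
| "tpars \<^bold>1 = {}"
| "tpars (s \<^bold>+ t) = tpars s \<union> tpars t"
| "tpars (s \<^bold>* t) = tpars s \<union> tpars t"

primrec svars :: "stm \<Rightarrow> name set" where
  "svars (SVar X) = {X}"
| "svars (SPar A) = {}"

primrec spars :: "stm \<Rightarrow> nat set" where
  "spars (SVar X) = {}"
| "spars (SPar A) = {A}"

primrec free_nvars :: "fm \<Rightarrow> name set" where
  "free_nvars (s \<^bold>= t) = tvars s \<union> tvars t"
| "free_nvars (s \<^bold>< t) = tvars s \<union> tvars t"
| "free_nvars (t \<^bold>\<in> S) = tvars t"
| "free_nvars \<^bold>\<bottom> = {}"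
| "free_nvars (\<phi> \<^bold>\<longrightarrow> \<psi>) = free_nvars \<phi> \<union> free_nvars \<psi>"
| "free_nvars (\<^bold>\<forall>x. \<phi>) = free_nvars \<phi> - {x}"
| "free_nvars (\<^bold>\<forall>\<^sub>sX. \<phi>) = free_nvars \<phi>"

primrec free_svars :: "fm \<Rightarrow> name set" where
  "free_svars (s \<^bold>= t) = {}"
| "free_svars (s \<^bold>< t) = {}"
| "free_svars (t \<^bold>\<in> S) = svars S"
| "free_svars \<^bold>\<bottom> = {}"
| "free_svars (\<phi> \<^bold>\<longrightarrow> \<psi>) = free_svars \<phi> \<union> free_svars \<psi>"
| "free_svars (\<^bold>\<forall>x. \<phi>) = free_svars \<phi>"
| "free_svars (\<^bold>\<forall>\<^sub>sX. \<phi>) = free_svars \<phi> - {X}"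

primrec fm_npars :: "fm \<Rightarrow> nat set" where
  "fm_npars (s \<^bold>= t) = tpars s \<union> tpars t"
| "fm_npars (s \<^bold>< t) = tpars s \<union> tpars t"
| "fm_npars (t \<^bold>\<in> S) = tpars t"
| "fm_npars \<^bold>\<bottom> = {}"
| "fm_npars (\<phi> \<^bold>\<longrightarrow> \<psi>) = fm_npars \<phi> \<union> fm_npars \<psi>"
| "fm_npars (\<^bold>\<forall>x. \<phi>) = fm_npars \<phi>"
| "fm_npars (\<^bold>\<forall>\<^sub>sX. \<phi>) = fm_npars \<phi>"

primrec fm_spars :: "fm \<Rightarrow> nat set" where
  "fm_spars (s \<^bold>= t) = {}"
| "fm_spars (s \<^bold>< t) = {}"
| "fm_spars (t \<^bold>\<in> S) = spars S"
| "fm_spars \<^bold>\<bottom> = {}"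
| "fm_spars (\<phi> \<^bold>\<longrightarrow> \<psi>) = fm_spars \<phi> \<union> fm_spars \<psi>"
| "fm_spars (\<^bold>\<forall>x. \<phi>) = fm_spars \<phi>"
| "fm_spars (\<^bold>\<forall>\<^sub>sX. \<phi>) = fm_spars \<phi>"

definition is_sentence :: "fm \<Rightarrow> bool" where
  "is_sentence \<phi> \<longleftrightarrow>
    free_nvars \<phi> = {} \<and> free_svars \<phi> = {} \<and> fm_npars \<phi> = {} \<and> fm_spars \<phi> = {}"

text \<open>
  Substitution does not rename bound variables. It is only ever used where capture is impossible:
  for substituted terms without variables, and for replacing a variable \<open>n\<close> by \<open>n + 1\<close>.
\<close>

primrec tsubst :: "name \<Rightarrow> ntm \<Rightarrow> ntm \<Rightarrow> ntm" where
  "tsubst x r (Var y) = (if y = x then r else Var y)"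
| "tsubst x r (Par a) = Par a"
| "tsubst x r \<^bold>0 = \<^bold>0"
| "tsubst x r \<^bold>1 = \<^bold>1"
| "tsubst x r (s \<^bold>+ t) = tsubst x r s \<^bold>+ tsubst x r t"
| "tsubst x r (s \<^bold>* t) = tsubst x r s \<^bold>* tsubst x r t"

primrec nsubst :: "name \<Rightarrow> ntm \<Rightarrow> fm \<Rightarrow> fm" where
  "nsubst x r (s \<^bold>= t) = (tsubst x r s \<^bold>= tsubst x r t)"
| "nsubst x r (s \<^bold>< t) = (tsubst x r s \<^bold>< tsubst x r t)"
| "nsubst x r (t \<^bold>\<in> S) = (tsubst x r t \<^bold>\<in> S)"
| "nsubst x r \<^bold>\<bottom> = \<^bold>\<bottom>"
| "nsubst x r (\<phi> \<^bold>\<longrightarrow> \<psi>) = (nsubst x r \<phi> \<^bold>\<longrightarrow> nsubst x r \<psi>)"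
| "nsubst x r (\<^bold>\<forall>y. \<phi>) = (\<^bold>\<forall>y. if y = x then \<phi> else nsubst x r \<phi>)"
| "nsubst x r (\<^bold>\<forall>\<^sub>sY. \<phi>) = (\<^bold>\<forall>\<^sub>sY. nsubst x r \<phi>)"

primrec ssubst :: "name \<Rightarrow> stm \<Rightarrow> fm \<Rightarrow> fm" where
  "ssubst X R (s \<^bold>= t) = (s \<^bold>= t)"
| "ssubst X R (s \<^bold>< t) = (s \<^bold>< t)"
| "ssubst X R (t \<^bold>\<in> S) = (t \<^bold>\<in> (if S = SVar X then R else S))"
| "ssubst X R \<^bold>\<bottom> = \<^bold>\<bottom>"
| "ssubst X R (\<phi> \<^bold>\<longrightarrow> \<psi>) = (ssubst X R \<phi> \<^bold>\<longrightarrow> ssubst X R \<psi>)"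
| "ssubst X R (\<^bold>\<forall>y. \<phi>) = (\<^bold>\<forall>y. ssubst X R \<phi>)"
| "ssubst X R (\<^bold>\<forall>\<^sub>sY. \<phi>) = (\<^bold>\<forall>\<^sub>sY. if Y = X then \<phi> else ssubst X R \<phi>)"


section \<open>Classical two-sorted natural deduction with equality on numbers\<close>

inductive derives :: "fm set \<Rightarrow> fm \<Rightarrow> bool" (infix "\<turnstile>" 5) where
  Assm: "\<phi> \<in> \<Gamma> \<Longrightarrow> \<Gamma> \<turnstile> \<phi>"
| ImpI: "insert \<phi> \<Gamma> \<turnstile> \<psi> \<Longrightarrow> \<Gamma> \<turnstile> (\<phi> \<^bold>\<longrightarrow> \<psi>)"
| ImpE: "\<Gamma> \<turnstile> (\<phi> \<^bold>\<longrightarrow> \<psi>) \<Longrightarrow> \<Gamma> \<turnstile> \<phi> \<Longrightarrow> \<Gamma> \<turnstile> \<psi>"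
| Raa: "insert (\<^bold>\<not> \<phi>) \<Gamma> \<turnstile> \<^bold>\<bottom> \<Longrightarrow> \<Gamma> \<turnstile> \<phi>"
| AllNI: "\<Gamma> \<turnstile> nsubst x (Par a) \<phi> \<Longrightarrow> a \<notin> (\<Union>\<psi>\<in>insert \<phi> \<Gamma>. fm_npars \<psi>) \<Longrightarrow> \<Gamma> \<turnstile> (\<^bold>\<forall>x. \<phi>)"
| AllNE: "\<Gamma> \<turnstile> (\<^bold>\<forall>x. \<phi>) \<Longrightarrow> tvars t = {} \<Longrightarrow> \<Gamma> \<turnstile> nsubst x t \<phi>"
| AllSI: "\<Gamma> \<turnstile> ssubst X (SPar A) \<phi> \<Longrightarrow> A \<notin> (\<Union>\<psi>\<in>insert \<phi> \<Gamma>. fm_spars \<psi>) \<Longrightarrow> \<Gamma> \<turnstile> (\<^bold>\<forall>\<^sub>sX. \<phi>)"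
| AllSE: "\<Gamma> \<turnstile> (\<^bold>\<forall>\<^sub>sX. \<phi>) \<Longrightarrow> \<Gamma> \<turnstile> ssubst X (SPar A) \<phi>"
| EqI: "\<Gamma> \<turnstile> (t \<^bold>= t)"
| EqE: "\<Gamma> \<turnstile> (s \<^bold>= t) \<Longrightarrow> \<Gamma> \<turnstile> nsubst x s \<phi> \<Longrightarrow> tvars s = {} \<Longrightarrow> tvars t = {} \<Longrightarrow>
    \<Gamma> \<turnstile> nsubst x t \<phi>"


section \<open>The theory RCA\<open>\<^sub>0\<close>\<close>

inductive bounded_fm :: "fm \<Rightarrow> bool" where
  "bounded_fm (s \<^bold>= t)"
| "bounded_fm (s \<^bold>< t)"
| "bounded_fm (t \<^bold>\<in> S)"
| "bounded_fm \<^bold>\<bottom>"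
| "bounded_fm \<phi> \<Longrightarrow> bounded_fm \<psi> \<Longrightarrow> bounded_fm (\<phi> \<^bold>\<longrightarrow> \<psi>)"
| "bounded_fm \<phi> \<Longrightarrow> x \<notin> tvars t \<Longrightarrow> bounded_fm (\<^bold>\<forall>x. Var x \<^bold>< t \<^bold>\<longrightarrow> \<phi>)"
| "bounded_fm \<phi> \<Longrightarrow> x \<notin> tvars t \<Longrightarrow> bounded_fm (\<^bold>\<exists>x. Var x \<^bold>< t \<^bold>\<and> \<phi>)"

inductive Sigma01 :: "fm \<Rightarrow> bool" where
  "bounded_fm \<theta> \<Longrightarrow> Sigma01 (\<^bold>\<exists>x. \<theta>)"

inductive Pi01 :: "fm \<Rightarrow> bool" where
  "bounded_fm \<theta> \<Longrightarrow> Pi01 (\<^bold>\<forall>x. \<theta>)"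

inductive_set basic_axioms :: "fm set" where
  "(\<^bold>\<not> Var ''n'' \<^bold>+ \<^bold>1 \<^bold>= \<^bold>0) \<in> basic_axioms"
| "(Var ''m'' \<^bold>+ \<^bold>1 \<^bold>= Var ''n'' \<^bold>+ \<^bold>1 \<^bold>\<longrightarrow> Var ''m'' \<^bold>= Var ''n'') \<in> basic_axioms"
| "(Var ''m'' \<^bold>+ \<^bold>0 \<^bold>= Var ''m'') \<in> basic_axioms"
| "(Var ''m'' \<^bold>+ (Var ''n'' \<^bold>+ \<^bold>1) \<^bold>= (Var ''m'' \<^bold>+ Var ''n'') \<^bold>+ \<^bold>1) \<in> basic_axioms"
| "(Var ''m'' \<^bold>* \<^bold>0 \<^bold>= \<^bold>0) \<in> basic_axioms"
| "(Var ''m'' \<^bold>* (Var ''n'' \<^bold>+ \<^bold>1) \<^bold>= (Var ''m'' \<^bold>* Var ''n'') \<^bold>+ Var ''m'') \<in> basic_axioms"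
| "(\<^bold>\<not> Var ''m'' \<^bold>< \<^bold>0) \<in> basic_axioms"
| "(Var ''m'' \<^bold>< Var ''n'' \<^bold>+ \<^bold>1 \<^bold>\<longleftrightarrow> (Var ''m'' \<^bold>< Var ''n'' \<^bold>\<or> Var ''m'' \<^bold>= Var ''n'')) \<in> basic_axioms"

definition induction_axiom :: "name \<Rightarrow> fm \<Rightarrow> fm" where
  "induction_axiom x \<phi> =
    (nsubst x \<^bold>0 \<phi> \<^bold>\<and> (\<^bold>\<forall>x. \<phi> \<^bold>\<longrightarrow> nsubst x (Var x \<^bold>+ \<^bold>1) \<phi>) \<^bold>\<longrightarrow> (\<^bold>\<forall>x. \<phi>))"

definition comprehension_axiom :: "name \<Rightarrow> name \<Rightarrow> fm \<Rightarrow> fm \<Rightarrow> fm" where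
  "comprehension_axiom x X \<phi> \<psi> =
    ((\<^bold>\<forall>x. \<phi> \<^bold>\<longleftrightarrow> \<psi>) \<^bold>\<longrightarrow> (\<^bold>\<exists>\<^sub>sX. \<^bold>\<forall>x. Var x \<^bold>\<in> SVar X \<^bold>\<longleftrightarrow> \<phi>))"

inductive_set RCA0_open :: "fm set" where
  RCA0_basic: "\<phi> \<in> basic_axioms \<Longrightarrow> \<phi> \<in> RCA0_open"
| RCA0_ind: "Sigma01 \<phi> \<Longrightarrow> induction_axiom x \<phi> \<in> RCA0_open"
| RCA0_comp: "Sigma01 \<phi> \<Longrightarrow> Pi01 \<psi> \<Longrightarrow> X \<notin> free_svars \<phi> \<Longrightarrow>
    comprehension_axiom x X \<phi> \<psi> \<in> RCA0_open"

inductive generalization :: "fm \<Rightarrow> fm \<Rightarrow> bool" where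
  "generalization \<phi> \<phi>"
| "generalization \<phi> \<psi> \<Longrightarrow> generalization \<phi> (\<^bold>\<forall>x. \<psi>)"
| "generalization \<phi> \<psi> \<Longrightarrow> generalization \<phi> (\<^bold>\<forall>\<^sub>sX. \<psi>)"

text \<open>The axioms are the universal closures of the above formulas; they contain no parameters.\<close>

definition RCA0 :: "fm set" ("RCA\<^sub>0") where
  "RCA\<^sub>0 = {\<psi>. is_sentence \<psi> \<and> (\<exists>\<phi>\<in>RCA0_open. generalization \<phi> \<psi>)}"


section \<open>Functions and finite sums in the language\<close>

text \<open>
  The following are formulas depending on terms. They bind variables, so they must only be
  applied to terms whose variables are distinct from those bound in them; all variables are
  given distinct names accordingly. The pairing function is \<open>(a, b) = (a + b)\<^sup>2 + a\<close>, and a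
  function from \<open>A\<close> to \<open>B\<close> is a set of pairs, as usual in second-order arithmetic.
\<close>

primrec numeral_tm :: "nat \<Rightarrow> ntm" where
  "numeral_tm 0 = \<^bold>0"
| "numeral_tm (Suc k) = numeral_tm k \<^bold>+ \<^bold>1"

definition pair :: "ntm \<Rightarrow> ntm \<Rightarrow> ntm" where
  "pair a b = (a \<^bold>+ b) \<^bold>* (a \<^bold>+ b) \<^bold>+ a"

text \<open>\<open>maps X a b\<close>: the function coded by \<open>X\<close> has value \<open>b\<close> at \<open>a\<close>.\<close>

definition maps :: "stm \<Rightarrow> ntm \<Rightarrow> ntm \<Rightarrow> fm" where
  "maps X a b = (pair a b \<^bold>\<in> X)"

context
begin

private abbreviation (input) "c \<equiv> Var ''c''"
private abbreviation (input) "i \<equiv> Var ''i''"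
private abbreviation (input) "j \<equiv> Var ''j''"
private abbreviation (input) "m \<equiv> Var ''m''"
private abbreviation (input) "q \<equiv> Var ''q''"
private abbreviation (input) "s \<equiv> Var ''s''"
private abbreviation (input) "t \<equiv> Var ''t''"
private abbreviation (input) "u \<equiv> Var ''u''"
private abbreviation (input) "v \<equiv> Var ''v''"
private abbreviation (input) "w \<equiv> Var ''w''"
private abbreviation (input) "x \<equiv> Var ''x''"
private abbreviation (input) "y \<equiv> Var ''y''"
private abbreviation (input) "z \<equiv> Var ''z''"
private abbreviation (input) "C \<equiv> SVar ''C''"
private abbreviation (input) "E \<equiv> SVar ''E''"
private abbreviation (input) "F \<equiv> SVar ''F''"
private abbreviation (input) "G \<equiv> SVar ''G''"
private abbreviation (input) "H \<equiv> SVar ''H''"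
private abbreviation (input) "J \<equiv> SVar ''J''"
private abbreviation (input) "L \<equiv> SVar ''L''"
private abbreviation (input) "Q \<equiv> SVar ''Q''"
private abbreviation (input) "T \<equiv> SVar ''T''"

definition is_function :: "(ntm \<Rightarrow> fm) \<Rightarrow> (ntm \<Rightarrow> fm) \<Rightarrow> stm \<Rightarrow> fm" where
  "is_function A B X =
    ((\<^bold>\<forall>''z''. z \<^bold>\<in> X \<^bold>\<longrightarrow> (\<^bold>\<exists>''u''. \<^bold>\<exists>''v''. A u \<^bold>\<and> B v \<^bold>\<and> z \<^bold>= pair u v)) \<^bold>\<and>
     (\<^bold>\<forall>''u''. A u \<^bold>\<longrightarrow>
        (\<^bold>\<exists>''v''. B v \<^bold>\<and> maps X u v \<^bold>\<and> (\<^bold>\<forall>''w''. maps X u w \<^bold>\<longrightarrow> w \<^bold>= v))))"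

definition is_nat :: "ntm \<Rightarrow> fm" where
  "is_nat a = \<^bold>\<top>"

definition is_increasing_pair :: "ntm \<Rightarrow> fm" where
  "is_increasing_pair a = (\<^bold>\<exists>''x''. \<^bold>\<exists>''y''. x \<^bold>< y \<^bold>\<and> a \<^bold>= pair x y)"

definition below :: "nat \<Rightarrow> ntm \<Rightarrow> fm" where
  "below k a = (a \<^bold>< numeral_tm k)"

definition is_infinite :: "stm \<Rightarrow> fm" where
  "is_infinite X = (\<^bold>\<forall>''x''. \<^bold>\<exists>''y''. y \<^bold>\<in> X \<^bold>\<and> x \<^bold>< y)"

text \<open>
  \<open>is_sum X a b r\<close>: \<open>a \<le> b\<close> and \<open>r = X(a) + X(a + 1) + \<dots> + X(b)\<close>, where \<open>Q(m)\<close> is the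
  partial sum up to \<open>m\<close>.
\<close>

definition is_sum :: "stm \<Rightarrow> ntm \<Rightarrow> ntm \<Rightarrow> ntm \<Rightarrow> fm" where
  "is_sum X a b r =
    (a \<^bold>\<le> b \<^bold>\<and>
     (\<^bold>\<exists>\<^sub>s''Q''. is_function is_nat is_nat Q \<^bold>\<and>
        (\<^bold>\<forall>''u''. maps X a u \<^bold>\<longrightarrow> maps Q a u) \<^bold>\<and>
        (\<^bold>\<forall>''m''. \<^bold>\<forall>''u''. \<^bold>\<forall>''v''.
           a \<^bold>\<le> m \<^bold>\<and> m \<^bold>< b \<^bold>\<and> maps Q m u \<^bold>\<and> maps X (m \<^bold>+ \<^bold>1) v \<^bold>\<longrightarrow> maps Q (m \<^bold>+ \<^bold>1) (u \<^bold>+ v)) \<^bold>\<and>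
        maps Q b r))"

definition is_powers_of_two :: "stm \<Rightarrow> fm" where
  "is_powers_of_two X =
    (is_function is_nat is_nat X \<^bold>\<and> maps X \<^bold>0 \<^bold>1 \<^bold>\<and>
     (\<^bold>\<forall>''m''. \<^bold>\<forall>''u''. maps X m u \<^bold>\<longrightarrow> maps X (m \<^bold>+ \<^bold>1) (numeral_tm 2 \<^bold>* u)))"

definition strictly_increasing_upto :: "stm \<Rightarrow> ntm \<Rightarrow> fm" where
  "strictly_increasing_upto X b =
    (\<^bold>\<forall>''i''. \<^bold>\<forall>''j''. \<^bold>\<forall>''u''. \<^bold>\<forall>''v''.
       i \<^bold>< j \<^bold>\<and> j \<^bold>\<le> b \<^bold>\<and> maps X i u \<^bold>\<and> maps X j v \<^bold>\<longrightarrow> u \<^bold>< v)"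

text \<open>
  \<open>is_binary_expansion X b r\<close>: \<open>r = 2^X(0) + 2^X(1) + \<dots> + 2^X(b)\<close> with
  \<open>X(0) < X(1) < \<dots> < X(b)\<close>.
\<close>

definition is_binary_expansion :: "stm \<Rightarrow> ntm \<Rightarrow> ntm \<Rightarrow> fm" where
  "is_binary_expansion X b r =
    (is_function is_nat is_nat X \<^bold>\<and> strictly_increasing_upto X b \<^bold>\<and>
     (\<^bold>\<exists>\<^sub>s''E''. \<^bold>\<exists>\<^sub>s''G''. is_powers_of_two E \<^bold>\<and> is_function is_nat is_nat G \<^bold>\<and>
        (\<^bold>\<forall>''i''. \<^bold>\<forall>''u''. \<^bold>\<forall>''v''. maps X i u \<^bold>\<and> maps E u v \<^bold>\<longrightarrow> maps G i v) \<^bold>\<and>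
        is_sum G \<^bold>0 b r))"

text \<open>\<open>lambda_is r a\<close> and \<open>mu_is r a\<close>: \<open>\<lambda>(r) = a\<close> and \<open>\<mu>(r) = a\<close>.\<close>

definition lambda_is :: "ntm \<Rightarrow> ntm \<Rightarrow> fm" where
  "lambda_is r a = (\<^bold>\<exists>\<^sub>s''T''. \<^bold>\<exists>''q''. is_binary_expansion T q r \<^bold>\<and> maps T \<^bold>0 a)"

definition mu_is :: "ntm \<Rightarrow> ntm \<Rightarrow> fm" where
  "mu_is r a = (\<^bold>\<exists>\<^sub>s''T''. \<^bold>\<exists>''q''. is_binary_expansion T q r \<^bold>\<and> maps T q a)"

definition is_apart :: "stm \<Rightarrow> fm" where
  "is_apart X =
    (\<^bold>\<forall>''x''. \<^bold>\<forall>''y''. x \<^bold>\<in> X \<^bold>\<and> y \<^bold>\<in> X \<^bold>\<and> x \<^bold>< y \<^bold>\<longrightarrow>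
       (\<^bold>\<exists>''s''. \<^bold>\<exists>''t''. mu_is x s \<^bold>\<and> lambda_is y t \<^bold>\<and> s \<^bold>< t))"

text \<open>\<open>enumerates Y X\<close>: \<open>X = {Y(0) < Y(1) < Y(2) < \<dots>}\<close>.\<close>

definition enumerates :: "stm \<Rightarrow> stm \<Rightarrow> fm" where
  "enumerates Y X =
    (is_function is_nat is_nat Y \<^bold>\<and>
     (\<^bold>\<forall>''i''. \<^bold>\<forall>''j''. \<^bold>\<forall>''u''. \<^bold>\<forall>''v''. i \<^bold>< j \<^bold>\<and> maps Y i u \<^bold>\<and> maps Y j v \<^bold>\<longrightarrow> u \<^bold>< v) \<^bold>\<and>
     (\<^bold>\<forall>''u''. u \<^bold>\<in> X \<^bold>\<longleftrightarrow> (\<^bold>\<exists>''i''. maps Y i u)))"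

definition in_AS :: "ntm \<Rightarrow> stm \<Rightarrow> fm" where
  "in_AS r X = (\<^bold>\<exists>\<^sub>s''L''. enumerates L X \<^bold>\<and> (\<^bold>\<exists>''i''. \<^bold>\<exists>''j''. is_sum L i j r))"


section \<open>The principles\<close>

definition RT2 :: "nat \<Rightarrow> fm" where
  "RT2 k =
    (\<^bold>\<forall>\<^sub>s''F''. is_function is_increasing_pair (below k) F \<^bold>\<longrightarrow>
       (\<^bold>\<exists>\<^sub>s''J''. \<^bold>\<exists>''c''. is_infinite J \<^bold>\<and> below k c \<^bold>\<and>
          (\<^bold>\<forall>''x''. \<^bold>\<forall>''y''. x \<^bold>\<in> J \<^bold>\<and> y \<^bold>\<in> J \<^bold>\<and> x \<^bold>< y \<^bold>\<longrightarrow> maps F (pair x y) c)))"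

definition AHT :: "nat \<Rightarrow> fm" where
  "AHT k =
    (\<^bold>\<forall>\<^sub>s''C''. is_function is_nat (below k) C \<^bold>\<longrightarrow>
       (\<^bold>\<exists>\<^sub>s''H''. is_infinite H \<^bold>\<and> (\<^bold>\<forall>''x''. x \<^bold>\<in> H \<^bold>\<longrightarrow> \<^bold>0 \<^bold>< x) \<^bold>\<and> is_apart H \<^bold>\<and>
          (\<^bold>\<exists>''c''. below k c \<^bold>\<and> (\<^bold>\<forall>''s''. in_AS s H \<^bold>\<longrightarrow> maps C s c))))"

end

end

theory Submission
  imports Defs "HOL-Library.Countable_Set"
begin

text \<open>
  A completeness theorem for the calculus, proved by Henkin's method, reduces the claim to
  arbitrary models of \<open>RCA\<^sub>0\<close>, where one can argue semantically. In such a model, powers of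
  two are available as a set: finite approximations to \<open>x \<mapsto> 2\<^sup>x\<close> are coded by numbers,
  the code \<open>(a, b)\<close> containing \<open>n\<close> if \<open>(n + 1) b + 1\<close> divides \<open>a\<close>, so that the graph is
  \<open>\<Delta>\<^sup>0\<^sub>1\<close>-definable.

  Given \<open>C : \<nat> \<rightarrow> 2\<close>, colour \<open>x < y\<close> by \<open>C (2\<^sup>y - 2\<^sup>x)\<close> and let \<open>J\<close> be an infinite homogeneous
  set. The numbers \<open>2\<^sup>k - 2\<^sup>j\<close> with \<open>j < k\<close> successive in \<open>J\<close> form the required set: they are apart,
  as \<open>2\<^sup>k - 2\<^sup>j\<close> has its binary digits at the positions \<open>j, \<dots>, k - 1\<close>, and their adjacent sums
  telescope to numbers \<open>2\<^sup>k - 2\<^sup>j\<close> with \<open>j < k\<close> in \<open>J\<close>.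
\<close>

section \<open>Structural properties of the calculus\<close>

text \<open>The base theory has only addition, multiplication, \<open>Sigma01\<close> induction and
  comprehension for formulas with both a \<open>Sigma01\<close> and a \<open>Pi01\<close> form.
  There is no exponential to start with, and every inductive statement needs a form with one
  unbounded existential quantifier before a bounded matrix. Most formulas below get their shape from
  this. A function that is present as a set may occur as a parameter in bounded formulas; this makes
  facts about powers of two accessible to induction.

  Differences of powers are chosen because a sum of adjacent ones depends on its two end points
  alone, and a colouring of pairs controls no more than that. No enumeration of the resulting set is
  constructed: membership in \<open>in_AS\<close> supplies one, and the work consists in showing
  that any increasing enumeration lists the gaps of J in their natural order.

  A HOL statement cannot range over all carrier types. Completeness is therefore formulated for
  models whose numbers are the type \<open>nat\<close>, which is enough because the term models
  involved are countable and infinite.\<close>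

primrec tren :: "(nat \<Rightarrow> nat) \<Rightarrow> ntm \<Rightarrow> ntm" where
  "tren f (Var x) = Var x"
| "tren f (Par a) = Par (f a)"
| "tren f \<^bold>0 = \<^bold>0"
| "tren f \<^bold>1 = \<^bold>1"
| "tren f (s \<^bold>+ t) = tren f s \<^bold>+ tren f t"
| "tren f (s \<^bold>* t) = tren f s \<^bold>* tren f t"

primrec sren :: "(nat \<Rightarrow> nat) \<Rightarrow> stm \<Rightarrow> stm" where
  "sren g (SVar X) = SVar X"
| "sren g (SPar A) = SPar (g A)"

primrec ren :: "(nat \<Rightarrow> nat) \<Rightarrow> (nat \<Rightarrow> nat) \<Rightarrow> fm \<Rightarrow> fm" where
  "ren f g (s \<^bold>= t) = (tren f s \<^bold>= tren f t)"
| "ren f g (s \<^bold>< t) = (tren f s \<^bold>< tren f t)"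
| "ren f g (t \<^bold>\<in> S) = (tren f t \<^bold>\<in> sren g S)"
| "ren f g \<^bold>\<bottom> = \<^bold>\<bottom>"
| "ren f g (\<phi> \<^bold>\<longrightarrow> \<psi>) = (ren f g \<phi> \<^bold>\<longrightarrow> ren f g \<psi>)"
| "ren f g (\<^bold>\<forall>x. \<phi>) = (\<^bold>\<forall>x. ren f g \<phi>)"
| "ren f g (\<^bold>\<forall>\<^sub>sX. \<phi>) = (\<^bold>\<forall>\<^sub>sX. ren f g \<phi>)"

lemma tvars_tren [simp]: "tvars (tren f t) = tvars t"
  by (induction t) auto

lemma tren_cong: "(\<And>a. a \<in> tpars t \<Longrightarrow> f a = f' a) \<Longrightarrow> tren f t = tren f' t"
  by (induction t) auto

lemma sren_cong: "(\<And>A. A \<in> spars S \<Longrightarrow> g A = g' A) \<Longrightarrow> sren g S = sren g' S"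
  by (cases S) auto

lemma ren_cong:
  assumes "\<And>a. a \<in> fm_npars \<phi> \<Longrightarrow> f a = f' a" and "\<And>A. A \<in> fm_spars \<phi> \<Longrightarrow> g A = g' A"
  shows "ren f g \<phi> = ren f' g' \<phi>"
  using assms by (induction \<phi>) (auto intro: tren_cong sren_cong)

lemma tren_id [simp]: "tren (\<lambda>a. a) t = t"
  by (induction t) auto

lemma sren_id [simp]: "sren (\<lambda>A. A) S = S"
  by (cases S) auto

lemma ren_id [simp]: "ren (\<lambda>a. a) (\<lambda>A. A) \<phi> = \<phi>"
  by (induction \<phi>) auto

lemma tren_tsubst: "tren f (tsubst x r t) = tsubst x (tren f r) (tren f t)"
  by (induction t) auto

lemma ren_nsubst: "ren f g (nsubst x r \<phi>) = nsubst x (tren f r) (ren f g \<phi>)"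
  by (induction \<phi>) (auto simp: tren_tsubst)

lemma sren_SVar_iff [simp]: "sren g S = SVar X \<longleftrightarrow> S = SVar X"
  by (cases S) auto

lemma ren_ssubst: "ren f g (ssubst X R \<phi>) = ssubst X (sren g R) (ren f g \<phi>)"
  by (induction \<phi>) auto

lemma finite_tpars [simp]: "finite (tpars t)"
  by (induction t) auto

lemma finite_spars [simp]: "finite (spars S)"
  by (cases S) auto

lemma finite_fm_npars [simp]: "finite (fm_npars \<phi>)"
  by (induction \<phi>) auto

lemma finite_fm_spars [simp]: "finite (fm_spars \<phi>)"
  by (induction \<phi>) auto

definition fin_pars :: "fm set \<Rightarrow> bool" where
  "fin_pars \<Gamma> \<longleftrightarrow> finite (\<Union>\<phi>\<in>\<Gamma>. fm_npars \<phi>) \<and> finite (\<Union>\<phi>\<in>\<Gamma>. fm_spars \<phi>)"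

lemma fin_pars_insert [simp]: "fin_pars (insert \<phi> \<Gamma>) \<longleftrightarrow> fin_pars \<Gamma>"
  by (auto simp: fin_pars_def)

lemma finite_imp_fin_pars: "finite \<Gamma> \<Longrightarrow> fin_pars \<Gamma>"
  by (auto simp: fin_pars_def)

lemma fin_pars_fresh:
  assumes "fin_pars \<Gamma>"
  obtains a A where "a \<notin> (\<Union>\<psi>\<in>insert \<phi> \<Gamma>. fm_npars \<psi>)" "A \<notin> (\<Union>\<psi>\<in>insert \<phi> \<Gamma>. fm_spars \<psi>)"
proof -
  have "finite (\<Union>\<psi>\<in>insert \<phi> \<Gamma>. fm_npars \<psi>)" "finite (\<Union>\<psi>\<in>insert \<phi> \<Gamma>. fm_spars \<psi>)"
    using assms by (auto simp: fin_pars_def)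
  then show ?thesis
    using that ex_new_if_finite[OF infinite_UNIV_nat] by metis
qed

text \<open>
  Weakening is proved together with renaming of parameters, since the eigenparameters of a
  derivation may occur in the additional hypotheses. Finitely many parameters are needed: from
  hypotheses containing all of them no generalization is possible.
\<close>

lemma derives_ren:
  assumes "\<Gamma> \<turnstile> \<phi>" and "ren f g ` \<Gamma> \<subseteq> \<Gamma>'" and "fin_pars \<Gamma>'"
  shows "\<Gamma>' \<turnstile> ren f g \<phi>"
  using assms
proof (induction arbitrary: f g \<Gamma>' rule: derives.induct)
  case (Assm \<phi> \<Gamma>)
  then show ?case by (auto intro: derives.Assm)
next
  case (ImpI \<phi> \<Gamma> \<psi>)
  then have "insert (ren f g \<phi>) \<Gamma>' \<turnstile> ren f g \<psi>"
    by (intro ImpI.IH) auto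
  then show ?case by (auto intro: derives.ImpI)
next
  case (ImpE \<Gamma> \<phi> \<psi>)
  from ImpE.IH[OF ImpE.prems] show ?case unfolding ren.simps by (rule derives.ImpE)
next
  case (Raa \<phi> \<Gamma>)
  then have "insert (\<^bold>\<not> ren f g \<phi>) \<Gamma>' \<turnstile> ren f g \<^bold>\<bottom>"
    by (intro Raa.IH) auto
  then show ?case by (auto intro: derives.Raa)
next
  case (AllNI \<Gamma> x a \<phi>)
  obtain b where b: "b \<notin> (\<Union>\<psi>\<in>insert (ren f g \<phi>) \<Gamma>'. fm_npars \<psi>)"
    using fin_pars_fresh[OF AllNI.prems(2)] by metis
  \<comment> \<open>The eigenparameter \<open>a\<close> is redirected to a parameter
    \<open>b\<close> that is fresh for the larger context. As \<open>a\<close> occurs neither in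
    \<open>\<phi>\<close> nor in \<open>\<Gamma>\<close>, the redirection is invisible
    there.\<close>
  have eq: "ren (f(a := b)) g \<psi> = ren f g \<psi>" if "\<psi> \<in> insert \<phi> \<Gamma>" for \<psi>
    using that AllNI.hyps(2) by (intro ren_cong) auto
  then have "ren (f(a := b)) g ` \<Gamma> \<subseteq> \<Gamma>'"
    using AllNI.prems(1) by auto
  then have "\<Gamma>' \<turnstile> ren (f(a := b)) g (nsubst x (Par a) \<phi>)"
    by (intro AllNI.IH AllNI.prems(2))
  then have "\<Gamma>' \<turnstile> nsubst x (Par b) (ren f g \<phi>)"
    by (simp add: ren_nsubst eq)
  then show ?case
    using b by (auto intro: derives.AllNI)
next
  case (AllNE \<Gamma> x \<phi> t)
  from AllNE.IH[OF AllNE.prems] AllNE.hyps show ?case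
    unfolding ren_nsubst by (intro derives.AllNE) simp_all
next
  case (AllSI \<Gamma> X A \<phi>)
  obtain B where B: "B \<notin> (\<Union>\<psi>\<in>insert (ren f g \<phi>) \<Gamma>'. fm_spars \<psi>)"
    using fin_pars_fresh[OF AllSI.prems(2)] by metis
  have eq: "ren f (g(A := B)) \<psi> = ren f g \<psi>" if "\<psi> \<in> insert \<phi> \<Gamma>" for \<psi>
    using that AllSI.hyps(2) by (intro ren_cong) auto
  then have "ren f (g(A := B)) ` \<Gamma> \<subseteq> \<Gamma>'"
    using AllSI.prems(1) by auto
  then have "\<Gamma>' \<turnstile> ren f (g(A := B)) (ssubst X (SPar A) \<phi>)"
    by (intro AllSI.IH AllSI.prems(2))
  then have "\<Gamma>' \<turnstile> ssubst X (SPar B) (ren f g \<phi>)"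
    by (simp add: ren_ssubst eq)
  then show ?case
    using B by (auto intro: derives.AllSI)
next
  case (AllSE \<Gamma> X \<phi> A)
  from AllSE.IH[OF AllSE.prems] show ?case
    unfolding ren_ssubst sren.simps ren.simps by (rule derives.AllSE)
next
  case (EqI \<Gamma> t)
  then show ?case by (auto intro: derives.EqI)
next
  case (EqE \<Gamma> s t x \<phi>)
  from EqE.IH[OF EqE.prems] have "\<Gamma>' \<turnstile> (tren f s \<^bold>= tren f t)"
    "\<Gamma>' \<turnstile> nsubst x (tren f s) (ren f g \<phi>)"
    by (simp_all add: ren_nsubst)
  then show ?case
    unfolding ren_nsubst by (rule derives.EqE) (simp_all add: EqE.hyps)
qed

lemma weakening:
  assumes "\<Gamma> \<turnstile> \<phi>" and "\<Gamma> \<subseteq> \<Gamma>'" and "fin_pars \<Gamma>'"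
  shows "\<Gamma>' \<turnstile> \<phi>"
  using derives_ren[OF assms(1), of "\<lambda>a. a" "\<lambda>A. A" \<Gamma>'] assms by simp

lemma derives_finite:
  assumes "\<Gamma> \<turnstile> \<phi>"
  shows "\<exists>F. finite F \<and> F \<subseteq> \<Gamma> \<and> (F \<turnstile> \<phi>)"
  using assms
proof (induction rule: derives.induct)
  case (Assm \<phi> \<Gamma>)
  then show ?case by (intro exI[of _ "{\<phi>}"]) (auto intro: derives.Assm)
next
  case (ImpI \<phi> \<Gamma> \<psi>)
  then obtain F where F: "finite F" "F \<subseteq> insert \<phi> \<Gamma>" "F \<turnstile> \<psi>" by blast
  \<comment> \<open>The finite support may or may not contain the discharged hypothesis; deleting
    and reinserting it treats both cases at once.\<close>
  then have "insert \<phi> (F - {\<phi>}) \<turnstile> \<psi>"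
    by (intro weakening[OF F(3)] finite_imp_fin_pars) auto
  then show ?case
    using F by (intro exI[of _ "F - {\<phi>}"]) (auto intro: derives.ImpI)
next
  case (ImpE \<Gamma> \<phi> \<psi>)
  then obtain F F' where F: "finite F" "F \<subseteq> \<Gamma>" "F \<turnstile> (\<phi> \<^bold>\<longrightarrow> \<psi>)"
    and F': "finite F'" "F' \<subseteq> \<Gamma>" "F' \<turnstile> \<phi>" by blast
  have "F \<union> F' \<turnstile> (\<phi> \<^bold>\<longrightarrow> \<psi>)" "F \<union> F' \<turnstile> \<phi>"
    using F F' by (auto intro: weakening finite_imp_fin_pars)
  then have "F \<union> F' \<turnstile> \<psi>" by (rule derives.ImpE)
  then show ?case
    using F F' by (intro exI[of _ "F \<union> F'"]) auto
next
  case (Raa \<phi> \<Gamma>)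
  then obtain F where F: "finite F" "F \<subseteq> insert (\<^bold>\<not> \<phi>) \<Gamma>" "F \<turnstile> \<^bold>\<bottom>" by blast
  then have "insert (\<^bold>\<not> \<phi>) (F - {\<^bold>\<not> \<phi>}) \<turnstile> \<^bold>\<bottom>"
    by (intro weakening[OF F(3)] finite_imp_fin_pars) auto
  then show ?case
    using F by (intro exI[of _ "F - {\<^bold>\<not> \<phi>}"]) (auto intro: derives.Raa)
next
  case (AllNI \<Gamma> x a \<phi>)
  then obtain F where F: "finite F" "F \<subseteq> \<Gamma>" "F \<turnstile> nsubst x (Par a) \<phi>" by blast
  then have "F \<turnstile> (\<^bold>\<forall>x. \<phi>)"
    using AllNI.hyps by (intro derives.AllNI[OF F(3)]) auto
  then show ?case using F by blast
next
  case (AllNE \<Gamma> x \<phi> t)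
  then show ?case by (blast intro: derives.AllNE)
next
  case (AllSI \<Gamma> X A \<phi>)
  then obtain F where F: "finite F" "F \<subseteq> \<Gamma>" "F \<turnstile> ssubst X (SPar A) \<phi>" by blast
  then have "F \<turnstile> (\<^bold>\<forall>\<^sub>sX. \<phi>)"
    using AllSI.hyps by (intro derives.AllSI[OF F(3)]) auto
  then show ?case using F by blast
next
  case (AllSE \<Gamma> X \<phi> A)
  then show ?case by (blast intro: derives.AllSE)
next
  case (EqI \<Gamma> t)
  then show ?case by (blast intro: derives.EqI)
next
  case (EqE \<Gamma> s t x \<phi>)
  then obtain F F' where F: "finite F" "F \<subseteq> \<Gamma>" "F \<turnstile> (s \<^bold>= t)"
    and F': "finite F'" "F' \<subseteq> \<Gamma>" "F' \<turnstile> nsubst x s \<phi>" by blast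
  have "F \<union> F' \<turnstile> (s \<^bold>= t)" "F \<union> F' \<turnstile> nsubst x s \<phi>"
    using F F' by (auto intro: weakening finite_imp_fin_pars)
  then have "F \<union> F' \<turnstile> nsubst x t \<phi>"
    using EqE.hyps(3,4) by (rule derives.EqE)
  then show ?case
    using F F' by (intro exI[of _ "F \<union> F'"]) auto
qed

section \<open>Henkin extensions\<close>

definition consistent :: "fm set \<Rightarrow> bool" where
  "consistent \<Gamma> \<longleftrightarrow> \<not> (\<Gamma> \<turnstile> \<^bold>\<bottom>)"

lemma consistentD:
  "consistent \<Gamma> \<Longrightarrow> \<Gamma> \<turnstile> (\<^bold>\<not> \<phi>) \<Longrightarrow> \<Gamma> \<turnstile> \<phi> \<Longrightarrow> False"
  unfolding consistent_def by (blast intro: derives.ImpE[of \<Gamma> \<phi> "\<^bold>\<bottom>"])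

text \<open>If adding the counterexample were contradictory, \<open>Raa\<close> would prove the
  instance at the fresh \<open>a\<close> and generalisation the universal formula, whose negation is
  a member of \<open>\<Gamma>\<close>.\<close>

lemma consistent_nwitness:
  assumes "consistent \<Gamma>" and "(\<^bold>\<not> (\<^bold>\<forall>x. \<phi>)) \<in> \<Gamma>" and "a \<notin> (\<Union>\<psi>\<in>\<Gamma>. fm_npars \<psi>)"
  shows "consistent (insert (\<^bold>\<not> nsubst x (Par a) \<phi>) \<Gamma>)"
proof -
  have "False" if "insert (\<^bold>\<not> nsubst x (Par a) \<phi>) \<Gamma> \<turnstile> \<^bold>\<bottom>"
  proof -
    have "a \<notin> (\<Union>\<psi>\<in>insert \<phi> \<Gamma>. fm_npars \<psi>)"
      using assms(2,3) by fastforce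
    with derives.Raa[OF that] have "\<Gamma> \<turnstile> (\<^bold>\<forall>x. \<phi>)"
      by (rule derives.AllNI)
    then show False
      using consistentD[OF assms(1)] derives.Assm[OF assms(2)] by blast
  qed
  then show ?thesis by (auto simp: consistent_def)
qed

lemma consistent_switness:
  assumes "consistent \<Gamma>" and "(\<^bold>\<not> (\<^bold>\<forall>\<^sub>sX. \<phi>)) \<in> \<Gamma>" and "A \<notin> (\<Union>\<psi>\<in>\<Gamma>. fm_spars \<psi>)"
  shows "consistent (insert (\<^bold>\<not> ssubst X (SPar A) \<phi>) \<Gamma>)"
proof -
  have "False" if "insert (\<^bold>\<not> ssubst X (SPar A) \<phi>) \<Gamma> \<turnstile> \<^bold>\<bottom>"
  proof -
    have "A \<notin> (\<Union>\<psi>\<in>insert \<phi> \<Gamma>. fm_spars \<psi>)"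
      using assms(2,3) by fastforce
    with derives.Raa[OF that] have "\<Gamma> \<turnstile> (\<^bold>\<forall>\<^sub>sX. \<phi>)"
      by (rule derives.AllSI)
    then show False
      using consistentD[OF assms(1)] derives.Assm[OF assms(2)] by blast
  qed
  then show ?thesis by (auto simp: consistent_def)
qed

instance ntm :: countable by countable_datatype
instance stm :: countable by countable_datatype
instance fm :: countable by countable_datatype

text \<open>Closure is stated for finite sets of premises, because a derivation from a subset need
  not survive weakening to a set in which every parameter may occur.\<close>

definition henkin :: "fm set \<Rightarrow> bool" where
  "henkin \<Delta> \<longleftrightarrow> consistent \<Delta> \<and> (\<forall>F \<phi>. finite F \<and> F \<subseteq> \<Delta> \<and> (F \<turnstile> \<phi>) \<longrightarrow> \<phi> \<in> \<Delta>) \<and>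
     (\<forall>\<phi>. \<phi> \<notin> \<Delta> \<longrightarrow> (\<^bold>\<not> \<phi>) \<in> \<Delta>) \<and>
     (\<forall>x \<phi>. (\<^bold>\<not> (\<^bold>\<forall>x. \<phi>)) \<in> \<Delta> \<longrightarrow> (\<exists>a. (\<^bold>\<not> nsubst x (Par a) \<phi>) \<in> \<Delta>)) \<and>
     (\<forall>X \<phi>. (\<^bold>\<not> (\<^bold>\<forall>\<^sub>sX. \<phi>)) \<in> \<Delta> \<longrightarrow> (\<exists>A. (\<^bold>\<not> ssubst X (SPar A) \<phi>) \<in> \<Delta>))"

text \<open>One stage settles a single formula and, if this is a negated universal formula that gets
  accepted, supplies the counterexample at once. Keeping \<open>fin_pars\<close> ensures fresh
  parameters for the next stage.\<close>

definition henkin_step :: "fm \<Rightarrow> fm set \<Rightarrow> fm set \<Rightarrow> bool" where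
  "henkin_step \<phi> \<Gamma> \<Gamma>' \<longleftrightarrow> \<Gamma> \<subseteq> \<Gamma>' \<and> fin_pars \<Gamma>' \<and> consistent \<Gamma>' \<and>
     (\<phi> \<in> \<Gamma>' \<or> \<not> consistent (insert \<phi> \<Gamma>)) \<and>
     (\<phi> \<in> \<Gamma>' \<longrightarrow>
       (\<forall>x \<psi>. \<phi> = (\<^bold>\<not> (\<^bold>\<forall>x. \<psi>)) \<longrightarrow> (\<exists>a. (\<^bold>\<not> nsubst x (Par a) \<psi>) \<in> \<Gamma>')) \<and>
       (\<forall>X \<psi>. \<phi> = (\<^bold>\<not> (\<^bold>\<forall>\<^sub>sX. \<psi>)) \<longrightarrow> (\<exists>A. (\<^bold>\<not> ssubst X (SPar A) \<psi>) \<in> \<Gamma>')))"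

lemma henkin_step_exists:
  assumes "fin_pars \<Gamma>" and "consistent \<Gamma>"
  shows "\<exists>\<Gamma>'. henkin_step \<phi> \<Gamma> \<Gamma>'"
proof (cases "consistent (insert \<phi> \<Gamma>)")
  case False
  then have "\<phi> \<notin> \<Gamma>"
    using assms by (auto simp: insert_absorb)
  then show ?thesis
    using assms False by (intro exI[of _ \<Gamma>]) (auto simp: henkin_step_def)
next
  case True
  obtain a A where a: "a \<notin> (\<Union>\<psi>\<in>insert \<phi> \<Gamma>. fm_npars \<psi>)" and A: "A \<notin> (\<Union>\<psi>\<in>insert \<phi> \<Gamma>. fm_spars \<psi>)"
    using fin_pars_fresh[OF assms(1)] by metis
  consider (N) x \<psi> where "\<phi> = (\<^bold>\<not> (\<^bold>\<forall>x. \<psi>))" | (S) X \<psi> where "\<phi> = (\<^bold>\<not> (\<^bold>\<forall>\<^sub>sX. \<psi>))"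
    | (other) "\<nexists>x \<psi>. \<phi> = (\<^bold>\<not> (\<^bold>\<forall>x. \<psi>))" "\<nexists>X \<psi>. \<phi> = (\<^bold>\<not> (\<^bold>\<forall>\<^sub>sX. \<psi>))"
    by blast
  then show ?thesis
  proof cases
    case N
    have "consistent (insert (\<^bold>\<not> nsubst x (Par a) \<psi>) (insert \<phi> \<Gamma>))"
      using True a N by (intro consistent_nwitness) auto
    then show ?thesis
      using assms N by (intro exI[of _ "insert (\<^bold>\<not> nsubst x (Par a) \<psi>) (insert \<phi> \<Gamma>)"])
        (auto simp: henkin_step_def)
  next
    case S
    have "consistent (insert (\<^bold>\<not> ssubst X (SPar A) \<psi>) (insert \<phi> \<Gamma>))"
      using True A S by (intro consistent_switness) auto
    then show ?thesis
      using assms S by (intro exI[of _ "insert (\<^bold>\<not> ssubst X (SPar A) \<psi>) (insert \<phi> \<Gamma>)"])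
        (auto simp: henkin_step_def)
  next
    case other
    then show ?thesis
      using assms True by (intro exI[of _ "insert \<phi> \<Gamma>"]) (auto simp: henkin_step_def)
  qed
qed

lemma henkin_step_refutes:
  "henkin_step \<phi> \<Gamma> \<Gamma>' \<Longrightarrow> \<phi> \<notin> \<Gamma>' \<Longrightarrow> \<Gamma> \<turnstile> (\<^bold>\<not> \<phi>)"
  by (auto simp: henkin_step_def consistent_def intro: derives.ImpI)

lemma henkin_step_nwit:
  "henkin_step (\<^bold>\<not> (\<^bold>\<forall>x. \<psi>)) \<Gamma> \<Gamma>' \<Longrightarrow> (\<^bold>\<not> (\<^bold>\<forall>x. \<psi>)) \<in> \<Gamma>' \<Longrightarrow> \<exists>a. (\<^bold>\<not> nsubst x (Par a) \<psi>) \<in> \<Gamma>'"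
  by (simp add: henkin_step_def)

lemma henkin_step_swit:
  "henkin_step (\<^bold>\<not> (\<^bold>\<forall>\<^sub>sX. \<psi>)) \<Gamma> \<Gamma>' \<Longrightarrow> (\<^bold>\<not> (\<^bold>\<forall>\<^sub>sX. \<psi>)) \<in> \<Gamma>' \<Longrightarrow>
    \<exists>A. (\<^bold>\<not> ssubst X (SPar A) \<psi>) \<in> \<Gamma>'"
  by (simp add: henkin_step_def)

text \<open>Lindenbaum's construction along an enumeration of all formulas, interleaved with Henkin
  witnesses. Deductions are brought down to a stage, where weakening applies, instead of being made
  in the union.\<close>

lemma henkin_extension:
  assumes "fin_pars \<Gamma>" and "consistent \<Gamma>"
  obtains \<Delta> where "\<Gamma> \<subseteq> \<Delta>" and "henkin \<Delta>"
proof -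
  define G where "G = rec_nat \<Gamma> (\<lambda>n \<Gamma>'. SOME \<Gamma>''. henkin_step (from_nat n) \<Gamma>' \<Gamma>'')"
  have G0: "G 0 = \<Gamma>" by (simp add: G_def)
  have GSuc: "G (Suc n) = (SOME \<Gamma>''. henkin_step (from_nat n) (G n) \<Gamma>'')" for n by (simp add: G_def)
  have inv: "fin_pars (G n) \<and> consistent (G n)" for n
  proof (induction n)
    case 0
    then show ?case using assms by (simp add: G0)
  next
    case (Suc n)
    then have "henkin_step (from_nat n) (G n) (G (Suc n))"
      unfolding GSuc by (intro someI_ex[OF henkin_step_exists]) auto
    then show ?case by (auto simp: henkin_step_def)
  qed
  have step: "henkin_step (from_nat n) (G n) (G (Suc n))" for n
    unfolding GSuc using inv by (intro someI_ex[OF henkin_step_exists]) auto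
  have mono: "G m \<subseteq> G n" if "m \<le> n" for m n
    using step that lift_Suc_mono_le[of G] by (simp add: henkin_step_def)
  define \<Delta> where "\<Delta> = (\<Union>n. G n)"
  have fin: "\<exists>n. F \<subseteq> G n" if "finite F" "F \<subseteq> \<Delta>" for F
    using that
  proof (induction F)
    case (insert \<phi> F)
    then obtain m n where "F \<subseteq> G n" "\<phi> \<in> G m" by (auto simp: \<Delta>_def)
    then have "insert \<phi> F \<subseteq> G (max m n)"
      using mono[of m "max m n"] mono[of n "max m n"] by auto
    then show ?case by blast
  qed simp
  have refutes_at: "G (to_nat \<phi>) \<turnstile> (\<^bold>\<not> \<phi>)" if "\<phi> \<notin> G (Suc (to_nat \<phi>))" for \<phi>
    using henkin_step_refutes[OF step[of "to_nat \<phi>", unfolded from_nat_to_nat] that] .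
  then have refutes: "\<exists>m. (G m \<turnstile> (\<^bold>\<not> \<phi>))" if "\<phi> \<notin> \<Delta>" for \<phi>
    using that by (auto simp: \<Delta>_def)
  have closed: "\<phi> \<in> \<Delta>" if "G n \<turnstile> \<phi>" for \<phi> n
  proof (rule ccontr)
    assume nin: "\<phi> \<notin> \<Delta>"
    obtain m where "G m \<turnstile> (\<^bold>\<not> \<phi>)"
      using refutes[OF nin] by blast
    then have "G (max m n) \<turnstile> (\<^bold>\<not> \<phi>)"
      by (rule weakening) (simp_all add: mono inv)
    moreover have "G (max m n) \<turnstile> \<phi>"
      using that by (rule weakening) (simp_all add: mono inv)
    ultimately show False
      using consistentD[OF inv[THEN conjunct2]] by blast
  qed
  have closed': "\<phi> \<in> \<Delta>" if F: "finite F" "F \<subseteq> \<Delta>" "F \<turnstile> \<phi>" for F \<phi>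
  proof -
    obtain n where "F \<subseteq> G n" using fin F by blast
    then have "G n \<turnstile> \<phi>" using weakening[OF F(3)] inv by blast
    then show ?thesis by (rule closed)
  qed
  have cons: "consistent \<Delta>"
    unfolding consistent_def
  proof
    assume "\<Delta> \<turnstile> \<^bold>\<bottom>"
    then obtain F where F: "finite F" "F \<subseteq> \<Delta>" "F \<turnstile> \<^bold>\<bottom>" using derives_finite by blast
    then obtain n where "F \<subseteq> G n" using fin by blast
    then have "G n \<turnstile> \<^bold>\<bottom>" using weakening[OF F(3)] inv by blast
    then show False using inv by (auto simp: consistent_def)
  qed
  have complete: "(\<^bold>\<not> \<phi>) \<in> \<Delta>" if "\<phi> \<notin> \<Delta>" for \<phi>
    using refutes[OF that] closed by blast
  \<comment> \<open>A formula may enter as the witness of another one, outside its own turn. It is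
    nevertheless present right after its turn, since rejection would have meant refutation; and that
    turn is when its own witness is supplied.\<close>
  have stage: "\<phi> \<in> G (Suc (to_nat \<phi>))" if mem: "\<phi> \<in> \<Delta>" for \<phi>
  proof (rule ccontr)
    assume "\<phi> \<notin> G (Suc (to_nat \<phi>))"
    note neg = refutes_at[OF this]
    obtain n where "\<phi> \<in> G n" using mem unfolding \<Delta>_def by blast
    then have "G n \<turnstile> \<phi>" by (rule derives.Assm)
    then have "G (max n (to_nat \<phi>)) \<turnstile> \<phi>"
      by (rule weakening) (simp_all add: mono inv)
    moreover have "G (max n (to_nat \<phi>)) \<turnstile> (\<^bold>\<not> \<phi>)"
      using neg by (rule weakening) (simp_all add: mono inv)
    ultimately show False
      using consistentD[OF inv[THEN conjunct2]] by blast
  qed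
  have nwit: "\<exists>a. (\<^bold>\<not> nsubst x (Par a) \<phi>) \<in> \<Delta>" if "(\<^bold>\<not> (\<^bold>\<forall>x. \<phi>)) \<in> \<Delta>" for x \<phi>
    using henkin_step_nwit[OF step[of "to_nat (\<^bold>\<not> (\<^bold>\<forall>x. \<phi>))", unfolded from_nat_to_nat] stage[OF that]]
    by (auto simp: \<Delta>_def)
  have swit: "\<exists>A. (\<^bold>\<not> ssubst X (SPar A) \<phi>) \<in> \<Delta>" if "(\<^bold>\<not> (\<^bold>\<forall>\<^sub>sX. \<phi>)) \<in> \<Delta>" for X \<phi>
    using henkin_step_swit[OF step[of "to_nat (\<^bold>\<not> (\<^bold>\<forall>\<^sub>sX. \<phi>))", unfolded from_nat_to_nat] stage[OF that]]
    by (auto simp: \<Delta>_def)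
  have "henkin \<Delta>"
    unfolding henkin_def
  proof (intro conjI allI impI)
    show "\<phi> \<in> \<Delta>" if "finite F \<and> F \<subseteq> \<Delta> \<and> (F \<turnstile> \<phi>)" for F \<phi>
      using that closed' by blast
  qed (fact cons complete nwit swit)+
  moreover have "\<Gamma> \<subseteq> \<Delta>"
    using G0 by (auto simp: \<Delta>_def)
  ultimately show ?thesis using that by blast
qed

section \<open>Structures for second-order arithmetic\<close>

locale so_structure =
  fixes zero :: 'n ("\<zero>")
    and one :: 'n ("\<one>")
    and add :: "'n \<Rightarrow> 'n \<Rightarrow> 'n" (infixl "\<oplus>" 65)
    and mul :: "'n \<Rightarrow> 'n \<Rightarrow> 'n" (infixl "\<otimes>" 70)
    and lt :: "'n \<Rightarrow> 'n \<Rightarrow> bool" (infix "\<prec>" 50)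
    and sets :: "'n set set"
    and npar :: "nat \<Rightarrow> 'n"
    and spar :: "nat \<Rightarrow> 'n set"
begin

primrec teval :: "(name \<Rightarrow> 'n) \<Rightarrow> ntm \<Rightarrow> 'n" where
  "teval e (Var x) = e x"
| "teval e (Par a) = npar a"
| "teval e \<^bold>0 = \<zero>"
| "teval e \<^bold>1 = \<one>"
| "teval e (s \<^bold>+ t) = teval e s \<oplus> teval e t"
| "teval e (s \<^bold>* t) = teval e s \<otimes> teval e t"

primrec seval :: "(name \<Rightarrow> 'n set) \<Rightarrow> stm \<Rightarrow> 'n set" where
  "seval E (SVar X) = E X"
| "seval E (SPar A) = spar A"

primrec sat :: "(name \<Rightarrow> 'n) \<Rightarrow> (name \<Rightarrow> 'n set) \<Rightarrow> fm \<Rightarrow> bool" where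
  "sat e E (s \<^bold>= t) \<longleftrightarrow> teval e s = teval e t"
| "sat e E (s \<^bold>< t) \<longleftrightarrow> teval e s \<prec> teval e t"
| "sat e E (t \<^bold>\<in> S) \<longleftrightarrow> teval e t \<in> seval E S"
| "sat e E \<^bold>\<bottom> \<longleftrightarrow> False"
| "sat e E (\<phi> \<^bold>\<longrightarrow> \<psi>) \<longleftrightarrow> (sat e E \<phi> \<longrightarrow> sat e E \<psi>)"
| "sat e E (\<^bold>\<forall>x. \<phi>) \<longleftrightarrow> (\<forall>a. sat (e(x := a)) E \<phi>)"
| "sat e E (\<^bold>\<forall>\<^sub>sX. \<phi>) \<longleftrightarrow> (\<forall>A\<in>sets. sat e (E(X := A)) \<phi>)"

lemma teval_upd [simp]: "x \<notin> tvars t \<Longrightarrow> teval (e(x := a)) t = teval e t"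
  by (induction t) auto

lemma seval_upd [simp]: "X \<notin> svars S \<Longrightarrow> seval (E(X := A)) S = seval E S"
  by (cases S) auto

lemma teval_tsubst: "teval e (tsubst x r t) = teval (e(x := teval e r)) t"
  by (induction t) auto

text \<open>The case \<open>tvars r = {x}\<close> is needed for the induction axioms, which substitute \<open>n + 1\<close> for \<open>n\<close>.\<close>

lemma sat_nsubst:
  "tvars r \<subseteq> {x} \<Longrightarrow> sat e E (nsubst x r \<phi>) = sat (e(x := teval e r)) E \<phi>"
proof (induction \<phi> arbitrary: e E)
  case (AllN y \<phi>)
  show ?case
  proof (cases "y = x")
    case False
    then have "teval (e(y := a)) r = teval e r" for a
      using AllN.prems by (intro teval_upd) auto
    then have "sat (e(y := a)) E (nsubst x r \<phi>) = sat (e(x := teval e r, y := a)) E \<phi>" for a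
      using AllN.IH[OF AllN.prems] fun_upd_twist[OF False] by metis
    then show ?thesis using False by (simp only: nsubst.simps sat.simps if_False)
  next
    case True
    then show ?thesis by (simp only: nsubst.simps sat.simps refl if_True fun_upd_upd simp_thms)
  qed
qed (simp_all add: teval_tsubst)

lemma sat_ssubst:
  "svars R = {} \<Longrightarrow> sat e E (ssubst X R \<phi>) = sat e (E(X := seval E R)) \<phi>"
proof (induction \<phi> arbitrary: e E)
  case (Mem t S)
  then show ?case by (cases S) auto
next
  case (AllS Y \<phi>)
  show ?case
  proof (cases "Y = X")
    case False
    then have "sat e (E(Y := A)) (ssubst X R \<phi>) = sat e (E(X := seval E R, Y := A)) \<phi>" for A
      using AllS.IH[OF AllS.prems] AllS.prems fun_upd_twist[OF False] seval_upd[of Y R] by (metis empty_iff)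
    then show ?thesis using False by (simp only: ssubst.simps sat.simps if_False)
  next
    case True
    then show ?thesis by (simp only: ssubst.simps sat.simps refl if_True fun_upd_upd simp_thms)
  qed
qed simp_all

lemma teval_cong: "(\<And>x. x \<in> tvars t \<Longrightarrow> e x = e' x) \<Longrightarrow> teval e t = teval e' t"
  by (induction t) auto

lemma seval_cong: "(\<And>X. X \<in> svars S \<Longrightarrow> E X = E' X) \<Longrightarrow> seval E S = seval E' S"
  by (cases S) auto

lemma sat_cong:
  assumes "\<And>x. x \<in> free_nvars \<phi> \<Longrightarrow> e x = e' x" and "\<And>X. X \<in> free_svars \<phi> \<Longrightarrow> E X = E' X"
  shows "sat e E \<phi> = sat e' E' \<phi>"
  using assms
proof (induction \<phi> arbitrary: e e' E E')
  case (Eq s t)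
  then have "teval e s = teval e' s" "teval e t = teval e' t"
    by (auto intro!: teval_cong)
  then show ?case by simp
next
  case (Less s t)
  then have "teval e s = teval e' s" "teval e t = teval e' t"
    by (auto intro!: teval_cong)
  then show ?case by simp
next
  case (Mem t S)
  then have "teval e t = teval e' t" "seval E S = seval E' S"
    by (auto intro!: teval_cong seval_cong)
  then show ?case by simp
next
  case Falsum
  then show ?case by simp
next
  case (Imp \<phi> \<psi>)
  have "sat e E \<phi> = sat e' E' \<phi>"
    using Imp.prems by (intro Imp.IH(1)) auto
  moreover have "sat e E \<psi> = sat e' E' \<psi>"
    using Imp.prems by (intro Imp.IH(2)) auto
  ultimately show ?case by simp
next
  case (AllN x \<phi>)
  have "sat (e(x := a)) E \<phi> = sat (e'(x := a)) E' \<phi>" for a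
    using AllN.prems by (intro AllN.IH) auto
  then show ?case by simp
next
  case (AllS X \<phi>)
  have "sat e (E(X := A)) \<phi> = sat e' (E'(X := A)) \<phi>" for A
    using AllS.prems by (intro AllS.IH) auto
  then show ?case by simp
qed

end


section \<open>Completeness\<close>

locale henkin_set =
  fixes \<Delta> :: "fm set"
  assumes henkin: "henkin \<Delta>"
begin

lemma closed: "finite F \<Longrightarrow> F \<subseteq> \<Delta> \<Longrightarrow> F \<turnstile> \<phi> \<Longrightarrow> \<phi> \<in> \<Delta>"
  using henkin unfolding henkin_def by blast

lemma falsum_notin: "\<^bold>\<bottom> \<notin> \<Delta>"
  using henkin derives.Assm unfolding henkin_def consistent_def by blast

lemma neg_in: "\<phi> \<notin> \<Delta> \<Longrightarrow> (\<^bold>\<not> \<phi>) \<in> \<Delta>"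
  using henkin unfolding henkin_def by blast

lemma nwitness: "(\<^bold>\<not> (\<^bold>\<forall>x. \<phi>)) \<in> \<Delta> \<Longrightarrow> \<exists>a. (\<^bold>\<not> nsubst x (Par a) \<phi>) \<in> \<Delta>"
  using henkin unfolding henkin_def by blast

lemma switness: "(\<^bold>\<not> (\<^bold>\<forall>\<^sub>sX. \<phi>)) \<in> \<Delta> \<Longrightarrow> \<exists>A. (\<^bold>\<not> ssubst X (SPar A) \<phi>) \<in> \<Delta>"
  using henkin unfolding henkin_def by blast

lemma mp: assumes "(\<phi> \<^bold>\<longrightarrow> \<psi>) \<in> \<Delta>" and "\<phi> \<in> \<Delta>" shows "\<psi> \<in> \<Delta>"
proof (rule closed)
  show "{\<phi> \<^bold>\<longrightarrow> \<psi>, \<phi>} \<turnstile> \<psi>"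
    by (rule derives.ImpE[OF derives.Assm derives.Assm, of \<phi>]) simp_all
qed (use assms in auto)

lemma imp_iff: "(\<phi> \<^bold>\<longrightarrow> \<psi>) \<in> \<Delta> \<longleftrightarrow> (\<phi> \<in> \<Delta> \<longrightarrow> \<psi> \<in> \<Delta>)"
proof
  assume *: "\<phi> \<in> \<Delta> \<longrightarrow> \<psi> \<in> \<Delta>"
  show "(\<phi> \<^bold>\<longrightarrow> \<psi>) \<in> \<Delta>"
  proof (cases "\<phi> \<in> \<Delta>")
    case True
    have "{\<psi>} \<turnstile> (\<phi> \<^bold>\<longrightarrow> \<psi>)"
      by (rule derives.ImpI, rule derives.Assm) simp
    then show ?thesis using True * by (intro closed[of "{\<psi>}"]) auto
  next
    case False
    have "insert (\<^bold>\<not> \<psi>) (insert \<phi> {\<^bold>\<not> \<phi>}) \<turnstile> \<^bold>\<bottom>"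
    proof (rule derives.ImpE)
      show "insert (\<^bold>\<not> \<psi>) (insert \<phi> {\<^bold>\<not> \<phi>}) \<turnstile> (\<^bold>\<not> \<phi>)" by (rule derives.Assm) simp
      show "insert (\<^bold>\<not> \<psi>) (insert \<phi> {\<^bold>\<not> \<phi>}) \<turnstile> \<phi>" by (rule derives.Assm) simp
    qed
    then have "{\<^bold>\<not> \<phi>} \<turnstile> (\<phi> \<^bold>\<longrightarrow> \<psi>)"
      by (rule derives.ImpI[OF derives.Raa])
    then show ?thesis using neg_in[OF False] by (intro closed[of "{\<^bold>\<not> \<phi>}"]) auto
  qed
qed (auto intro: mp)

lemma neg_iff: "(\<^bold>\<not> \<phi>) \<in> \<Delta> \<longleftrightarrow> \<phi> \<notin> \<Delta>"
  using imp_iff falsum_notin by blast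

lemma AllN_inst: assumes "(\<^bold>\<forall>x. \<phi>) \<in> \<Delta>" and "tvars t = {}" shows "nsubst x t \<phi> \<in> \<Delta>"
proof (rule closed)
  show "{\<^bold>\<forall>x. \<phi>} \<turnstile> nsubst x t \<phi>"
    by (rule derives.AllNE[OF derives.Assm]) (use assms in auto)
qed (use assms in auto)

lemma AllN_iff: "(\<^bold>\<forall>x. \<phi>) \<in> \<Delta> \<longleftrightarrow> (\<forall>t. tvars t = {} \<longrightarrow> nsubst x t \<phi> \<in> \<Delta>)"
proof
  assume *: "\<forall>t. tvars t = {} \<longrightarrow> nsubst x t \<phi> \<in> \<Delta>"
  show "(\<^bold>\<forall>x. \<phi>) \<in> \<Delta>"
  proof (rule ccontr)
    assume "(\<^bold>\<forall>x. \<phi>) \<notin> \<Delta>"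
    then obtain a where "(\<^bold>\<not> nsubst x (Par a) \<phi>) \<in> \<Delta>"
      using nwitness[OF neg_in] by blast
    then show False using * by (simp add: neg_iff)
  qed
qed (auto intro: AllN_inst)

lemma AllS_inst: assumes "(\<^bold>\<forall>\<^sub>sX. \<phi>) \<in> \<Delta>" shows "ssubst X (SPar A) \<phi> \<in> \<Delta>"
proof (rule closed)
  show "{\<^bold>\<forall>\<^sub>sX. \<phi>} \<turnstile> ssubst X (SPar A) \<phi>"
    by (rule derives.AllSE[OF derives.Assm]) simp
qed (use assms in auto)

lemma AllS_iff: "(\<^bold>\<forall>\<^sub>sX. \<phi>) \<in> \<Delta> \<longleftrightarrow> (\<forall>A. ssubst X (SPar A) \<phi> \<in> \<Delta>)"
proof
  assume *: "\<forall>A. ssubst X (SPar A) \<phi> \<in> \<Delta>"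
  show "(\<^bold>\<forall>\<^sub>sX. \<phi>) \<in> \<Delta>"
  proof (rule ccontr)
    assume "(\<^bold>\<forall>\<^sub>sX. \<phi>) \<notin> \<Delta>"
    then obtain A where "(\<^bold>\<not> ssubst X (SPar A) \<phi>) \<in> \<Delta>"
      using switness[OF neg_in] by blast
    then show False using * by (simp add: neg_iff)
  qed
qed (auto intro: AllS_inst)

lemma eq_refl: "(t \<^bold>= t) \<in> \<Delta>"
  by (rule closed[of "{}"]) (auto intro: derives.EqI)

lemma eq_subst:
  assumes "(s \<^bold>= t) \<in> \<Delta>" and "nsubst x s \<phi> \<in> \<Delta>" and "tvars s = {}" and "tvars t = {}"
  shows "nsubst x t \<phi> \<in> \<Delta>"
proof (rule closed)
  show "{s \<^bold>= t, nsubst x s \<phi>} \<turnstile> nsubst x t \<phi>"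
    using assms(3,4) by (intro derives.EqE[OF derives.Assm derives.Assm]) simp_all
qed (use assms in auto)

lemma tsubst_closed: "tvars t = {} \<Longrightarrow> tsubst x r t = t"
  by (induction t) auto

text \<open>The empty name \<open>[]\<close> marks the hole of the context in which equals are
  replaced.\<close>

lemma eq_sym: "(s \<^bold>= t) \<in> \<Delta> \<Longrightarrow> tvars s = {} \<Longrightarrow> tvars t = {} \<Longrightarrow> (t \<^bold>= s) \<in> \<Delta>"
  using eq_subst[of s t "[]" "Var [] \<^bold>= s"] eq_refl by (simp add: tsubst_closed)

lemma eq_trans:
  "(s \<^bold>= t) \<in> \<Delta> \<Longrightarrow> (t \<^bold>= u) \<in> \<Delta> \<Longrightarrow> tvars s = {} \<Longrightarrow> tvars t = {} \<Longrightarrow> tvars u = {} \<Longrightarrow> (s \<^bold>= u) \<in> \<Delta>"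
  using eq_subst[of t u "[]" "s \<^bold>= Var []"] by (simp add: tsubst_closed)

lemma eq_cong:
  assumes "(s \<^bold>= s') \<in> \<Delta>" "(t \<^bold>= t') \<in> \<Delta>" "tvars s = {}" "tvars s' = {}" "tvars t = {}" "tvars t' = {}"
  shows "(s \<^bold>+ t \<^bold>= s' \<^bold>+ t') \<in> \<Delta>" and "(s \<^bold>* t \<^bold>= s' \<^bold>* t') \<in> \<Delta>"
    and "(s \<^bold>< t) \<in> \<Delta> \<longrightarrow> (s' \<^bold>< t') \<in> \<Delta>" and "(s \<^bold>\<in> S) \<in> \<Delta> \<longrightarrow> (s' \<^bold>\<in> S) \<in> \<Delta>"
  using eq_subst[OF assms(1), of "[]" "s \<^bold>+ t \<^bold>= Var [] \<^bold>+ t"]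
    eq_subst[OF assms(2), of "[]" "s \<^bold>+ t \<^bold>= s' \<^bold>+ Var []"]
    eq_subst[OF assms(1), of "[]" "s \<^bold>* t \<^bold>= Var [] \<^bold>* t"]
    eq_subst[OF assms(2), of "[]" "s \<^bold>* t \<^bold>= s' \<^bold>* Var []"]
    eq_subst[OF assms(1), of "[]" "Var [] \<^bold>< t"] eq_subst[OF assms(2), of "[]" "s' \<^bold>< Var []"]
    eq_subst[OF assms(1), of "[]" "Var [] \<^bold>\<in> S"] eq_refl assms(3-)
  by (auto simp: tsubst_closed)

end

text \<open>The term model, with the classes of closed terms labelled by the elements of a type.\<close>

locale henkin_labelling = henkin_set +
  fixes val :: "ntm \<Rightarrow> 'n"
  assumes val_eq_iff: "tvars s = {} \<Longrightarrow> tvars t = {} \<Longrightarrow> val s = val t \<longleftrightarrow> (s \<^bold>= t) \<in> \<Delta>"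
    and val_surj: "\<exists>t. tvars t = {} \<and> val t = a"
begin

definition rep :: "'n \<Rightarrow> ntm" where
  "rep a = (SOME t. tvars t = {} \<and> val t = a)"

lemma rep: "tvars (rep a) = {}" "val (rep a) = a"
  using someI_ex[OF val_surj, of a] by (auto simp: rep_def)

lemma rep_val: "tvars t = {} \<Longrightarrow> (rep (val t) \<^bold>= t) \<in> \<Delta>"
  using val_eq_iff rep by metis

lemma rep_val': "tvars t = {} \<Longrightarrow> (t \<^bold>= rep (val t)) \<in> \<Delta>"
  using val_eq_iff rep by metis

text \<open>The extensions of the set parameters suffice as second-order part: parameters are the
  only set terms without variables, and a universal set statement outside \<open>\<Delta>\<close>
  fails at one of them by the Henkin property.\<close>

sublocale M: so_structure "val \<^bold>0" "val \<^bold>1" "\<lambda>a b. val (rep a \<^bold>+ rep b)"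
  "\<lambda>a b. val (rep a \<^bold>* rep b)" "\<lambda>a b. (rep a \<^bold>< rep b) \<in> \<Delta>"
  "range (\<lambda>A. {a. (rep a \<^bold>\<in> SPar A) \<in> \<Delta>})" "\<lambda>a. val (Par a)" "\<lambda>A. {a. (rep a \<^bold>\<in> SPar A) \<in> \<Delta>}" .

lemma teval_closed: "tvars t = {} \<Longrightarrow> M.teval e t = val t"
  by (induction t) (auto simp: val_eq_iff rep intro!: eq_cong rep_val)

lemma free_nvars_nsubst: "tvars t = {} \<Longrightarrow> free_nvars (nsubst x t \<phi>) = free_nvars \<phi> - {x}"
proof (induction \<phi>)
  have tvars_tsubst: "tvars t = {} \<Longrightarrow> tvars (tsubst x t s) = tvars s - {x}" for s
    by (induction s) auto
  show "tvars t = {} \<Longrightarrow> free_nvars (nsubst x t (r \<^bold>= s)) = free_nvars (r \<^bold>= s) - {x}" for r s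
    by (auto simp: tvars_tsubst)
  show "tvars t = {} \<Longrightarrow> free_nvars (nsubst x t (r \<^bold>< s)) = free_nvars (r \<^bold>< s) - {x}" for r s
    by (auto simp: tvars_tsubst)
  show "tvars t = {} \<Longrightarrow> free_nvars (nsubst x t (r \<^bold>\<in> S)) = free_nvars (r \<^bold>\<in> S) - {x}" for r S
    by (auto simp: tvars_tsubst)
qed auto

lemma free_svars_nsubst [simp]: "free_svars (nsubst x t \<phi>) = free_svars \<phi>"
  by (induction \<phi>) auto

lemma free_svars_ssubst: "free_svars (ssubst X (SPar A) \<phi>) = free_svars \<phi> - {X}"
proof (induction \<phi>)
  case (Mem t S)
  then show ?case by (cases S) auto
qed auto

lemma free_nvars_ssubst [simp]: "free_nvars (ssubst X R \<phi>) = free_nvars \<phi>"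
  by (induction \<phi>) auto

lemma size_nsubst [simp]: "size (nsubst x t \<phi>) = size \<phi>"
  by (induction \<phi>) auto

lemma size_ssubst [simp]: "size (ssubst X R \<phi>) = size \<phi>"
  by (induction \<phi>) auto

text \<open>The induction is on size, since the instances needed for a quantified formula are not
  subformulas; substitution of terms leaves the size of a formula unchanged.\<close>

lemma truth: "free_nvars \<phi> = {} \<Longrightarrow> free_svars \<phi> = {} \<Longrightarrow> M.sat e E \<phi> \<longleftrightarrow> \<phi> \<in> \<Delta>"
proof (induction "size \<phi>" arbitrary: \<phi> rule: less_induct)
  case less
  note IH = less.hyps
  show ?case
  proof (cases \<phi>)
    case (Eq s t)
    then show ?thesis using less.prems by (simp add: teval_closed val_eq_iff)
  next
    case (Less s t)
    then have "tvars s = {}" "tvars t = {}" using less.prems by auto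
    then have "(rep (val s) \<^bold>< rep (val t)) \<in> \<Delta> \<longleftrightarrow> (s \<^bold>< t) \<in> \<Delta>"
      using eq_cong(3) rep_val rep_val' rep(1) by blast
    then show ?thesis using Less less.prems by (simp add: teval_closed)
  next
    case (Mem t S)
    then obtain A where A: "S = SPar A" "tvars t = {}" using less.prems by (cases S) auto
    then have "(rep (val t) \<^bold>\<in> S) \<in> \<Delta> \<longleftrightarrow> (t \<^bold>\<in> S) \<in> \<Delta>"
      using eq_cong(4) rep_val rep_val' rep(1) by blast
    then show ?thesis using A Mem by (simp add: teval_closed)
  next
    case Falsum
    then show ?thesis using falsum_notin by simp
  next
    case (Imp \<phi> \<psi>)
    then show ?thesis using less.prems IH by (simp add: imp_iff)
  next
    case (AllN x \<psi>)
    have "M.sat (e(x := val t)) E \<psi> \<longleftrightarrow> nsubst x t \<psi> \<in> \<Delta>" if "tvars t = {}" for t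
    proof -
      have "M.sat e E (nsubst x t \<psi>) \<longleftrightarrow> nsubst x t \<psi> \<in> \<Delta>"
        using that less.prems AllN by (intro IH) (auto simp: free_nvars_nsubst)
      then show ?thesis by (simp add: that M.sat_nsubst teval_closed)
    qed
    then show ?thesis
      unfolding AllN AllN_iff M.sat.simps by (metis val_surj)
  next
    case (AllS X \<psi>)
    have "M.sat e (E(X := {a. (rep a \<^bold>\<in> SPar A) \<in> \<Delta>})) \<psi> \<longleftrightarrow> ssubst X (SPar A) \<psi> \<in> \<Delta>" for A
    proof -
      have "M.sat e E (ssubst X (SPar A) \<psi>) \<longleftrightarrow> ssubst X (SPar A) \<psi> \<in> \<Delta>"
        using less.prems AllS by (intro IH) (auto simp: free_svars_ssubst)
      then show ?thesis by (simp add: M.sat_ssubst)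
    qed
    then show ?thesis
      unfolding AllS AllS_iff M.sat.simps by blast
  qed
qed

end


section \<open>Models of RCA\<open>\<^sub>0\<close>\<close>

locale rca0_model = so_structure +
  assumes RCA0_true: "\<psi> \<in> RCA\<^sub>0 \<Longrightarrow> sat e E \<psi>"
    and sets_nonempty: "sets \<noteq> {}"

definition closure :: "name list \<Rightarrow> name list \<Rightarrow> fm \<Rightarrow> fm" where
  "closure xs Xs \<phi> = foldr AllN xs (foldr AllS Xs \<phi>)"

lemma generalization_foldr:
  "generalization \<phi> \<psi> \<Longrightarrow> generalization \<phi> (foldr AllN xs \<psi>)"
  "generalization \<phi> \<psi> \<Longrightarrow> generalization \<phi> (foldr AllS Xs \<psi>)"
  by (induction xs, auto intro: generalization.intros)
    (induction Xs, auto intro: generalization.intros)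

lemma free_vars_foldr [simp]:
  "free_nvars (foldr AllN xs \<phi>) = free_nvars \<phi> - set xs"
  "free_svars (foldr AllN xs \<phi>) = free_svars \<phi>"
  "free_nvars (foldr AllS Xs \<phi>) = free_nvars \<phi>"
  "free_svars (foldr AllS Xs \<phi>) = free_svars \<phi> - set Xs"
  "fm_npars (foldr AllN xs \<phi>) = fm_npars \<phi>"
  "fm_spars (foldr AllN xs \<phi>) = fm_spars \<phi>"
  "fm_npars (foldr AllS Xs \<phi>) = fm_npars \<phi>"
  "fm_spars (foldr AllS Xs \<phi>) = fm_spars \<phi>"
  by (induction xs, auto) (induction Xs, auto)+

lemma finite_tvars [simp]: "finite (tvars t)"
  by (induction t) auto

lemma finite_svars [simp]: "finite (svars S)"
  by (cases S) auto

lemma finite_free_nvars [simp]: "finite (free_nvars \<phi>)"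
  by (induction \<phi>) auto

lemma finite_free_svars [simp]: "finite (free_svars \<phi>)"
  by (induction \<phi>) auto

context so_structure
begin

lemma sat_foldr_AllN: "sat e E (foldr AllN xs \<phi>) \<Longrightarrow> sat e E \<phi>"
proof (induction xs)
  case (Cons x xs)
  then have "sat (e(x := e x)) E (foldr AllN xs \<phi>)"
    by (simp del: fun_upd_triv)
  then show ?case by (simp add: Cons.IH)
qed simp

lemma sat_foldr_AllS: "sat e E (foldr AllS Xs \<phi>) \<Longrightarrow> range E \<subseteq> sets \<Longrightarrow> sat e E \<phi>"
proof (induction Xs)
  case (Cons X Xs)
  then have "sat e (E(X := E X)) (foldr AllS Xs \<phi>)"
    by (simp del: fun_upd_triv add: image_subset_iff)
  then show ?case using Cons by simp
qed simp

end

context rca0_model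
begin

text \<open>Only closed sentences belong to the theory, so the open axiom is closed off and then
  stripped of its quantifiers again. Set quantifiers range over \<open>sets\<close>, which is why
  \<open>E\<close> has to take its values there.\<close>

lemma RCA0_open_true:
  assumes "\<phi> \<in> RCA0_open" and "fm_npars \<phi> = {}" and "fm_spars \<phi> = {}" and "range E \<subseteq> sets"
  shows "sat e E \<phi>"
proof -
  obtain xs where xs: "set xs = free_nvars \<phi>" using finite_list[OF finite_free_nvars] by blast
  obtain Xs where Xs: "set Xs = free_svars \<phi>" using finite_list[OF finite_free_svars] by blast
  have "closure xs Xs \<phi> \<in> RCA\<^sub>0"
    unfolding RCA0_def closure_def is_sentence_def using assms xs Xs
    by (auto intro!: bexI[of _ \<phi>] generalization_foldr generalization.intros(1))
  then have "sat e E (closure xs Xs \<phi>)" by (rule RCA0_true)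
  then show ?thesis
    unfolding closure_def using assms(4) by (blast dest: sat_foldr_AllN sat_foldr_AllS)
qed

end

lemma RCA0_param_free: "\<psi> \<in> RCA\<^sub>0 \<Longrightarrow> fm_npars \<psi> = {} \<and> fm_spars \<psi> = {}"
  by (auto simp: RCA0_def is_sentence_def)

lemma RCA0_I: "\<phi> \<in> RCA0_open \<Longrightarrow> generalization \<phi> \<psi> \<Longrightarrow> is_sentence \<psi> \<Longrightarrow> \<psi> \<in> RCA\<^sub>0"
  by (auto simp: RCA0_def)

lemma RCA0_suc:
  "(\<^bold>\<forall>''n''. \<^bold>\<not> Var ''n'' \<^bold>+ \<^bold>1 \<^bold>= \<^bold>0) \<in> RCA\<^sub>0"
  "(\<^bold>\<forall>''m''. \<^bold>\<forall>''n''. Var ''m'' \<^bold>+ \<^bold>1 \<^bold>= Var ''n'' \<^bold>+ \<^bold>1 \<^bold>\<longrightarrow> Var ''m'' \<^bold>= Var ''n'') \<in> RCA\<^sub>0"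
  by (rule RCA0_I[OF RCA0_basic[OF basic_axioms.intros(1)]],
      intro generalization.intros, simp add: is_sentence_def)
    (rule RCA0_I[OF RCA0_basic[OF basic_axioms.intros(2)]],
      intro generalization.intros, simp add: is_sentence_def)

lemma tvars_numeral_tm [simp]: "tvars (numeral_tm n) = {}"
  by (induction n) auto

text \<open>Distinct numerals denote distinct classes, so the term model is infinite and can be
  labelled bijectively by \<open>nat\<close>.\<close>

lemma (in henkin_set) numeral_tm_inj:
  assumes "RCA\<^sub>0 \<subseteq> \<Delta>" and "(numeral_tm m \<^bold>= numeral_tm n) \<in> \<Delta>"
  shows "m = n"
  using assms(2)
proof (induction m arbitrary: n)
  have nonzero: "(t \<^bold>+ \<^bold>1 \<^bold>= \<^bold>0) \<notin> \<Delta>" if "tvars t = {}" for t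
    using AllN_inst[OF subsetD[OF assms(1) RCA0_suc(1)] that] by (simp add: neg_iff)
  {
    case 0
    then show ?case
      using nonzero[of "numeral_tm (n - 1)"] eq_sym[OF 0] by (cases n) auto
  next
    case (Suc m)
    show ?case
    proof (cases n)
      case 0
      then show ?thesis using Suc.prems nonzero by simp
    next
      case (Suc k)
      have "nsubst ''m'' (numeral_tm m)
         (\<^bold>\<forall>''n''. Var ''m'' \<^bold>+ \<^bold>1 \<^bold>= Var ''n'' \<^bold>+ \<^bold>1 \<^bold>\<longrightarrow> Var ''m'' \<^bold>= Var ''n'') \<in> \<Delta>"
        by (rule AllN_inst[OF subsetD[OF assms(1) RCA0_suc(2)]]) simp
      then have "(\<^bold>\<forall>''n''. numeral_tm m \<^bold>+ \<^bold>1 \<^bold>= Var ''n'' \<^bold>+ \<^bold>1 \<^bold>\<longrightarrow> numeral_tm m \<^bold>= Var ''n'') \<in> \<Delta>"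
        by simp
      from AllN_inst[OF this, of "numeral_tm k"]
      show ?thesis
        using Suc Suc.prems Suc.IH by (simp add: tsubst_closed imp_iff)
    qed
  }
qed

text \<open>A non-derivable sentence fails in a term model. Its carrier consists of classes of
  closed terms, hence is countable, and it is infinite by the successor axioms; transported along a
  bijection it becomes a model over \<open>nat\<close>, against the hypothesis
  \<open>valid\<close>.\<close>

theorem RCA0_completeness:
  assumes \<phi>: "is_sentence \<phi>"
    and valid: "\<And>(zero :: nat) one add mul lt sets npar spar e E.
      rca0_model zero one add mul lt sets npar spar \<Longrightarrow>
      so_structure.sat zero one add mul lt sets npar spar e E \<phi>"
  shows "RCA\<^sub>0 \<turnstile> \<phi>"
proof (rule ccontr)
  assume "\<not> (RCA\<^sub>0 \<turnstile> \<phi>)"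
  then have "consistent (insert (\<^bold>\<not> \<phi>) RCA\<^sub>0)"
    unfolding consistent_def using derives.Raa by blast
  moreover have "fin_pars (insert (\<^bold>\<not> \<phi>) RCA\<^sub>0)"
    using \<phi> RCA0_param_free by (auto simp: fin_pars_def)
  ultimately obtain \<Delta> where \<Delta>: "insert (\<^bold>\<not> \<phi>) RCA\<^sub>0 \<subseteq> \<Delta>" "henkin \<Delta>"
    using henkin_extension by blast
  interpret henkin_set \<Delta> by unfold_locales (fact \<Delta>)
  define cls where "cls t = {s. tvars s = {} \<and> (t \<^bold>= s) \<in> \<Delta>}" for t
  define Q where "Q = cls ` {t. tvars t = {}}"
  have cls_eq: "cls s = cls t \<longleftrightarrow> (s \<^bold>= t) \<in> \<Delta>" if "tvars s = {}" "tvars t = {}" for s t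
    unfolding cls_def using that eq_refl eq_sym eq_trans by blast
  have "inj (\<lambda>n. cls (numeral_tm n))"
    using numeral_tm_inj \<Delta>(1) by (intro injI) (simp add: cls_eq)
  then have "infinite Q"
    by (rule infinite_super[rotated, OF range_inj_infinite]) (auto simp: Q_def)
  moreover have "countable Q"
    by (simp add: Q_def)
  ultimately have bij: "bij_betw (to_nat_on Q) Q UNIV"
    by (rule to_nat_on_infinite[rotated])
  interpret henkin_labelling \<Delta> "\<lambda>t. to_nat_on Q (cls t)"
  proof unfold_locales
    show "(to_nat_on Q (cls s) = to_nat_on Q (cls t)) = ((s \<^bold>= t) \<in> \<Delta>)"
      if "tvars s = {}" "tvars t = {}" for s t
      using that cls_eq[OF that] inj_on_eq_iff[OF bij_betw_imp_inj_on[OF bij], of "cls s" "cls t"]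
      unfolding Q_def by blast
    show "\<exists>t. tvars t = {} \<and> to_nat_on Q (cls t) = a" for a
    proof -
      have "a \<in> to_nat_on Q ` cls ` {t. tvars t = {}}"
        using bij_betw_imp_surj_on[OF bij] unfolding Q_def by simp
      then show ?thesis by blast
    qed
  qed
  have sat: "M.sat e E \<psi> \<longleftrightarrow> \<psi> \<in> \<Delta>" if "is_sentence \<psi>" for \<psi> e E
    using that by (intro truth) (auto simp: is_sentence_def)
  have "M.sat e E \<phi>" for e E
  proof (rule valid, unfold_locales)
    show "M.sat e E \<psi>" if "\<psi> \<in> RCA\<^sub>0" for \<psi> e E
      using that \<Delta>(1) sat[of \<psi>] unfolding RCA0_def by blast
  qed simp
  then have "\<phi> \<in> \<Delta>" using sat \<phi> by blast
  moreover have "\<phi> \<notin> \<Delta>" using \<Delta> neg_iff by blast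
  ultimately show False by blast
qed

section \<open>Bounded formulas, induction and comprehension in a model\<close>

definition BAll :: "name \<Rightarrow> ntm \<Rightarrow> fm \<Rightarrow> fm" where
  "BAll x t \<phi> = (\<^bold>\<forall>x. Var x \<^bold>< t \<^bold>\<longrightarrow> \<phi>)"

definition BEx :: "name \<Rightarrow> ntm \<Rightarrow> fm \<Rightarrow> fm" where
  "BEx x t \<phi> = (\<^bold>\<exists>x. Var x \<^bold>< t \<^bold>\<and> \<phi>)"

lemma bounded_fm_simps [simp]:
  "bounded_fm (s \<^bold>= t)" "bounded_fm (s \<^bold>< t)" "bounded_fm (t \<^bold>\<in> S)" "bounded_fm \<^bold>\<bottom>"
  "bounded_fm \<phi> \<Longrightarrow> bounded_fm \<psi> \<Longrightarrow> bounded_fm (\<phi> \<^bold>\<longrightarrow> \<psi>)"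
  "bounded_fm \<phi> \<Longrightarrow> x \<notin> tvars t \<Longrightarrow> bounded_fm (BAll x t \<phi>)"
  "bounded_fm \<phi> \<Longrightarrow> x \<notin> tvars t \<Longrightarrow> bounded_fm (BEx x t \<phi>)"
  unfolding BAll_def BEx_def by (auto intro: bounded_fm.intros)

lemma fm_pars_BAll_BEx [simp]:
  "fm_npars (BAll x t \<phi>) = tpars t \<union> fm_npars \<phi>" "fm_npars (BEx x t \<phi>) = tpars t \<union> fm_npars \<phi>"
  "fm_spars (BAll x t \<phi>) = fm_spars \<phi>" "fm_spars (BEx x t \<phi>) = fm_spars \<phi>"
  by (auto simp: BAll_def BEx_def)

lemma (in so_structure) sat_BAll_BEx [simp]:
  "x \<notin> tvars t \<Longrightarrow> sat e E (BAll x t \<phi>) \<longleftrightarrow> (\<forall>a. a \<prec> teval e t \<longrightarrow> sat (e(x := a)) E \<phi>)"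
  "x \<notin> tvars t \<Longrightarrow> sat e E (BEx x t \<phi>) \<longleftrightarrow> (\<exists>a. a \<prec> teval e t \<and> sat (e(x := a)) E \<phi>)"
  by (auto simp: BAll_def BEx_def)

lemma (in so_structure) sat_abbrevs:
  "sat e E (\<^bold>\<not> \<phi>) \<longleftrightarrow> \<not> sat e E \<phi>"
  "sat e E (\<phi> \<^bold>\<and> \<psi>) \<longleftrightarrow> sat e E \<phi> \<and> sat e E \<psi>"
  "sat e E (\<phi> \<^bold>\<or> \<psi>) \<longleftrightarrow> sat e E \<phi> \<or> sat e E \<psi>"
  "sat e E (\<phi> \<^bold>\<longleftrightarrow> \<psi>) \<longleftrightarrow> (sat e E \<phi> \<longleftrightarrow> sat e E \<psi>)"
  "sat e E (\<^bold>\<exists>x. \<phi>) \<longleftrightarrow> (\<exists>a. sat (e(x := a)) E \<phi>)"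
  "sat e E (\<^bold>\<exists>\<^sub>sX. \<phi>) \<longleftrightarrow> (\<exists>A\<in>sets. sat e (E(X := A)) \<phi>)"
  by auto

lemma (in so_structure) sat_nfresh: "x \<notin> free_nvars \<phi> \<Longrightarrow> sat (e(x := a)) E \<phi> = sat e E \<phi>"
  by (rule sat_cong) auto

lemma (in so_structure) sat_sfresh: "X \<notin> free_svars \<phi> \<Longrightarrow> sat e (E(X := A)) \<phi> = sat e E \<phi>"
  by (rule sat_cong) auto

text \<open>The axioms contain no parameters. Elements and sets of a model therefore enter induction
  and comprehension as values of free variables.\<close>

definition param_free :: "fm \<Rightarrow> bool" where
  "param_free \<phi> \<longleftrightarrow> fm_npars \<phi> = {} \<and> fm_spars \<phi> = {}"

lemma tpars_tsubst_subset: "tpars r = {} \<Longrightarrow> tpars t = {} \<Longrightarrow> tpars (tsubst x r t) = {}"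
  by (induction t) auto

lemma param_free_nsubst: "param_free \<phi> \<Longrightarrow> tpars r = {} \<Longrightarrow> param_free (nsubst x r \<phi>)"
  unfolding param_free_def by (induction \<phi>) (auto simp: tpars_tsubst_subset)

lemma fresh_name:
  assumes "finite A"
  obtains x :: name where "x \<notin> A"
  using ex_new_if_finite[OF infinite_UNIV_listI assms] by blast

context rca0_model
begin

lemma Sigma01_induct:
  assumes "Sigma01 \<phi>" and pf: "param_free \<phi>" and E: "range E \<subseteq> sets"
    and zero: "sat (e(x := \<zero>)) E \<phi>"
    and step: "\<And>a. sat (e(x := a)) E \<phi> \<Longrightarrow> sat (e(x := a \<oplus> \<one>)) E \<phi>"
  shows "sat (e(x := a)) E \<phi>"
proof -
  have "param_free (induction_axiom x \<phi>)"
    using pf param_free_nsubst[OF pf, of "\<^bold>0" x] param_free_nsubst[OF pf, of "Var x \<^bold>+ \<^bold>1" x]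
    by (simp add: induction_axiom_def param_free_def)
  then have "sat e E (induction_axiom x \<phi>)"
    using assms by (intro RCA0_open_true RCA0_ind) (auto simp: param_free_def)
  then show ?thesis
    using zero step by (simp add: induction_axiom_def sat_nsubst)
qed

text \<open>A vacuous existential quantifier over a fresh variable turns a bounded formula into a
  \<open>Sigma01\<close> one.\<close>

lemma bounded_induct:
  assumes "bounded_fm \<phi>" and pf: "param_free \<phi>" and E: "range E \<subseteq> sets"
    and zero: "sat (e(x := \<zero>)) E \<phi>"
    and step: "\<And>a. sat (e(x := a)) E \<phi> \<Longrightarrow> sat (e(x := a \<oplus> \<one>)) E \<phi>"
  shows "sat (e(x := a)) E \<phi>"
proof -
  obtain y where "y \<notin> insert x (free_nvars \<phi>)"
    using fresh_name finite_free_nvars finite_insert by metis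
  then have eq: "sat e' E (\<^bold>\<exists>y. \<phi>) = sat e' E \<phi>" for e'
    by (simp add: sat_nfresh)
  have "sat (e(x := a)) E (\<^bold>\<exists>y. \<phi>)"
  proof (rule Sigma01_induct)
    show "Sigma01 (\<^bold>\<exists>y. \<phi>)" using assms(1) by (rule Sigma01.intros)
    show "param_free (\<^bold>\<exists>y. \<phi>)" using pf by (simp add: param_free_def)
  qed (use E zero step in \<open>simp_all only: eq\<close>)
  then show ?thesis by (simp only: eq)
qed

lemma Delta1_comprehension:
  assumes "bounded_fm \<theta>" and "bounded_fm \<theta>'" and "param_free \<theta>" and "param_free \<theta>'"
    and E: "range E \<subseteq> sets"
    and eq: "\<And>a. (\<exists>b. sat (e(x := a, y := b)) E \<theta>) \<longleftrightarrow> (\<forall>b. sat (e(x := a, z := b)) E \<theta>')"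
  shows "{a. \<exists>b. sat (e(x := a, y := b)) E \<theta>} \<in> sets"
proof -
  obtain X where X: "X \<notin> free_svars \<theta> \<union> free_svars \<theta>'"
    using fresh_name finite_free_svars finite_UnI by metis
  let ?\<phi> = "\<^bold>\<exists>y. \<theta>" and ?\<psi> = "\<^bold>\<forall>z. \<theta>'"
  have "sat e E (comprehension_axiom x X ?\<phi> ?\<psi>)"
    using assms(1-5) X
    by (intro RCA0_open_true RCA0_comp Sigma01.intros Pi01.intros)
      (auto simp: comprehension_axiom_def param_free_def)
  then have "sat e E (\<^bold>\<forall>x. ?\<phi> \<^bold>\<longleftrightarrow> ?\<psi>) \<longrightarrow>
      sat e E (\<^bold>\<exists>\<^sub>sX. \<^bold>\<forall>x. Var x \<^bold>\<in> SVar X \<^bold>\<longleftrightarrow> ?\<phi>)"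
    unfolding comprehension_axiom_def by (rule iffD1[OF sat.simps(5)])
  moreover have "sat e E (\<^bold>\<forall>x. ?\<phi> \<^bold>\<longleftrightarrow> ?\<psi>)"
    using eq by (simp only: sat.simps(6) sat_abbrevs(4,5) simp_thms)
  ultimately have "sat e E (\<^bold>\<exists>\<^sub>sX. \<^bold>\<forall>x. Var x \<^bold>\<in> SVar X \<^bold>\<longleftrightarrow> ?\<phi>)"
    by (rule mp)
  then have "\<exists>A\<in>sets. \<forall>a. a \<in> A \<longleftrightarrow> (\<exists>b. sat (e(x := a, y := b)) (E(X := A)) \<theta>)"
    by (simp only: sat.simps(3,6) sat_abbrevs(4-6) teval.simps seval.simps fun_upd_same)
  then obtain A where A: "A \<in> sets"
    "\<And>a. a \<in> A \<longleftrightarrow> (\<exists>b. sat (e(x := a, y := b)) (E(X := A)) \<theta>)" by blast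
  have Xf: "X \<notin> free_svars \<theta>" using X by blast
  have "a \<in> A \<longleftrightarrow> (\<exists>b. sat (e(x := a, y := b)) E \<theta>)" for a
    unfolding A(2) by (simp only: sat_sfresh[OF Xf])
  then have "{a. \<exists>b. sat (e(x := a, y := b)) E \<theta>} = A" by blast
  with A(1) show ?thesis by simp
qed

text \<open>With a vacuous quantifier of either kind, a bounded formula acquires both a
  \<open>Sigma01\<close> and a \<open>Pi01\<close> form.\<close>

lemma bounded_comprehension:
  assumes "bounded_fm \<theta>" and "param_free \<theta>" and E: "range E \<subseteq> sets"
  shows "{a. sat (e(x := a)) E \<theta>} \<in> sets"
proof -
  obtain y where y: "y \<notin> insert x (free_nvars \<theta>)"
    using fresh_name finite_free_nvars finite_insert by metis
  then have eq: "sat (e(x := a, y := b)) E \<theta> = sat (e(x := a)) E \<theta>" for a b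
    by (simp add: sat_nfresh)
  show ?thesis
    using Delta1_comprehension[of \<theta> \<theta> E e x y y] assms by (simp add: eq)
qed

definition E0 :: "name \<Rightarrow> 'a set" where
  "E0 = (\<lambda>_. SOME A. A \<in> sets)"

lemma E0: "range E0 \<subseteq> sets"
  using sets_nonempty some_in_eq by (auto simp: E0_def)

abbreviation e0 :: "name \<Rightarrow> 'a" where
  "e0 \<equiv> \<lambda>_. \<zero>"

lemma basic_true:
  assumes "\<phi> \<in> basic_axioms"
  shows "sat e E0 \<phi>"
proof -
  have "fm_npars \<phi> = {} \<and> fm_spars \<phi> = {}"
    using assms by cases auto
  then show ?thesis
    using assms E0 by (intro RCA0_open_true RCA0_basic) auto
qed

section \<open>Arithmetic of the first-order part\<close>

lemma N_add_one_ne_zero: "a \<oplus> \<one> \<noteq> \<zero>"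
  using basic_true[OF basic_axioms.intros(1), of "e0(''n'' := a)"] by simp

lemma N_add_one_inj: "a \<oplus> \<one> = b \<oplus> \<one> \<Longrightarrow> a = b"
  using basic_true[OF basic_axioms.intros(2), of "e0(''m'' := a, ''n'' := b)"] by simp

lemma N_add_zero: "a \<oplus> \<zero> = a"
  using basic_true[OF basic_axioms.intros(3), of "e0(''m'' := a)"] by simp

lemma N_add_suc: "a \<oplus> (b \<oplus> \<one>) = (a \<oplus> b) \<oplus> \<one>"
  using basic_true[OF basic_axioms.intros(4), of "e0(''m'' := a, ''n'' := b)"] by simp

lemma N_mul_zero: "a \<otimes> \<zero> = \<zero>"
  using basic_true[OF basic_axioms.intros(5), of "e0(''m'' := a)"] by simp

lemma N_mul_suc: "a \<otimes> (b \<oplus> \<one>) = (a \<otimes> b) \<oplus> a"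
  using basic_true[OF basic_axioms.intros(6), of "e0(''m'' := a, ''n'' := b)"] by simp

lemma N_not_less_zero: "\<not> a \<prec> \<zero>"
  using basic_true[OF basic_axioms.intros(7), of "e0(''m'' := a)"] by simp

lemma N_less_suc: "a \<prec> b \<oplus> \<one> \<longleftrightarrow> a \<prec> b \<or> a = b"
  using basic_true[OF basic_axioms.intros(8), of "e0(''m'' := a, ''n'' := b)"] by auto

lemma N_zero_add: "\<zero> \<oplus> a = a"
  using bounded_induct[of "\<^bold>0 \<^bold>+ Var ''x'' \<^bold>= Var ''x''" E0 e0 "''x''" a] E0
  by (simp add: param_free_def N_add_zero N_add_suc)

lemma N_suc_add: "(a \<oplus> \<one>) \<oplus> b = (a \<oplus> b) \<oplus> \<one>"
  using bounded_induct[of "(Var ''y'' \<^bold>+ \<^bold>1) \<^bold>+ Var ''x'' \<^bold>= (Var ''y'' \<^bold>+ Var ''x'') \<^bold>+ \<^bold>1"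
      E0 "e0(''y'' := a)" "''x''" b] E0
  by (simp add: param_free_def N_add_zero N_add_suc)

lemma N_add_commute: "a \<oplus> b = b \<oplus> a"
  using bounded_induct[of "Var ''y'' \<^bold>+ Var ''x'' \<^bold>= Var ''x'' \<^bold>+ Var ''y''"
      E0 "e0(''y'' := a)" "''x''" b] E0
  by (simp add: param_free_def N_add_zero N_zero_add N_add_suc N_suc_add)

lemma N_add_assoc: "(a \<oplus> b) \<oplus> c = a \<oplus> (b \<oplus> c)"
  using bounded_induct[of "(Var ''y'' \<^bold>+ Var ''z'') \<^bold>+ Var ''x'' \<^bold>= Var ''y'' \<^bold>+ (Var ''z'' \<^bold>+ Var ''x'')"
      E0 "e0(''y'' := a, ''z'' := b)" "''x''" c] E0
  by (simp add: param_free_def N_add_zero N_add_suc)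

lemma N_add_left_commute: "a \<oplus> (b \<oplus> c) = b \<oplus> (a \<oplus> c)"
  using N_add_commute N_add_assoc by metis

lemmas N_add_ac = N_add_assoc N_add_commute N_add_left_commute

lemma N_zero_mul: "\<zero> \<otimes> a = \<zero>"
  using bounded_induct[of "\<^bold>0 \<^bold>* Var ''x'' \<^bold>= \<^bold>0" E0 e0 "''x''" a] E0
  by (simp add: param_free_def N_mul_zero N_mul_suc N_add_zero)

lemma N_suc_mul: "(a \<oplus> \<one>) \<otimes> b = (a \<otimes> b) \<oplus> b"
  using bounded_induct[of "(Var ''y'' \<^bold>+ \<^bold>1) \<^bold>* Var ''x'' \<^bold>= (Var ''y'' \<^bold>* Var ''x'') \<^bold>+ Var ''x''"
      E0 "e0(''y'' := a)" "''x''" b] E0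
  by (simp add: param_free_def N_mul_zero N_mul_suc N_add_zero N_add_ac)

lemma N_mul_commute: "a \<otimes> b = b \<otimes> a"
  using bounded_induct[of "Var ''y'' \<^bold>* Var ''x'' \<^bold>= Var ''x'' \<^bold>* Var ''y''"
      E0 "e0(''y'' := a)" "''x''" b] E0
  by (simp add: param_free_def N_mul_zero N_zero_mul N_mul_suc N_suc_mul)

lemma N_distrib: "a \<otimes> (b \<oplus> c) = (a \<otimes> b) \<oplus> (a \<otimes> c)"
  using bounded_induct[of "Var ''y'' \<^bold>* (Var ''z'' \<^bold>+ Var ''x'') \<^bold>= Var ''y'' \<^bold>* Var ''z'' \<^bold>+ Var ''y'' \<^bold>* Var ''x''"
      E0 "e0(''y'' := a, ''z'' := b)" "''x''" c] E0
  by (simp add: param_free_def N_mul_zero N_mul_suc N_add_zero flip: N_add_assoc)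

lemma N_mul_one: "a \<otimes> \<one> = a"
  using N_mul_suc[of a \<zero>] by (simp add: N_zero_add N_mul_zero)

lemma N_mul_assoc: "(a \<otimes> b) \<otimes> c = a \<otimes> (b \<otimes> c)"
  using bounded_induct[of "(Var ''y'' \<^bold>* Var ''z'') \<^bold>* Var ''x'' \<^bold>= Var ''y'' \<^bold>* (Var ''z'' \<^bold>* Var ''x'')"
      E0 "e0(''y'' := a, ''z'' := b)" "''x''" c] E0
  by (simp add: param_free_def N_mul_zero N_mul_suc N_mul_one N_distrib)

lemma N_add_cancel: "a \<oplus> c = b \<oplus> c \<Longrightarrow> a = b"
  using bounded_induct[of "Var ''y'' \<^bold>+ Var ''x'' \<^bold>= Var ''z'' \<^bold>+ Var ''x'' \<^bold>\<longrightarrow> Var ''y'' \<^bold>= Var ''z''"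
      E0 "e0(''y'' := a, ''z'' := b)" "''x''" c] E0
  by (auto simp: param_free_def N_add_zero N_add_suc dest: N_add_one_inj)

lemma N_zero_or_suc: "a = \<zero> \<or> (\<exists>b. a = b \<oplus> \<one>)"
  using Sigma01_induct[OF Sigma01.intros, of "\<^bold>\<not> Var ''x'' \<^bold>= \<^bold>0 \<^bold>\<longrightarrow> Var ''x'' \<^bold>= Var ''y'' \<^bold>+ \<^bold>1"
      "''y''" E0 e0 "''x''" a] E0
  by (auto simp: param_free_def)

lemma N_linear: "(\<exists>c. b = a \<oplus> c) \<or> (\<exists>c. a = b \<oplus> c)"
proof -
  have "sat (e0(''y'' := a, ''x'' := b)) E0
    (\<^bold>\<exists>''z''. Var ''x'' \<^bold>= Var ''y'' \<^bold>+ Var ''z'' \<^bold>\<or> Var ''y'' \<^bold>= Var ''x'' \<^bold>+ Var ''z'')"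
  proof (rule Sigma01_induct)
    show "sat (e0(''y'' := a, ''x'' := n \<oplus> \<one>)) E0
      (\<^bold>\<exists>''z''. Var ''x'' \<^bold>= Var ''y'' \<^bold>+ Var ''z'' \<^bold>\<or> Var ''y'' \<^bold>= Var ''x'' \<^bold>+ Var ''z'')"
      if hyp: "sat (e0(''y'' := a, ''x'' := n)) E0
        (\<^bold>\<exists>''z''. Var ''x'' \<^bold>= Var ''y'' \<^bold>+ Var ''z'' \<^bold>\<or> Var ''y'' \<^bold>= Var ''x'' \<^bold>+ Var ''z'')" for n
    proof -
      obtain c where "n = a \<oplus> c \<or> a = n \<oplus> c" using hyp by auto
      moreover have "\<exists>d. a = (n \<oplus> \<one>) \<oplus> d \<or> n \<oplus> \<one> = a \<oplus> d" if "a = n \<oplus> c"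
        using that N_zero_or_suc[of c] by (metis N_add_assoc N_add_commute N_add_zero)
      ultimately show ?thesis
        using N_add_suc by simp metis
    qed
  qed (use E0 in \<open>auto simp: param_free_def N_zero_add intro!: Sigma01.intros\<close>)
  then show ?thesis by auto
qed

text \<open>The axioms describe the order only by comparison with zero and with successors. Reduced
  to addition, its laws follow from those of \<open>\<oplus>\<close>.\<close>

lemma N_less_iff: "a \<prec> b \<longleftrightarrow> (\<exists>c. b = a \<oplus> (c \<oplus> \<one>))"
proof
  assume "a \<prec> b"
  \<comment> \<open>The premise is placed inside the existential quantifier, so that the induction
    formula is \<open>Sigma01\<close>.\<close>
  moreover have "sat (e0(''y'' := a, ''x'' := b)) E0
    (\<^bold>\<exists>''z''. Var ''y'' \<^bold>< Var ''x'' \<^bold>\<longrightarrow> Var ''x'' \<^bold>= Var ''y'' \<^bold>+ (Var ''z'' \<^bold>+ \<^bold>1))"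
  proof (rule Sigma01_induct)
    show "sat (e0(''y'' := a, ''x'' := n \<oplus> \<one>)) E0
      (\<^bold>\<exists>''z''. Var ''y'' \<^bold>< Var ''x'' \<^bold>\<longrightarrow> Var ''x'' \<^bold>= Var ''y'' \<^bold>+ (Var ''z'' \<^bold>+ \<^bold>1))"
      if hyp: "sat (e0(''y'' := a, ''x'' := n)) E0
        (\<^bold>\<exists>''z''. Var ''y'' \<^bold>< Var ''x'' \<^bold>\<longrightarrow> Var ''x'' \<^bold>= Var ''y'' \<^bold>+ (Var ''z'' \<^bold>+ \<^bold>1))" for n
    proof -
      obtain c where c: "a \<prec> n \<longrightarrow> n = a \<oplus> (c \<oplus> \<one>)" using hyp by auto
      have "\<exists>d. a \<prec> n \<oplus> \<one> \<longrightarrow> n \<oplus> \<one> = a \<oplus> (d \<oplus> \<one>)"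
      proof (cases "a \<prec> n")
        case True
        then have "n \<oplus> \<one> = a \<oplus> ((c \<oplus> \<one>) \<oplus> \<one>)" using c by (simp add: N_add_suc)
        then show ?thesis by blast
      next
        case False
        then have "a \<prec> n \<oplus> \<one> \<longrightarrow> n \<oplus> \<one> = a \<oplus> (\<zero> \<oplus> \<one>)"
          by (simp add: N_less_suc N_zero_add)
        then show ?thesis by blast
      qed
      then show ?thesis by simp
    qed
  qed (use E0 in \<open>auto simp: param_free_def N_not_less_zero intro!: Sigma01.intros\<close>)
  ultimately show "\<exists>c. b = a \<oplus> (c \<oplus> \<one>)" by auto
next
  assume "\<exists>c. b = a \<oplus> (c \<oplus> \<one>)"
  moreover have "a \<prec> a \<oplus> (c \<oplus> \<one>)" for c
    using bounded_induct[of "Var ''y'' \<^bold>< Var ''y'' \<^bold>+ (Var ''x'' \<^bold>+ \<^bold>1)" E0 "e0(''y'' := a)" "''x''" c] E0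
    by (simp add: param_free_def N_zero_add N_less_suc N_add_suc N_add_zero)
  ultimately show "a \<prec> b" by blast
qed

definition le :: "'a \<Rightarrow> 'a \<Rightarrow> bool" (infix "\<preceq>" 50) where
  "a \<preceq> b \<longleftrightarrow> a \<prec> b \<or> a = b"

text \<open>Truncated subtraction, one of the operations of the class
  \<open>linordered_semidom\<close>.\<close>

definition minus :: "'a \<Rightarrow> 'a \<Rightarrow> 'a" (infixl "\<ominus>" 65) where
  "a \<ominus> b = (if b \<preceq> a then SOME c. a = b \<oplus> c else \<zero>)"

lemma N_le_iff: "a \<preceq> b \<longleftrightarrow> (\<exists>c. b = a \<oplus> c)"
  unfolding le_def N_less_iff using N_zero_or_suc N_add_zero by metis

lemma N_add_eq_self: "a \<oplus> c = a \<Longrightarrow> c = \<zero>"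
  using N_add_cancel[of c a \<zero>] N_zero_add N_add_commute by metis

lemma N_add_eq_zero: "a \<oplus> b = \<zero> \<Longrightarrow> a = \<zero>"
  using N_zero_or_suc[of a] N_suc_add N_add_one_ne_zero by metis

lemma N_less_irrefl: "\<not> a \<prec> a"
proof
  assume "a \<prec> a"
  then obtain c where "a = a \<oplus> (c \<oplus> \<one>)" unfolding N_less_iff by blast
  then have "c \<oplus> \<one> = \<zero>" by (rule N_add_eq_self[OF sym])
  then show False by (rule notE[OF N_add_one_ne_zero])
qed

lemma N_le_antisym:
  assumes "a \<preceq> b" and "b \<preceq> a"
  shows "a = b"
proof -
  obtain c d where c: "b = a \<oplus> c" and d: "a = b \<oplus> d" using assms N_le_iff by blast
  then have "a \<oplus> (c \<oplus> d) = a" using N_add_assoc[of a c d] by simp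
  then have "c \<oplus> d = \<zero>" by (rule N_add_eq_self)
  then have "c = \<zero>" by (rule N_add_eq_zero)
  with c show ?thesis by (simp add: N_add_zero)
qed

lemma N_le_trans:
  assumes "a \<preceq> b" and "b \<preceq> c"
  shows "a \<preceq> c"
proof -
  obtain d e where "b = a \<oplus> d" and "c = b \<oplus> e" using assms N_le_iff by blast
  then have "c = a \<oplus> (d \<oplus> e)" by (simp add: N_add_assoc)
  then show ?thesis using N_le_iff by blast
qed

lemma N_minus_add: "(b \<oplus> c) \<ominus> b = c"
proof -
  have "(SOME c'. b \<oplus> c = b \<oplus> c') = c"
  proof (rule some_equality)
    show "c' = c" if "b \<oplus> c = b \<oplus> c'" for c'
      using N_add_cancel[of c' b c] that N_add_commute[of b] by simp
  qed simp
  moreover have "b \<preceq> b \<oplus> c" using N_le_iff by blast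
  ultimately show ?thesis by (simp add: minus_def)
qed

lemma N_minus_not_le: "\<not> b \<preceq> a \<Longrightarrow> a \<ominus> b = \<zero>"
  by (simp add: minus_def)

lemma N_le_add: "a \<preceq> a \<oplus> c"
  using N_le_iff by blast

lemma N_le_elim:
  assumes "a \<preceq> b"
  obtains c where "b = a \<oplus> c"
  using assms N_le_iff by blast

lemma N_minus_minus: "a \<ominus> b \<ominus> c = a \<ominus> (b \<oplus> c)"
proof (cases "b \<preceq> a")
  case True
  then obtain x where x: "a = b \<oplus> x" by (rule N_le_elim)
  show ?thesis
  proof (cases "c \<preceq> x")
    case True
    then obtain y where y: "x = c \<oplus> y" by (rule N_le_elim)
    have "a \<ominus> (b \<oplus> c) = y"
      unfolding x y N_add_assoc[symmetric] by (rule N_minus_add)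
    then show ?thesis by (simp only: x y N_minus_add)
  next
    case False
    have "\<not> b \<oplus> c \<preceq> a"
    proof
      assume "b \<oplus> c \<preceq> a"
      then obtain y where "b \<oplus> x = b \<oplus> (c \<oplus> y)" unfolding x N_add_assoc[symmetric] by (rule N_le_elim)
      then have "x = c \<oplus> y" using N_minus_add by metis
      then show False using False N_le_add by simp
    qed
    then show ?thesis using False by (simp only: N_minus_not_le x N_minus_add not_False_eq_True)
  qed
next
  case False
  then have "\<not> b \<oplus> c \<preceq> a"
    using N_le_trans[OF N_le_add] by blast
  moreover have "\<zero> \<ominus> c = \<zero>"
  proof (cases "c \<preceq> \<zero>")
    case True
    then obtain d where "\<zero> = c \<oplus> d" by (rule N_le_elim)
    then have "c = \<zero>" by (intro N_add_eq_zero[OF sym])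
    then show ?thesis using N_minus_add[of \<zero> \<zero>] by (simp add: N_add_zero)
  qed (simp add: N_minus_not_le)
  ultimately show ?thesis using False by (simp add: N_minus_not_le)
qed

lemma N_mul_minus: "a \<otimes> (b \<ominus> c) = (a \<otimes> b) \<ominus> (a \<otimes> c)"
proof (cases "c \<preceq> b")
  case True
  then obtain x where "b = c \<oplus> x" by (rule N_le_elim)
  then show ?thesis by (simp only: N_distrib N_minus_add)
next
  case False
  then obtain x where x: "c = b \<oplus> x" using N_linear N_le_iff by blast
  have "a \<otimes> b \<ominus> a \<otimes> c = \<zero>"
  proof (cases "a \<otimes> c \<preceq> a \<otimes> b")
    case True
    moreover have "a \<otimes> b \<preceq> a \<otimes> c" unfolding x N_distrib by (rule N_le_add)
    ultimately have "a \<otimes> c = a \<otimes> b" by (rule N_le_antisym)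
    then show ?thesis using N_minus_add[of "a \<otimes> b" \<zero>] by (simp add: N_add_zero)
  qed (simp add: N_minus_not_le)
  then show ?thesis using False by (simp add: N_minus_not_le N_mul_zero)
qed

lemma N_mul_strict_mono: "a \<prec> b \<Longrightarrow> \<zero> \<prec> c \<Longrightarrow> c \<otimes> a \<prec> c \<otimes> b"
proof -
  assume "a \<prec> b" "\<zero> \<prec> c"
  then obtain d k where "b = a \<oplus> (d \<oplus> \<one>)" and c: "c = k \<oplus> \<one>"
    unfolding N_less_iff by (auto simp: N_zero_add)
  then have "c \<otimes> b = (c \<otimes> a) \<oplus> (((c \<otimes> d) \<oplus> k) \<oplus> \<one>)"
    by (simp add: N_distrib N_mul_one N_add_assoc)
  then show ?thesis unfolding N_less_iff by blast
qed

lemma N_mul_eq_zero: "a \<noteq> \<zero> \<Longrightarrow> b \<noteq> \<zero> \<Longrightarrow> a \<otimes> b \<noteq> \<zero>"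
proof -
  assume "a \<noteq> \<zero>" "b \<noteq> \<zero>"
  then obtain c d where "a = c \<oplus> \<one>" "b = d \<oplus> \<one>" using N_zero_or_suc by metis
  then have "a \<otimes> b = ((c \<oplus> \<one>) \<otimes> d \<oplus> c) \<oplus> \<one>" by (simp add: N_mul_suc N_add_suc)
  then show ?thesis using N_add_one_ne_zero by simp
qed

text \<open>From here on the library of ordered semirings applies to the possibly nonstandard
  numbers of the model. Only induction and comprehension still have to go through formulas.\<close>

sublocale linordered_semidom "(\<oplus>)" "(\<ominus>)" "(\<preceq>)" "(\<prec>)" \<zero> "(\<otimes>)" \<one>
proof unfold_locales
  show "a \<oplus> b \<oplus> c = a \<oplus> (b \<oplus> c)" for a b c by (fact N_add_assoc)
  show "a \<oplus> b = b \<oplus> a" for a b by (fact N_add_commute)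
  show "a \<oplus> b \<ominus> a = b" for a b by (fact N_minus_add)
  show "a \<ominus> b \<ominus> c = a \<ominus> (b \<oplus> c)" for a b c by (fact N_minus_minus)
  show "a \<prec> b \<longleftrightarrow> a \<preceq> b \<and> \<not> b \<preceq> a" for a b
    using N_le_antisym[of a b] N_less_irrefl unfolding le_def by blast
  show "a \<preceq> a" for a by (simp add: le_def)
  show "a \<preceq> b \<Longrightarrow> b \<preceq> c \<Longrightarrow> a \<preceq> c" for a b c by (fact N_le_trans)
  show "a \<preceq> b \<Longrightarrow> b \<preceq> a \<Longrightarrow> a = b" for a b by (fact N_le_antisym)
  show "c \<oplus> a \<preceq> c \<oplus> b" if "a \<preceq> b" for a b c
    using that by (auto elim!: N_le_elim simp flip: N_add_assoc intro: N_le_add)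
  show "a \<preceq> b \<or> b \<preceq> a" for a b
    using N_linear unfolding N_le_iff .
  show "\<zero> \<oplus> a = a" for a by (fact N_zero_add)
  show "a \<otimes> b \<otimes> c = a \<otimes> (b \<otimes> c)" for a b c by (fact N_mul_assoc)
  show "a \<otimes> b = b \<otimes> a" for a b by (fact N_mul_commute)
  show "a \<otimes> (b \<oplus> c) = a \<otimes> b \<oplus> a \<otimes> c" for a b c by (fact N_distrib)
  then show "(a \<oplus> b) \<otimes> c = a \<otimes> c \<oplus> b \<otimes> c" for a b c by (simp only: N_mul_commute[of _ c])
  show "\<zero> \<otimes> a = \<zero>" for a by (fact N_zero_mul)
  show "a \<otimes> \<zero> = \<zero>" for a by (fact N_mul_zero)
  show "a \<prec> b \<Longrightarrow> \<zero> \<prec> c \<Longrightarrow> c \<otimes> a \<prec> c \<otimes> b" for a b c by (fact N_mul_strict_mono)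
  show "\<one> \<otimes> a = a" for a using N_mul_one N_mul_commute by simp
  show "\<zero> \<noteq> \<one>" using N_add_one_ne_zero[of \<zero>] by (simp add: N_zero_add)
  show "a \<otimes> (b \<ominus> c) = a \<otimes> b \<ominus> a \<otimes> c" for a b c by (fact N_mul_minus)
  show "a \<noteq> \<zero> \<Longrightarrow> b \<noteq> \<zero> \<Longrightarrow> a \<otimes> b \<noteq> \<zero>" for a b by (fact N_mul_eq_zero)
  show "\<zero> \<prec> \<one>" unfolding N_less_iff by (rule exI[of _ \<zero>]) (simp only: N_zero_add)
  show "a \<ominus> b \<oplus> b = a" if le: "b \<preceq> a" for a b
  proof -
    obtain c where "a = b \<oplus> c" using le by (rule N_le_elim)
    then show ?thesis by (simp only: N_minus_add N_add_commute)
  qed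
qed

lemma less_add_one_iff: "a \<prec> b \<oplus> \<one> \<longleftrightarrow> a \<preceq> b"
  by (simp add: N_less_suc le_def)

lemma add_one_le_iff: "a \<oplus> \<one> \<preceq> b \<longleftrightarrow> a \<prec> b"
  by (metis less_add_one_iff add_le_cancel_right not_le)

lemma zero_le [simp]: "\<zero> \<preceq> a"
  using N_le_add[of \<zero> a] by simp

end


section \<open>Coding finite sets by divisibility\<close>

lemma tvars_pair [simp]: "tvars (pair s t) = tvars s \<union> tvars t"
  by (auto simp: pair_def)

lemma tpars_pair [simp]: "tpars (pair s t) = tpars s \<union> tpars t"
  by (auto simp: pair_def)

context rca0_model
begin

definition pr :: "'a \<Rightarrow> 'a \<Rightarrow> 'a" where
  "pr a b = (a \<oplus> b) \<otimes> (a \<oplus> b) \<oplus> a"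

lemma teval_pair [simp]: "teval e (pair s t) = pr (teval e s) (teval e t)"
  by (simp add: pair_def pr_def)

lemma le_square: "a \<preceq> a \<otimes> a"
proof (cases "a = \<zero>")
  case False
  then have "\<one> \<preceq> a" using add_one_le_iff[of \<zero> a] by (simp add: less_le)
  then show ?thesis using mult_left_mono[of \<one> a a] by simp
qed simp

lemma add_le_pr: "a \<oplus> b \<preceq> pr a b"
  using add_mono[OF le_square[of "a \<oplus> b"] zero_le[of a]] by (simp add: pr_def)

lemma fst_le_pr: "a \<preceq> pr a b" and snd_le_pr: "b \<preceq> pr a b"
  using order_trans[OF _ add_le_pr] by simp_all

text \<open>Pairs with sum s have codes between s^2 and s^2 + s, and these intervals are disjoint
  because s^2 + s < (s + 1)^2.\<close>

lemma pr_less: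
  assumes "a \<oplus> b \<prec> c \<oplus> d"
  shows "pr a b \<prec> pr c d"
proof -
  let ?s = "a \<oplus> b" and ?t = "c \<oplus> d"
  have "pr a b \<preceq> ?s \<otimes> ?s \<oplus> ?s"
    by (simp add: pr_def)
  also have "\<dots> \<prec> ?s \<otimes> ?s \<oplus> ?s \<oplus> (?s \<oplus> \<one>)"
    by (rule less_add_same_cancel1[THEN iffD2]) (simp add: add_nonneg_pos)
  also have "\<dots> = (?s \<oplus> \<one>) \<otimes> (?s \<oplus> \<one>)"
    by (simp only: distrib_left distrib_right mult_1_left mult_1_right add_ac)
  also have "\<dots> \<preceq> ?t \<otimes> ?t"
    using assms add_one_le_iff by (intro mult_mono) auto
  also have "\<dots> \<preceq> pr c d"
    by (simp add: pr_def)
  finally show ?thesis .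
qed

lemma pr_inject [simp]: "pr a b = pr c d \<longleftrightarrow> a = c \<and> b = d"
proof
  assume eq: "pr a b = pr c d"
  then have "a \<oplus> b = c \<oplus> d"
    using pr_less[of a b c d] pr_less[of c d a b] by (metis less_irrefl linorder_cases)
  moreover from this eq have "a = c" by (simp add: pr_def)
  ultimately show "a = c \<and> b = d" by simp
qed simp

abbreviation divides :: "'a \<Rightarrow> 'a \<Rightarrow> bool" where
  "divides \<equiv> dvd.dvd (\<otimes>)"

definition in_code :: "'a \<Rightarrow> 'a \<Rightarrow> 'a \<Rightarrow> bool" where
  "in_code n a b \<longleftrightarrow> divides ((n \<oplus> \<one>) \<otimes> b \<oplus> \<one>) a"

text \<open>\<open>d\<close> is one more than a multiple of \<open>k\<close>, so \<open>k\<close> is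
  invertible modulo \<open>d\<close>: with b = k r, the number x d equals (x k)(r p) + x.\<close>

lemma divides_cancel:
  assumes "divides d (x \<otimes> k)" and "divides k b" and "d = p \<otimes> b \<oplus> \<one>"
  shows "divides d x"
proof -
  obtain r where r: "b = k \<otimes> r" using assms(2) by (rule dvdE)
  have "divides d (x \<otimes> k \<otimes> (r \<otimes> p))"
    using assms(1) by (rule dvd_mult2)
  moreover have "x \<otimes> d = x \<otimes> k \<otimes> (r \<otimes> p) \<oplus> x"
    by (simp add: assms(3) r distrib_left mult_ac)
  moreover have "divides d (x \<otimes> d)" by (rule dvd_triv_right)
  ultimately show ?thesis by (simp only: dvd_add_right_iff)
qed

text \<open>
  The moduli \<open>(n + 1) b + 1\<close> are pairwise coprime since
  \<open>(m + 1) ((n + 1) b + 1) - (n + 1) ((m + 1) b + 1) = m - n\<close> divides \<open>b\<close>.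
\<close>

lemma in_code_mult_aux:
  assumes "divides k b" and "m = n \<oplus> k"
  shows "in_code m (x \<otimes> ((n \<oplus> \<one>) \<otimes> b \<oplus> \<one>)) b \<Longrightarrow> in_code m x b"
    and "in_code n (x \<otimes> ((m \<oplus> \<one>) \<otimes> b \<oplus> \<one>)) b \<Longrightarrow> in_code n x b"
proof -
  let ?d = "(m \<oplus> \<one>) \<otimes> b \<oplus> \<one>" and ?e = "(n \<oplus> \<one>) \<otimes> b \<oplus> \<one>"
  have eq: "x \<otimes> ?e \<otimes> (m \<oplus> \<one>) = x \<otimes> (n \<oplus> \<one>) \<otimes> ?d \<oplus> x \<otimes> k"
    unfolding assms(2) by (simp only: distrib_left distrib_right mult_1_left mult_1_right mult_ac add_ac)
  show "in_code m x b" if "in_code m (x \<otimes> ?e) b"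
  proof -
    have "divides ?d (x \<otimes> ?e \<otimes> (m \<oplus> \<one>))"
      using that unfolding in_code_def by (rule dvd_mult2)
    moreover have "divides ?d (x \<otimes> (n \<oplus> \<one>) \<otimes> ?d)" by (rule dvd_triv_right)
    ultimately have "divides ?d (x \<otimes> k)" unfolding eq by (simp only: dvd_add_right_iff)
    then show ?thesis unfolding in_code_def using assms(1) by (rule divides_cancel) (rule refl)
  qed
  show "in_code n x b" if "in_code n (x \<otimes> ?d) b"
  proof -
    have "divides ?e (x \<otimes> ?d \<otimes> (n \<oplus> \<one>))"
      using that unfolding in_code_def by (rule dvd_mult2)
    then have "divides ?e (x \<otimes> (n \<oplus> \<one>) \<otimes> ?d)" by (simp only: mult_ac)
    moreover have "divides ?e (x \<otimes> (n \<oplus> \<one>) \<otimes> ?d \<oplus> x \<otimes> k)"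
      unfolding eq[symmetric] by (rule dvd_mult2, rule dvd_triv_right)
    ultimately have "divides ?e (x \<otimes> k)" by (simp only: dvd_add_right_iff)
    then show ?thesis unfolding in_code_def using assms(1) by (rule divides_cancel) (rule refl)
  qed
qed

text \<open>Multiplying \<open>a\<close> by the modulus of \<open>n\<close> inserts \<open>n\<close>
  into the coded set and, the moduli being coprime below \<open>N\<close>, inserts nothing else.
  This is the step by which codes are built.\<close>

lemma in_code_mult:
  assumes "\<And>k. k \<prec> N \<Longrightarrow> divides (k \<oplus> \<one>) b" and "m \<prec> N" and "n \<prec> N"
  shows "in_code m (x \<otimes> ((n \<oplus> \<one>) \<otimes> b \<oplus> \<one>)) b \<longleftrightarrow> m = n \<or> in_code m x b"
proof -
  have *: "divides k b" if k: "k \<noteq> \<zero>" "k \<preceq> N" for k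
  proof -
    obtain l where "k = l \<oplus> \<one>" using N_zero_or_suc[of k] k(1) by blast
    then show ?thesis using assms(1)[of l] k(2) add_one_le_iff by simp
  qed
  have "in_code m x b" if "m \<noteq> n" "in_code m (x \<otimes> ((n \<oplus> \<one>) \<otimes> b \<oplus> \<one>)) b"
  proof (cases "n \<preceq> m")
    case True
    then obtain k where k: "m = n \<oplus> k" by (rule N_le_elim)
    have "k \<preceq> m" unfolding k by simp
    then have "k \<preceq> N" using less_imp_le[OF assms(2)] by (rule order_trans)
    moreover have "k \<noteq> \<zero>" using that(1) k by auto
    ultimately show ?thesis using in_code_mult_aux(1)[OF * k] that(2) by blast
  next
    case False
    then obtain k where k: "n = m \<oplus> k" using N_le_elim[of m n] by (metis linear)
    have "k \<preceq> n" unfolding k by simp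
    then have "k \<preceq> N" using less_imp_le[OF assms(3)] by (rule order_trans)
    moreover have "k \<noteq> \<zero>" using that(1) k by auto
    ultimately show ?thesis using in_code_mult_aux(2)[OF * k] that(2) by blast
  qed
  moreover have "in_code n (x \<otimes> ((n \<oplus> \<one>) \<otimes> b \<oplus> \<one>)) b"
    unfolding in_code_def by (rule dvd_triv_right)
  moreover have "in_code m (x \<otimes> ((n \<oplus> \<one>) \<otimes> b \<oplus> \<one>)) b" if "in_code m x b"
    using that unfolding in_code_def by (rule dvd_mult2)
  ultimately show ?thesis by blast
qed

end

text \<open>The bound makes divisibility a bounded formula. It loses nothing: a quotient of a
  nonzero \<open>t\<close> is at most \<open>t\<close>, and for \<open>t\<close> zero the quotient 0
  will do.\<close>

definition dvd_fm :: "ntm \<Rightarrow> ntm \<Rightarrow> fm" where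
  "dvd_fm s t = BEx ''q'' (t \<^bold>+ \<^bold>1) (t \<^bold>= s \<^bold>* Var ''q'')"

definition in_code_fm :: "ntm \<Rightarrow> ntm \<Rightarrow> ntm \<Rightarrow> fm" where
  "in_code_fm n a b = dvd_fm ((n \<^bold>+ \<^bold>1) \<^bold>* b \<^bold>+ \<^bold>1) a"

lemma bounded_dvd_fm [simp]: "''q'' \<notin> tvars t \<Longrightarrow> bounded_fm (dvd_fm s t)"
  by (simp add: dvd_fm_def)

lemma bounded_in_code_fm [simp]: "''q'' \<notin> tvars a \<Longrightarrow> bounded_fm (in_code_fm n a b)"
  by (simp add: in_code_fm_def)

lemma pars_dvd_fm [simp]:
  "fm_npars (dvd_fm s t) = tpars s \<union> tpars t" "fm_spars (dvd_fm s t) = {}"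
  by (auto simp: dvd_fm_def)

lemma pars_in_code_fm [simp]:
  "fm_npars (in_code_fm n a b) = tpars n \<union> tpars a \<union> tpars b" "fm_spars (in_code_fm n a b) = {}"
  by (auto simp: in_code_fm_def)

context rca0_model
begin

lemma sat_dvd_fm [simp]:
  assumes "''q'' \<notin> tvars s" and "''q'' \<notin> tvars t"
  shows "sat e E (dvd_fm s t) \<longleftrightarrow> divides (teval e s) (teval e t)"
proof -
  have "q \<preceq> t'" if "t' = s' \<otimes> q" "t' \<noteq> \<zero>" for q s' t'
  proof -
    have "\<one> \<preceq> s'" using that add_one_le_iff[of \<zero> s'] by (auto simp: less_le)
    then show ?thesis using mult_right_mono[of \<one> s' q] that by simp
  qed
  then have "(\<exists>q. q \<prec> t' \<oplus> \<one> \<and> t' = s' \<otimes> q) \<longleftrightarrow> divides s' t'" for s' t'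
    unfolding less_add_one_iff dvd_def by (metis zero_le mult_zero_right)
  then show ?thesis using assms by (simp add: dvd_fm_def)
qed

lemma sat_in_code_fm [simp]:
  assumes "''q'' \<notin> tvars n" and "''q'' \<notin> tvars a" and "''q'' \<notin> tvars b"
  shows "sat e E (in_code_fm n a b) \<longleftrightarrow> in_code (teval e n) (teval e a) (teval e b)"
  using assms by (simp add: in_code_fm_def in_code_def)

lemma common_multiple: "\<exists>b. \<zero> \<prec> b \<and> (\<forall>k. k \<prec> N \<longrightarrow> divides (k \<oplus> \<one>) b)"
proof -
  let ?\<theta> = "\<^bold>0 \<^bold>< Var ''b'' \<^bold>\<and> BAll ''k'' (Var ''x'') (dvd_fm (Var ''k'' \<^bold>+ \<^bold>1) (Var ''b''))"
  have "sat (e0(''x'' := N)) E0 (\<^bold>\<exists>''b''. ?\<theta>)"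
  proof (rule Sigma01_induct)
    show "Sigma01 (\<^bold>\<exists>''b''. ?\<theta>)" by (rule Sigma01.intros) simp
    show "param_free (\<^bold>\<exists>''b''. ?\<theta>)" by (simp add: param_free_def)
    show "sat (e0(''x'' := \<zero>)) E0 (\<^bold>\<exists>''b''. ?\<theta>)" by (auto simp: N_not_less_zero intro!: exI[of _ \<one>])
    show "sat (e0(''x'' := n \<oplus> \<one>)) E0 (\<^bold>\<exists>''b''. ?\<theta>)"
      if "sat (e0(''x'' := n)) E0 (\<^bold>\<exists>''b''. ?\<theta>)" for n
    proof -
      from that have "\<exists>b. \<zero> \<prec> b \<and> (\<forall>k. k \<prec> n \<longrightarrow> divides (k \<oplus> \<one>) b)" by simp
      then obtain b where b: "\<zero> \<prec> b" "\<And>k. k \<prec> n \<Longrightarrow> divides (k \<oplus> \<one>) b" by blast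
      have "\<zero> \<prec> b \<otimes> (n \<oplus> \<one>)"
        using b(1) add_nonneg_pos[OF zero_le zero_less_one] by (rule mult_pos_pos)
      moreover have "divides (k \<oplus> \<one>) (b \<otimes> (n \<oplus> \<one>))" if "k \<prec> n \<oplus> \<one>" for k
        using that b(2)[of k] unfolding N_less_suc by auto
      ultimately show ?thesis by (simp, blast)
    qed
  qed (rule E0)
  then show ?thesis by simp
qed

text \<open>With \<open>b\<close> and \<open>N\<close> fixed, induction on \<open>k\<close> produces
  a code of the part of \<open>A\<close> below \<open>k\<close>; the only unbounded quantifier is
  the one over \<open>a\<close>. The case k = N is the claim.\<close>

lemma code_exists:
  assumes "A \<in> sets"
  shows "\<exists>a b. \<forall>n. n \<prec> N \<longrightarrow> (in_code n a b \<longleftrightarrow> n \<in> A)"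
proof -
  obtain b where b: "\<zero> \<prec> b" "\<And>k. k \<prec> N \<Longrightarrow> divides (k \<oplus> \<one>) b"
    using common_multiple by blast
  let ?\<theta> = "BAll ''n'' (Var ''N'') (in_code_fm (Var ''n'') (Var ''a'') (Var ''b'') \<^bold>\<longleftrightarrow>
    Var ''n'' \<^bold>< Var ''x'' \<^bold>\<and> Var ''n'' \<^bold>\<in> SVar ''A'')"
  let ?e = "e0(''N'' := N, ''b'' := b)" and ?E = "E0(''A'' := A)"
  let ?P = "\<lambda>k. \<exists>a. \<forall>n. n \<prec> N \<longrightarrow> (in_code n a b \<longleftrightarrow> n \<prec> k \<and> n \<in> A)"
  have sat: "sat (?e(''x'' := k)) ?E (\<^bold>\<exists>''a''. ?\<theta>) \<longleftrightarrow> ?P k" for k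
    by (simp del: not_all) blast
  have "sat (?e(''x'' := N)) ?E (\<^bold>\<exists>''a''. ?\<theta>)"
  proof (rule Sigma01_induct)
    show "Sigma01 (\<^bold>\<exists>''a''. ?\<theta>)" by (rule Sigma01.intros) simp
    show "param_free (\<^bold>\<exists>''a''. ?\<theta>)" by (simp add: param_free_def)
    show "range ?E \<subseteq> sets" using E0 assms by auto
    \<comment> \<open>The number 1 codes the empty set, since every modulus is greater than
      1.\<close>
    have "\<not> in_code n \<one> b" for n
    proof
      assume "in_code n \<one> b"
      then have "divides ((n \<oplus> \<one>) \<otimes> b \<oplus> \<one>) \<one>" by (simp add: in_code_def)
      then obtain q where q: "\<one> = ((n \<oplus> \<one>) \<otimes> b \<oplus> \<one>) \<otimes> q" by (rule dvdE)
      have "\<zero> \<prec> (n \<oplus> \<one>) \<otimes> b"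
        using add_nonneg_pos[OF zero_le zero_less_one] b(1) by (rule mult_pos_pos)
      then have "\<one> \<prec> (n \<oplus> \<one>) \<otimes> b \<oplus> \<one>" by simp
      moreover have "q \<noteq> \<zero>" using q by auto
      then have "\<one> \<preceq> q" using add_one_le_iff[of \<zero> q] by (simp add: less_le)
      then have "(n \<oplus> \<one>) \<otimes> b \<oplus> \<one> \<preceq> ((n \<oplus> \<one>) \<otimes> b \<oplus> \<one>) \<otimes> q"
        using mult_left_mono[of \<one> q "(n \<oplus> \<one>) \<otimes> b \<oplus> \<one>"] by simp
      ultimately have "\<one> \<prec> ((n \<oplus> \<one>) \<otimes> b \<oplus> \<one>) \<otimes> q" by (rule less_le_trans)
      then show False using q by simp
    qed
    then have "?P \<zero>" by (auto simp: N_not_less_zero)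
    then show "sat (?e(''x'' := \<zero>)) ?E (\<^bold>\<exists>''a''. ?\<theta>)" by (simp only: sat)
    show "sat (?e(''x'' := k \<oplus> \<one>)) ?E (\<^bold>\<exists>''a''. ?\<theta>)"
      if hyp: "sat (?e(''x'' := k)) ?E (\<^bold>\<exists>''a''. ?\<theta>)" for k
    proof -
      obtain a where a: "\<And>n. n \<prec> N \<Longrightarrow> in_code n a b \<longleftrightarrow> n \<prec> k \<and> n \<in> A"
        using hyp unfolding sat by blast
      show ?thesis
      proof (cases "k \<prec> N \<and> k \<in> A")
        case True
        then have "in_code n (a \<otimes> ((k \<oplus> \<one>) \<otimes> b \<oplus> \<one>)) b \<longleftrightarrow> n \<prec> k \<oplus> \<one> \<and> n \<in> A" if "n \<prec> N" for n
          using in_code_mult[OF b(2) that] a[OF that] by (auto simp: N_less_suc)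
        then show ?thesis unfolding sat by blast
      next
        case False
        then have "in_code n a b \<longleftrightarrow> n \<prec> k \<oplus> \<one> \<and> n \<in> A" if "n \<prec> N" for n
          using a[OF that] that by (auto simp: N_less_suc)
        then show ?thesis unfolding sat by blast
      qed
    qed
  qed
  then show ?thesis unfolding sat by blast
qed

end


section \<open>Powers of two\<close>

text \<open>
  The connectives of the language are abbreviations for implications; constants keep the simplifier
  from normalising the meaning of larger formulas beyond recognition.
\<close>

definition And :: "fm \<Rightarrow> fm \<Rightarrow> fm" where
  "And \<phi> \<psi> = (\<phi> \<^bold>\<and> \<psi>)"

definition Or :: "fm \<Rightarrow> fm \<Rightarrow> fm" where
  "Or \<phi> \<psi> = (\<phi> \<^bold>\<or> \<psi>)"

lemma bounded_And_Or [simp]: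
  "bounded_fm \<phi> \<Longrightarrow> bounded_fm \<psi> \<Longrightarrow> bounded_fm (And \<phi> \<psi>)"
  "bounded_fm \<phi> \<Longrightarrow> bounded_fm \<psi> \<Longrightarrow> bounded_fm (Or \<phi> \<psi>)"
  by (simp_all add: And_def Or_def)

lemma fm_pars_And_Or [simp]:
  "fm_npars (And \<phi> \<psi>) = fm_npars \<phi> \<union> fm_npars \<psi>" "fm_npars (Or \<phi> \<psi>) = fm_npars \<phi> \<union> fm_npars \<psi>"
  "fm_spars (And \<phi> \<psi>) = fm_spars \<phi> \<union> fm_spars \<psi>" "fm_spars (Or \<phi> \<psi>) = fm_spars \<phi> \<union> fm_spars \<psi>"
  by (auto simp: And_def Or_def)

lemma (in so_structure) sat_And_Or [simp]:
  "sat e E (And \<phi> \<psi>) \<longleftrightarrow> sat e E \<phi> \<and> sat e E \<psi>"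
  "sat e E (Or \<phi> \<psi>) \<longleftrightarrow> sat e E \<phi> \<or> sat e E \<psi>"
  by (auto simp: And_def Or_def)

definition coded_mem_fm :: "ntm \<Rightarrow> fm" where
  "coded_mem_fm n = And (n \<^bold>< Var ''N'') (in_code_fm n (Var ''a'') (Var ''b''))"

text \<open>The bounds exclude nothing: the code of a pair dominates both components,
  \<open>j\<close> is below j + 1, and \<open>k\<close> is at most 2k.\<close>

definition doubling_fm :: fm where
  "doubling_fm =
    BAll ''i'' (Var ''N'') (BAll ''u'' (Var ''N'') (coded_mem_fm (pair (Var ''i'') (Var ''u'')) \<^bold>\<longrightarrow>
      Or (And (Var ''i'' \<^bold>= \<^bold>0) (Var ''u'' \<^bold>= \<^bold>1))
        (BEx ''j'' (Var ''i'') (BEx ''k'' (Var ''u'' \<^bold>+ \<^bold>1)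
          (And (Var ''i'' \<^bold>= Var ''j'' \<^bold>+ \<^bold>1) (And (Var ''u'' \<^bold>= Var ''k'' \<^bold>+ Var ''k'')
            (coded_mem_fm (pair (Var ''j'') (Var ''k'')))))))))"

text \<open>\<open>Sigma01\<close> allows a single unbounded quantifier, so \<open>w\<close> is a
  common bound for \<open>a\<close>, \<open>b\<close> and \<open>N\<close>. The value variable is an
  argument because the graph of the power function needs two candidate values at once.\<close>

definition pow_fm :: "name \<Rightarrow> fm" where
  "pow_fm v = BEx ''a'' (Var ''w'') (BEx ''b'' (Var ''w'') (BEx ''N'' (Var ''w'')
    (And doubling_fm (coded_mem_fm (pair (Var ''x'') (Var v))))))"

lemma bounded_pow_fm [simp]: "bounded_fm (pow_fm v)"
  by (simp add: pow_fm_def doubling_fm_def coded_mem_fm_def)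

lemma pars_pow_fm [simp]: "fm_npars (pow_fm v) = {}" "fm_spars (pow_fm v) = {}"
  by (auto simp: pow_fm_def doubling_fm_def coded_mem_fm_def)

context rca0_model
begin

definition coded :: "'a \<Rightarrow> 'a \<Rightarrow> 'a \<Rightarrow> 'a set" where
  "coded a b N = {n. n \<prec> N \<and> in_code n a b}"

text \<open>Each member has to be justified by a predecessor, back to the pair of 0 and 1. Such a
  set describes part of the graph of the power function without being required to contain any
  particular initial piece of it.\<close>

definition doubling :: "'a set \<Rightarrow> bool" where
  "doubling W \<longleftrightarrow> (\<forall>i u. pr i u \<in> W \<longrightarrow>
    (i = \<zero> \<and> u = \<one>) \<or> (\<exists>j k. i = j \<oplus> \<one> \<and> u = k \<oplus> k \<and> pr j k \<in> W))"

definition pow_approx :: "'a \<Rightarrow> 'a \<Rightarrow> 'a \<Rightarrow> bool" where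
  "pow_approx x y w \<longleftrightarrow> (\<exists>a. a \<prec> w \<and> (\<exists>b. b \<prec> w \<and> (\<exists>N. N \<prec> w \<and>
    doubling (coded a b N) \<and> pr x y \<in> coded a b N)))"

lemma sat_coded_mem_fm [simp]:
  "''q'' \<notin> tvars n \<Longrightarrow> sat e E (coded_mem_fm n) \<longleftrightarrow> teval e n \<in> coded (e ''a'') (e ''b'') (e ''N'')"
  by (simp add: coded_mem_fm_def coded_def)

lemma sat_doubling_fm [simp]:
  "sat e E doubling_fm \<longleftrightarrow> doubling (coded (e ''a'') (e ''b'') (e ''N''))"
proof -
  let ?W = "coded (e ''a'') (e ''b'') (e ''N'')"
  have bd: "i \<prec> e ''N'' \<and> u \<prec> e ''N''" if "pr i u \<in> ?W" for i u
  proof -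
    have "pr i u \<prec> e ''N''" using that by (simp add: coded_def)
    then show ?thesis using le_less_trans[OF fst_le_pr] le_less_trans[OF snd_le_pr] by blast
  qed
  have pred: "(\<exists>j. j \<prec> i \<and> (\<exists>k. k \<prec> u \<oplus> \<one> \<and> i = j \<oplus> \<one> \<and> u = k \<oplus> k \<and> pr j k \<in> ?W)) \<longleftrightarrow>
      (\<exists>j k. i = j \<oplus> \<one> \<and> u = k \<oplus> k \<and> pr j k \<in> ?W)" for i u
  proof -
    have "j \<prec> j \<oplus> \<one>" "k \<prec> k \<oplus> k \<oplus> \<one>" for j k
      by (simp_all add: less_add_one_iff)
    then show ?thesis by blast
  qed
  have "sat e E doubling_fm \<longleftrightarrow> (\<forall>i. i \<prec> e ''N'' \<longrightarrow> (\<forall>u. u \<prec> e ''N'' \<longrightarrow> pr i u \<in> ?W \<longrightarrow>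
      i = \<zero> \<and> u = \<one> \<or>
      (\<exists>j. j \<prec> i \<and> (\<exists>k. k \<prec> u \<oplus> \<one> \<and> i = j \<oplus> \<one> \<and> u = k \<oplus> k \<and> pr j k \<in> ?W))))"
    unfolding doubling_fm_def by simp
  then show ?thesis
    unfolding doubling_def pred using bd by blast
qed

lemma sat_pow_fm [simp]:
  "sat e E (pow_fm ''y'') \<longleftrightarrow> pow_approx (e ''x'') (e ''y'') (e ''w'')"
  "sat e E (pow_fm ''v'') \<longleftrightarrow> pow_approx (e ''x'') (e ''v'') (e ''w'')"
  unfolding pow_fm_def pow_approx_def by simp_all

lemma coded_in_sets: "coded a b N \<in> sets"
  using bounded_comprehension[of "coded_mem_fm (Var ''n'')" E0 "e0(''a'' := a, ''b'' := b, ''N'' := N)" "''n''"]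
  by (simp add: E0 param_free_def coded_mem_fm_def coded_def)

lemma coded_exists:
  assumes "A \<in> sets" and "\<And>n. n \<in> A \<Longrightarrow> n \<prec> N"
  obtains a b where "coded a b N = A"
proof -
  obtain a b where "\<forall>n. n \<prec> N \<longrightarrow> (in_code n a b \<longleftrightarrow> n \<in> A)"
    using code_exists[OF assms(1)] by blast
  then have "coded a b N = A" using assms(2) by (auto simp: coded_def)
  then show ?thesis using that by blast
qed

lemma pow_approx_mono: "pow_approx x y w \<Longrightarrow> w \<preceq> w' \<Longrightarrow> pow_approx x y w'"
  unfolding pow_approx_def by (meson less_le_trans)

lemma pow_approx_iff:
  "(\<exists>w. pow_approx x y w) \<longleftrightarrow> (\<exists>a b N. doubling (coded a b N) \<and> pr x y \<in> coded a b N)"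
proof
  assume "\<exists>a b N. doubling (coded a b N) \<and> pr x y \<in> coded a b N"
  then obtain a b N where *: "doubling (coded a b N)" "pr x y \<in> coded a b N" by blast
  have "b \<preceq> a \<oplus> b" "a \<oplus> b \<preceq> a \<oplus> b \<oplus> N" by simp_all
  then have "b \<preceq> a \<oplus> b \<oplus> N" by (rule order_trans)
  moreover have "a \<preceq> a \<oplus> b \<oplus> N" by (simp add: add_assoc)
  moreover have "N \<preceq> a \<oplus> b \<oplus> N" by simp
  ultimately have "a \<prec> a \<oplus> b \<oplus> N \<oplus> \<one>" "b \<prec> a \<oplus> b \<oplus> N \<oplus> \<one>" "N \<prec> a \<oplus> b \<oplus> N \<oplus> \<one>"
    by (simp_all only: less_add_one_iff)
  with * show "\<exists>w. pow_approx x y w" unfolding pow_approx_def by blast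
qed (auto simp: pow_approx_def)

text \<open>The values at n + 1 are doubles of values at n, so agreement propagates upwards. The
  halves never exceed the original values, hence one bound on all values serves throughout and the
  induction formula is bounded.\<close>

lemma doubling_unique:
  assumes "doubling A" "doubling B" "A \<in> sets" "B \<in> sets" "pr x y \<in> A" "pr x z \<in> B"
  shows "y = z"
proof -
  let ?\<theta> = "BAll ''u'' (Var ''M'') (BAll ''v'' (Var ''M'')
    (pair (Var ''x'') (Var ''u'') \<^bold>\<in> SVar ''A'' \<^bold>\<longrightarrow> pair (Var ''x'') (Var ''v'') \<^bold>\<in> SVar ''B'' \<^bold>\<longrightarrow>
      Var ''u'' \<^bold>= Var ''v''))"
  let ?e = "e0(''M'' := y \<oplus> z \<oplus> \<one>)" and ?E = "E0(''A'' := A, ''B'' := B)"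
  have "sat (?e(''x'' := x)) ?E ?\<theta>"
  proof (rule bounded_induct)
    show "range ?E \<subseteq> sets" using E0 assms by auto
    have "u = \<one>" if "pr \<zero> u \<in> W" "doubling W" for u W
      using that N_add_one_ne_zero unfolding doubling_def by metis
    then show "sat (?e(''x'' := \<zero>)) ?E ?\<theta>" using assms by (simp, blast)
    show "sat (?e(''x'' := n \<oplus> \<one>)) ?E ?\<theta>" if "sat (?e(''x'' := n)) ?E ?\<theta>" for n
    proof -
      have IH: "u = v" if "u \<prec> y \<oplus> z \<oplus> \<one>" "v \<prec> y \<oplus> z \<oplus> \<one>" "pr n u \<in> A" "pr n v \<in> B" for u v
        using that \<open>sat (?e(''x'' := n)) ?E ?\<theta>\<close> by simp
      have pred: "\<exists>k. u = k \<oplus> k \<and> pr n k \<in> W" if "pr (n \<oplus> \<one>) u \<in> W" "doubling W" for u W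
        using that N_add_one_ne_zero[of n] unfolding doubling_def by (metis N_add_one_inj)
      have "u = v" if uv: "u \<prec> y \<oplus> z \<oplus> \<one>" "v \<prec> y \<oplus> z \<oplus> \<one>"
        "pr (n \<oplus> \<one>) u \<in> A" "pr (n \<oplus> \<one>) v \<in> B" for u v
      proof -
        obtain k l where k: "u = k \<oplus> k" "pr n k \<in> A" and l: "v = l \<oplus> l" "pr n l \<in> B"
          using pred[OF uv(3) assms(1)] pred[OF uv(4) assms(2)] by blast
        have "k \<preceq> u" "l \<preceq> v" using k l by simp_all
        then have "k = l" using IH[OF _ _ k(2) l(2)] uv(1,2) by (blast intro: le_less_trans)
        then show ?thesis using k l by simp
      qed
      then show ?thesis by simp
    qed
  qed (simp_all add: param_free_def)
  moreover have "y \<prec> y \<oplus> z \<oplus> \<one>" "z \<prec> y \<oplus> z \<oplus> \<one>"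
    by (simp_all add: less_add_one_iff)
  ultimately show ?thesis using assms(5,6) by simp
qed

text \<open>The old code is not modified. The coded set is enlarged by comprehension and then coded
  afresh, with moduli suited to the larger bound.\<close>

lemma doubling_extend:
  assumes "doubling W" "pr x y \<in> W" "W \<in> sets" "\<And>n. n \<in> W \<Longrightarrow> n \<prec> N"
  shows "\<exists>a b N. doubling (coded a b N) \<and> pr (x \<oplus> \<one>) (y \<oplus> y) \<in> coded a b N"
proof -
  let ?p = "pr (x \<oplus> \<one>) (y \<oplus> y)"
  have "{n. n \<in> W \<or> n = ?p} \<in> sets"
    using bounded_comprehension[of "Or (Var ''n'' \<^bold>\<in> SVar ''W'') (Var ''n'' \<^bold>= Var ''p'')"
        "E0(''W'' := W)" "e0(''p'' := ?p)" "''n''"] E0 assms(3)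
    by (simp add: param_free_def image_subset_iff)
  moreover have "n \<prec> N \<oplus> ?p \<oplus> \<one>" if "n \<in> {n. n \<in> W \<or> n = ?p}" for n
    using that assms(4)[of n] by (auto simp: less_add_one_iff intro: less_imp_le add_increasing2)
  ultimately obtain a b where ab: "coded a b (N \<oplus> ?p \<oplus> \<one>) = {n. n \<in> W \<or> n = ?p}"
    by (rule coded_exists)
  have "doubling {n. n \<in> W \<or> n = ?p}"
    using assms(1,2) unfolding doubling_def by auto
  then show ?thesis using ab by (metis (mono_tags, lifting) mem_Collect_eq)
qed

lemma pow_total: "\<exists>y w. pow_approx x y w"
proof -
  \<comment> \<open>The value \<open>y\<close> is put below \<open>w\<close> too, leaving
    \<open>w\<close> as the only unbounded quantifier; enlarging \<open>w\<close> keeps an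
    approximation valid.\<close>
  let ?\<theta> = "BEx ''y'' (Var ''w'') (pow_fm ''y'')"
  have sat: "sat (e0(''x'' := n)) E0 (\<^bold>\<exists>''w''. ?\<theta>) \<longleftrightarrow> (\<exists>y w. pow_approx n y w)" for n
  proof -
    have "pow_approx n y (w \<oplus> y \<oplus> \<one>) \<and> y \<prec> w \<oplus> y \<oplus> \<one>" if "pow_approx n y w" for y w
    proof
      show "pow_approx n y (w \<oplus> y \<oplus> \<one>)"
        using that by (rule pow_approx_mono) (simp add: add_assoc)
    qed (simp add: less_add_one_iff)
    then show ?thesis by (simp, blast)
  qed
  have "sat (e0(''x'' := x)) E0 (\<^bold>\<exists>''w''. ?\<theta>)"
  proof (rule Sigma01_induct)
    show "Sigma01 (\<^bold>\<exists>''w''. ?\<theta>)" by (rule Sigma01.intros) simp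
    show "param_free (\<^bold>\<exists>''w''. ?\<theta>)" by (simp add: param_free_def)
    have "{pr \<zero> \<one>} \<in> sets"
      using bounded_comprehension[of "Var ''n'' \<^bold>= Var ''p''" E0 "e0(''p'' := pr \<zero> \<one>)" "''n''"] E0
      by (simp add: param_free_def)
    moreover have "n \<prec> pr \<zero> \<one> \<oplus> \<one>" if "n \<in> {pr \<zero> \<one>}" for n
      using that unfolding less_add_one_iff by simp
    ultimately obtain a b where "coded a b (pr \<zero> \<one> \<oplus> \<one>) = {pr \<zero> \<one>}"
      by (rule coded_exists)
    moreover have "doubling {pr \<zero> \<one>}" by (simp add: doubling_def)
    ultimately have "doubling (coded a b (pr \<zero> \<one> \<oplus> \<one>)) \<and> pr \<zero> \<one> \<in> coded a b (pr \<zero> \<one> \<oplus> \<one>)"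
      by simp
    then show "sat (e0(''x'' := \<zero>)) E0 (\<^bold>\<exists>''w''. ?\<theta>)"
      unfolding sat using pow_approx_iff by blast
    show "sat (e0(''x'' := n \<oplus> \<one>)) E0 (\<^bold>\<exists>''w''. ?\<theta>)"
      if hyp: "sat (e0(''x'' := n)) E0 (\<^bold>\<exists>''w''. ?\<theta>)" for n
    proof -
      obtain y a b N where W: "doubling (coded a b N)" "pr n y \<in> coded a b N"
        using hyp unfolding sat pow_approx_iff by blast
      have "\<exists>a b N. doubling (coded a b N) \<and> pr (n \<oplus> \<one>) (y \<oplus> y) \<in> coded a b N"
        using W coded_in_sets by (rule doubling_extend[where N = N]) (simp add: coded_def)
      then show ?thesis unfolding sat using pow_approx_iff by blast
    qed
  qed (rule E0)
  then show ?thesis unfolding sat .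
qed

lemma pow_unique:
  assumes "pow_approx x y w" and "pow_approx x z w'"
  shows "y = z"
proof -
  obtain a b N where "doubling (coded a b N)" "pr x y \<in> coded a b N"
    using assms(1) pow_approx_iff by blast
  moreover obtain a' b' N' where "doubling (coded a' b' N')" "pr x z \<in> coded a' b' N'"
    using assms(2) pow_approx_iff by blast
  ultimately show ?thesis
    by (intro doubling_unique[OF _ _ coded_in_sets coded_in_sets])
qed

definition pow2 :: "'a \<Rightarrow> 'a" where
  "pow2 x = (THE y. \<exists>w. pow_approx x y w)"

lemma pow2_iff: "(\<exists>w. pow_approx x y w) \<longleftrightarrow> y = pow2 x"
proof -
  have ex: "\<exists>!y. \<exists>w. pow_approx x y w"
  proof (rule ex_ex1I)
    show "y = z" if "\<exists>w. pow_approx x y w" "\<exists>w. pow_approx x z w" for y z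
      using that pow_unique by blast
  qed (rule pow_total)
  have "\<exists>w. pow_approx x (pow2 x) w" unfolding pow2_def by (rule theI'[OF ex])
  then show ?thesis using ex by blast
qed

lemma pow2_doubling: "\<exists>a b N. doubling (coded a b N) \<and> pr x (pow2 x) \<in> coded a b N"
  using pow2_iff[of x "pow2 x"] pow_approx_iff by blast

lemma pow2_zero [simp]: "pow2 \<zero> = \<one>"
proof -
  obtain a b N where "doubling (coded a b N)" "pr \<zero> (pow2 \<zero>) \<in> coded a b N"
    using pow2_doubling by blast
  then have "pow2 \<zero> = \<one> \<or> (\<exists>j. \<zero> = j \<oplus> \<one>)" unfolding doubling_def by blast
  then show ?thesis using N_add_one_ne_zero[THEN not_sym] by blast
qed

lemma pow2_add_one: "pow2 (x \<oplus> \<one>) = pow2 x \<oplus> pow2 x"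
proof -
  obtain a b N where W: "doubling (coded a b N)" "pr x (pow2 x) \<in> coded a b N"
    using pow2_doubling by blast
  have "\<exists>a b N. doubling (coded a b N) \<and> pr (x \<oplus> \<one>) (pow2 x \<oplus> pow2 x) \<in> coded a b N"
    using W coded_in_sets by (rule doubling_extend[where N = N]) (simp add: coded_def)
  then have "\<exists>w. pow_approx (x \<oplus> \<one>) (pow2 x \<oplus> pow2 x) w" by (simp only: pow_approx_iff)
  then show ?thesis unfolding pow2_iff by (rule sym)
qed

definition graph :: "('a \<Rightarrow> 'a) \<Rightarrow> 'a set" where
  "graph f = {pr x (f x) | x. True}"

lemma pr_in_graph [simp]: "pr x y \<in> graph f \<longleftrightarrow> y = f x"
  by (auto simp: graph_def)

text \<open>Totality and uniqueness give the graph two forms: some approximation yields the value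
  \<open>y\<close>, and every value yielded by an approximation equals \<open>y\<close>. The
  components of \<open>z\<close> are determined by \<open>z\<close>, so their bounded quantifiers
  may stand inside the universal one.\<close>

lemma graph_pow2: "graph pow2 \<in> sets"
proof -
  let ?z = "Var ''z''" and ?p = "Var ''z'' \<^bold>= pair (Var ''x'') (Var ''y'')"
  let ?\<theta> = "BEx ''x'' (?z \<^bold>+ \<^bold>1) (BEx ''y'' (?z \<^bold>+ \<^bold>1) (And ?p (pow_fm ''y'')))"
  let ?\<theta>' = "BEx ''x'' (?z \<^bold>+ \<^bold>1) (BEx ''y'' (?z \<^bold>+ \<^bold>1) (And ?p
    (BAll ''v'' (Var ''w'') (pow_fm ''v'' \<^bold>\<longrightarrow> Var ''v'' \<^bold>= Var ''y''))))"
  have bd: "x \<prec> pr x y \<oplus> \<one>" "y \<prec> pr x y \<oplus> \<one>" for x y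
    unfolding less_add_one_iff by (rule fst_le_pr snd_le_pr)+
  have pow_ex: "\<exists>w. pow_approx x (pow2 x) w" for x
    by (simp only: pow2_iff)
  have pow_eq: "y = pow2 x" if "pow_approx x y w" for x y w
    using that pow2_iff[of x y] by blast
  have 1: "(\<exists>b. sat (e0(''z'' := a, ''w'' := b)) E0 ?\<theta>) \<longleftrightarrow> (\<exists>x. a = pr x (pow2 x))" for a
  proof -
    have eq: "(\<exists>b. sat (e0(''z'' := a, ''w'' := b)) E0 ?\<theta>) \<longleftrightarrow>
        (\<exists>b x. x \<prec> a \<oplus> \<one> \<and> (\<exists>y. y \<prec> a \<oplus> \<one> \<and> a = pr x y \<and> pow_approx x y b))"
      by simp
    show ?thesis
    proof
      assume "\<exists>b. sat (e0(''z'' := a, ''w'' := b)) E0 ?\<theta>"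
      then show "\<exists>x. a = pr x (pow2 x)" unfolding eq using pow_eq by blast
    next
      assume "\<exists>x. a = pr x (pow2 x)"
      then obtain x where a: "a = pr x (pow2 x)" by blast
      then have "x \<prec> a \<oplus> \<one>" "pow2 x \<prec> a \<oplus> \<one>" using bd by blast+
      then show "\<exists>b. sat (e0(''z'' := a, ''w'' := b)) E0 ?\<theta>"
        unfolding eq using a pow_ex[of x] by blast
    qed
  qed
  have 2: "(\<forall>b. sat (e0(''z'' := a, ''w'' := b)) E0 ?\<theta>') \<longleftrightarrow> (\<exists>x. a = pr x (pow2 x))" for a
  proof -
    have eq: "(\<forall>b. sat (e0(''z'' := a, ''w'' := b)) E0 ?\<theta>') \<longleftrightarrow>
        (\<forall>w. \<exists>x. x \<prec> a \<oplus> \<one> \<and> (\<exists>y. y \<prec> a \<oplus> \<one> \<and> a = pr x y \<and>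
          (\<forall>v. v \<prec> w \<longrightarrow> pow_approx x v w \<longrightarrow> v = y)))"
      by simp
    show ?thesis
    proof
      assume "\<exists>x. a = pr x (pow2 x)"
      then obtain x where a: "a = pr x (pow2 x)" by blast
      then have "x \<prec> a \<oplus> \<one>" "pow2 x \<prec> a \<oplus> \<one>" using bd by blast+
      then show "\<forall>b. sat (e0(''z'' := a, ''w'' := b)) E0 ?\<theta>'"
        unfolding eq using a pow_eq by blast
    next
      assume "\<forall>b. sat (e0(''z'' := a, ''w'' := b)) E0 ?\<theta>'"
      then have all: "\<exists>x y. a = pr x y \<and> (\<forall>v. v \<prec> w \<longrightarrow> pow_approx x v w \<longrightarrow> v = y)" for w
        unfolding eq by blast
      then obtain x y where a: "a = pr x y" by blast
      obtain w where w: "pow_approx x (pow2 x) w" using pow_ex by blast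
      \<comment> \<open>The universal form inspects only values \<open>v\<close> below
        \<open>w\<close>. The approximation bound is enlarged until the true value is among
        them.\<close>
      have "w \<preceq> w \<oplus> pow2 x \<oplus> \<one>" by (simp add: add_assoc)
      with w have "pow_approx x (pow2 x) (w \<oplus> pow2 x \<oplus> \<one>)" by (rule pow_approx_mono)
      moreover have "pow2 x \<prec> w \<oplus> pow2 x \<oplus> \<one>" by (simp add: less_add_one_iff)
      ultimately have "pow2 x = y" using all[of "w \<oplus> pow2 x \<oplus> \<one>"] a by auto
      then show "\<exists>x. a = pr x (pow2 x)" using a by blast
    qed
  qed
  have "{a. \<exists>b. sat (e0(''z'' := a, ''w'' := b)) E0 ?\<theta>} \<in> sets"
  proof (rule Delta1_comprehension)
    show "(\<exists>b. sat (e0(''z'' := a, ''w'' := b)) E0 ?\<theta>) \<longleftrightarrow>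
        (\<forall>b. sat (e0(''z'' := a, ''w'' := b)) E0 ?\<theta>')" for a
      by (simp only: 1 2)
  qed (simp_all add: param_free_def E0)
  then show ?thesis unfolding 1 graph_def by simp
qed

end

section \<open>Differences of powers of two and gaps of a set\<close>

definition successive_fm :: "name \<Rightarrow> name \<Rightarrow> fm" where
  "successive_fm j k = And (Var j \<^bold>\<in> SVar ''J'') (And (Var k \<^bold>\<in> SVar ''J'') (And (Var j \<^bold>< Var k)
    (BAll ''i'' (Var k) (Var ''i'' \<^bold>\<in> SVar ''J'' \<^bold>\<longrightarrow> \<^bold>\<not> Var j \<^bold>< Var ''i''))))"

lemma bounded_successive_fm [simp]: "''i'' \<noteq> k \<Longrightarrow> bounded_fm (successive_fm j k)"
  by (simp add: successive_fm_def)

lemma pars_successive_fm [simp]: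
  "fm_npars (successive_fm j k) = {}" "fm_spars (successive_fm j k) = {}"
  by (simp_all add: successive_fm_def)

context rca0_model
begin

text \<open>The language has no symbol for powers; with the graph of \<open>pow2\<close> as the set
  \<open>P\<close>, the equation becomes a \<open>Sigma01\<close> formula in which \<open>v\<close>
  names the power at \<open>k\<close>, and induction applies.\<close>

lemma pow2_add: "pow2 (x \<oplus> k) = pow2 x \<otimes> pow2 k"
proof -
  let ?\<theta> = "And (pair (Var ''k'') (Var ''v'') \<^bold>\<in> SVar ''P'')
    (pair (Var ''x'' \<^bold>+ Var ''k'') (Var ''p'' \<^bold>* Var ''v'') \<^bold>\<in> SVar ''P'')"
  let ?e = "e0(''x'' := x, ''p'' := pow2 x)" and ?E = "E0(''P'' := graph pow2)"
  have sat: "sat (?e(''k'' := n)) ?E (\<^bold>\<exists>''v''. ?\<theta>) \<longleftrightarrow> pow2 (x \<oplus> n) = pow2 x \<otimes> pow2 n" for n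
    by (auto simp: sat_abbrevs)
  have "sat (?e(''k'' := k)) ?E (\<^bold>\<exists>''v''. ?\<theta>)"
  proof (rule Sigma01_induct)
    show "Sigma01 (\<^bold>\<exists>''v''. ?\<theta>)" by (rule Sigma01.intros) simp
    show "param_free (\<^bold>\<exists>''v''. ?\<theta>)" by (simp add: param_free_def)
    show "range ?E \<subseteq> sets" using E0 graph_pow2 by auto
    show "sat (?e(''k'' := \<zero>)) ?E (\<^bold>\<exists>''v''. ?\<theta>)" unfolding sat by simp
    show "sat (?e(''k'' := n \<oplus> \<one>)) ?E (\<^bold>\<exists>''v''. ?\<theta>)" if "sat (?e(''k'' := n)) ?E (\<^bold>\<exists>''v''. ?\<theta>)" for n
      using that unfolding sat by (simp add: pow2_add_one distrib_left flip: add_assoc)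
  qed
  then show ?thesis unfolding sat .
qed

lemma less_pow2: "x \<prec> pow2 x"
proof -
  let ?\<theta> = "And (pair (Var ''k'') (Var ''v'') \<^bold>\<in> SVar ''P'') (Var ''k'' \<^bold>< Var ''v'')"
  let ?E = "E0(''P'' := graph pow2)"
  have sat: "sat (e0(''k'' := n)) ?E (\<^bold>\<exists>''v''. ?\<theta>) \<longleftrightarrow> n \<prec> pow2 n" for n
    by (auto simp: sat_abbrevs)
  have "sat (e0(''k'' := x)) ?E (\<^bold>\<exists>''v''. ?\<theta>)"
  proof (rule Sigma01_induct)
    show "Sigma01 (\<^bold>\<exists>''v''. ?\<theta>)" by (rule Sigma01.intros) simp
    show "param_free (\<^bold>\<exists>''v''. ?\<theta>)" by (simp add: param_free_def)
    show "range ?E \<subseteq> sets" using E0 graph_pow2 by auto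
    show "sat (e0(''k'' := \<zero>)) ?E (\<^bold>\<exists>''v''. ?\<theta>)" unfolding sat by simp
    show "sat (e0(''k'' := n \<oplus> \<one>)) ?E (\<^bold>\<exists>''v''. ?\<theta>)" if "sat (e0(''k'' := n)) ?E (\<^bold>\<exists>''v''. ?\<theta>)" for n
    proof -
      have n: "n \<prec> pow2 n" using that unfolding sat .
      have "\<one> \<preceq> pow2 n"
        using le_less_trans[OF zero_le n] add_one_le_iff[of \<zero> "pow2 n"] by simp
      with n have "n \<oplus> \<one> \<prec> pow2 n \<oplus> pow2 n" by (rule add_less_le_mono)
      then show ?thesis unfolding sat pow2_add_one .
    qed
  qed
  then show ?thesis unfolding sat .
qed

lemma pow2_pos: "\<zero> \<prec> pow2 x"
  using le_less_trans[OF zero_le less_pow2] .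

lemma one_le_pow2: "\<one> \<preceq> pow2 x"
  using pow2_pos[of x] add_one_le_iff[of \<zero> "pow2 x"] by simp

lemma pow2_mono: "x \<preceq> y \<Longrightarrow> pow2 x \<preceq> pow2 y"
proof (erule N_le_elim)
  fix c assume "y = x \<oplus> c"
  moreover have "pow2 x \<otimes> \<one> \<preceq> pow2 x \<otimes> pow2 c"
    using one_le_pow2 by (rule mult_left_mono) simp
  ultimately show ?thesis by (simp add: pow2_add)
qed

definition pdiff :: "'a \<Rightarrow> 'a \<Rightarrow> 'a" where
  "pdiff x y = pow2 y \<ominus> pow2 x"

lemma pdiff_add: "x \<preceq> y \<Longrightarrow> pdiff x y \<oplus> pow2 x = pow2 y"
  unfolding pdiff_def by (rule le_add_diff_inverse2) (rule pow2_mono)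

lemma pdiff_eq_iff: "x \<preceq> y \<Longrightarrow> d = pdiff x y \<longleftrightarrow> pow2 y = d \<oplus> pow2 x"
  using pdiff_add[of x y] by (metis add_right_cancel)

lemma double_le_pow2:
  assumes "x \<prec> y"
  shows "pow2 x \<oplus> pow2 x \<preceq> pow2 y"
  using pow2_mono[of "x \<oplus> \<one>" y] assms unfolding pow2_add_one add_one_le_iff by simp

lemma pow2_le_pdiff: "x \<prec> y \<Longrightarrow> pow2 x \<preceq> pdiff x y"
  using double_le_pow2[of x y] pdiff_add[of x y] by (metis add_le_cancel_right less_imp_le)

lemma pdiff_less_pow2: "x \<preceq> y \<Longrightarrow> pdiff x y \<prec> pow2 y"
  using pdiff_add[of x y] pow2_pos[of x] by (metis less_add_same_cancel1)

text \<open>Writing y = z + 1 with x \<le> z, the difference is at least 2^z, which exceeds z. This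
  estimate bounds the search for exponents when a difference is given.\<close>

lemma snd_le_pdiff:
  assumes "x \<prec> y"
  shows "y \<preceq> pdiff x y"
proof -
  obtain z where z: "y = z \<oplus> \<one>" using assms N_zero_or_suc[of y] N_not_less_zero by blast
  then have "x \<preceq> z" using assms less_add_one_iff by simp
  have "pow2 z \<oplus> pow2 x \<preceq> pow2 z \<oplus> pow2 z" using pow2_mono[OF \<open>x \<preceq> z\<close>] by simp
  also have "\<dots> = pdiff x y \<oplus> pow2 x"
    using pdiff_add[of x y] assms by (simp add: z pow2_add_one less_imp_le)
  finally have "pow2 z \<preceq> pdiff x y" by simp
  with less_pow2[of z] have "z \<prec> pdiff x y" by (rule less_le_trans)
  then show ?thesis unfolding z add_one_le_iff .
qed

lemma pdiff_concat: "x \<preceq> y \<Longrightarrow> y \<preceq> z \<Longrightarrow> pdiff x y \<oplus> pdiff y z = pdiff x z"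
proof -
  assume "x \<preceq> y" "y \<preceq> z"
  then have "pow2 z = pdiff y z \<oplus> (pdiff x y \<oplus> pow2 x)" by (simp add: pdiff_add)
  then show ?thesis
    using \<open>x \<preceq> y\<close> \<open>y \<preceq> z\<close> order_trans[of x y z] by (simp add: pdiff_eq_iff add_ac)
qed

definition pdiff_set :: "'a set" where
  "pdiff_set = {pr (pr x y) (pdiff x y) | x y. x \<prec> y}"

lemma pdiff_set_iff: "pr (pr x y) d \<in> pdiff_set \<longleftrightarrow> x \<prec> y \<and> d = pdiff x y"
  by (auto simp: pdiff_set_def)

lemma less_pr_add_one: "a \<prec> pr a b \<oplus> \<one>" "b \<prec> pr a b \<oplus> \<one>"
  unfolding less_add_one_iff by (rule fst_le_pr snd_le_pr)+

lemma pdiff_set: "pdiff_set \<in> sets"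
proof -
  let ?\<theta> = "BEx ''a'' (Var ''z'' \<^bold>+ \<^bold>1) (BEx ''d'' (Var ''z'' \<^bold>+ \<^bold>1)
    (And (Var ''z'' \<^bold>= pair (Var ''a'') (Var ''d''))
    (BEx ''x'' (Var ''a'' \<^bold>+ \<^bold>1) (BEx ''y'' (Var ''a'' \<^bold>+ \<^bold>1)
      (And (Var ''a'' \<^bold>= pair (Var ''x'') (Var ''y'')) (And (Var ''x'' \<^bold>< Var ''y'')
      (BEx ''u'' (Var ''d'' \<^bold>+ Var ''d'' \<^bold>+ \<^bold>1) (And (pair (Var ''x'') (Var ''u'') \<^bold>\<in> SVar ''P'')
        (pair (Var ''y'') (Var ''d'' \<^bold>+ Var ''u'') \<^bold>\<in> SVar ''P'')))))))))"
  have eq: "sat (e0(''z'' := z)) (E0(''P'' := graph pow2)) ?\<theta> \<longleftrightarrow>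
    (\<exists>a. a \<prec> z \<oplus> \<one> \<and> (\<exists>d. d \<prec> z \<oplus> \<one> \<and> z = pr a d \<and>
      (\<exists>x. x \<prec> a \<oplus> \<one> \<and> (\<exists>y. y \<prec> a \<oplus> \<one> \<and> a = pr x y \<and> x \<prec> y \<and>
        (\<exists>u. u \<prec> d \<oplus> d \<oplus> \<one> \<and> u = pow2 x \<and> d \<oplus> u = pow2 y)))))" for z
    by simp
  have "sat (e0(''z'' := z)) (E0(''P'' := graph pow2)) ?\<theta> \<longleftrightarrow> z \<in> pdiff_set" for z
    unfolding eq
  proof
    assume "z \<in> pdiff_set"
    then obtain x y where z: "z = pr (pr x y) (pdiff x y)" "x \<prec> y" by (auto simp: pdiff_set_def)
    have "pdiff x y \<oplus> pow2 x = pow2 y" using z(2) by (simp add: pdiff_add less_imp_le)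
    moreover have "pow2 x \<prec> pdiff x y \<oplus> pdiff x y \<oplus> \<one>"
      unfolding less_add_one_iff using pow2_le_pdiff[OF z(2)] by (rule order_trans) simp
    ultimately show "\<exists>a. a \<prec> z \<oplus> \<one> \<and> (\<exists>d. d \<prec> z \<oplus> \<one> \<and> z = pr a d \<and>
      (\<exists>x. x \<prec> a \<oplus> \<one> \<and> (\<exists>y. y \<prec> a \<oplus> \<one> \<and> a = pr x y \<and> x \<prec> y \<and>
        (\<exists>u. u \<prec> d \<oplus> d \<oplus> \<one> \<and> u = pow2 x \<and> d \<oplus> u = pow2 y))))"
      using z less_pr_add_one by blast
  next
    assume "\<exists>a. a \<prec> z \<oplus> \<one> \<and> (\<exists>d. d \<prec> z \<oplus> \<one> \<and> z = pr a d \<and>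
      (\<exists>x. x \<prec> a \<oplus> \<one> \<and> (\<exists>y. y \<prec> a \<oplus> \<one> \<and> a = pr x y \<and> x \<prec> y \<and>
        (\<exists>u. u \<prec> d \<oplus> d \<oplus> \<one> \<and> u = pow2 x \<and> d \<oplus> u = pow2 y))))"
    then obtain d x y where "z = pr (pr x y) d" "x \<prec> y" "pow2 y = d \<oplus> pow2 x" by metis
    then show "z \<in> pdiff_set" by (simp add: pdiff_set_iff pdiff_eq_iff less_imp_le)
  qed
  then show ?thesis
    using bounded_comprehension[of ?\<theta> "E0(''P'' := graph pow2)" e0 "''z''"] E0 graph_pow2
    by (simp add: param_free_def image_subset_iff del: sat_BAll_BEx)
qed

text \<open>Without a least element, the absence of elements below n would be inductive in n, and
  this is a bounded formula with \<open>A\<close> as parameter.\<close>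

lemma least_element:
  assumes "A \<in> sets" and "a \<in> A"
  obtains m where "m \<in> A" and "\<And>i. i \<in> A \<Longrightarrow> m \<preceq> i"
proof -
  have "\<exists>m\<in>A. \<forall>i\<in>A. m \<preceq> i"
  proof (rule ccontr)
    assume none: "\<not> (\<exists>m\<in>A. \<forall>i\<in>A. m \<preceq> i)"
    have "sat (e0(''x'' := a \<oplus> \<one>)) (E0(''A'' := A)) (BAll ''i'' (Var ''x'') (\<^bold>\<not> Var ''i'' \<^bold>\<in> SVar ''A''))"
    proof (rule bounded_induct)
      show "range (E0(''A'' := A)) \<subseteq> sets" using E0 assms by auto
      show "sat (e0(''x'' := n \<oplus> \<one>)) (E0(''A'' := A)) (BAll ''i'' (Var ''x'') (\<^bold>\<not> Var ''i'' \<^bold>\<in> SVar ''A''))"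
        if "sat (e0(''x'' := n)) (E0(''A'' := A)) (BAll ''i'' (Var ''x'') (\<^bold>\<not> Var ''i'' \<^bold>\<in> SVar ''A''))" for n
      proof -
        have below: "i \<notin> A" if "i \<prec> n" for i
          using that \<open>sat (e0(''x'' := n)) _ _\<close> by simp
        then have "n \<notin> A" using none not_le by blast
        then show ?thesis using below by (auto simp: N_less_suc)
      qed
    qed (simp_all add: param_free_def N_not_less_zero)
    then show False using assms(2) by (simp add: less_add_one_iff)
  qed
  then show ?thesis using that by blast
qed

definition successive :: "'a set \<Rightarrow> 'a \<Rightarrow> 'a \<Rightarrow> bool" where
  "successive J j k \<longleftrightarrow> j \<in> J \<and> k \<in> J \<and> j \<prec> k \<and> (\<forall>i. i \<prec> k \<longrightarrow> i \<in> J \<longrightarrow> \<not> j \<prec> i)"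

lemma sat_successive_fm [simp]:
  "''i'' \<noteq> j \<Longrightarrow> ''i'' \<noteq> k \<Longrightarrow> sat e E (successive_fm j k) \<longleftrightarrow> successive (E ''J'') (e j) (e k)"
  by (simp add: successive_fm_def successive_def)

lemma successiveD:
  "successive J j k \<Longrightarrow> j \<in> J" "successive J j k \<Longrightarrow> k \<in> J" "successive J j k \<Longrightarrow> j \<prec> k"
  "successive J j k \<Longrightarrow> i \<in> J \<Longrightarrow> j \<prec> i \<Longrightarrow> k \<preceq> i"
  unfolding successive_def using not_le by blast+

lemma successive_exists:
  assumes "J \<in> sets" and "\<And>x. \<exists>y. y \<in> J \<and> x \<prec> y" and "j \<in> J"
  shows "\<exists>k. successive J j k"
proof -
  have "{n. n \<in> J \<and> j \<prec> n} \<in> sets"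
    using bounded_comprehension[of "And (Var ''n'' \<^bold>\<in> SVar ''J'') (Var ''j'' \<^bold>< Var ''n'')"
        "E0(''J'' := J)" "e0(''j'' := j)" "''n''"] E0 assms(1)
    by (simp add: param_free_def image_subset_iff)
  moreover obtain y where "y \<in> {n. n \<in> J \<and> j \<prec> n}" using assms(2) by blast
  ultimately obtain k where "k \<in> {n. n \<in> J \<and> j \<prec> n}" "\<And>i. i \<in> {n. n \<in> J \<and> j \<prec> n} \<Longrightarrow> k \<preceq> i"
    by (rule least_element) blast
  then have "successive J j k" using assms(3) not_le unfolding successive_def by blast
  then show ?thesis by blast
qed

definition gap_set :: "'a set \<Rightarrow> 'a set" where
  "gap_set J = {pdiff j k | j k. successive J j k}"

text \<open>A gap dominates both of its exponents by \<open>snd_le_pdiff\<close>, so membership is a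
  bounded condition once the table of differences is used as a set parameter.\<close>

lemma gap_set:
  assumes "J \<in> sets"
  shows "gap_set J \<in> sets"
proof -
  let ?\<theta> = "BEx ''j'' (Var ''z'' \<^bold>+ \<^bold>1) (BEx ''k'' (Var ''z'' \<^bold>+ \<^bold>1)
    (And (successive_fm ''j'' ''k'') (pair (pair (Var ''j'') (Var ''k'')) (Var ''z'') \<^bold>\<in> SVar ''D'')))"
  let ?E = "E0(''J'' := J, ''D'' := pdiff_set)"
  have eq: "sat (e0(''z'' := z)) ?E ?\<theta> \<longleftrightarrow> (\<exists>j. j \<prec> z \<oplus> \<one> \<and> (\<exists>k. k \<prec> z \<oplus> \<one> \<and>
      successive J j k \<and> pr (pr j k) z \<in> pdiff_set))" for z
    by simp
  have bd: "j \<prec> pdiff j k \<oplus> \<one> \<and> k \<prec> pdiff j k \<oplus> \<one>" if "j \<prec> k" for j k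
    using snd_le_pdiff[OF that] less_imp_le[OF that] unfolding less_add_one_iff by (blast intro: order_trans)
  have "sat (e0(''z'' := z)) ?E ?\<theta> \<longleftrightarrow> z \<in> gap_set J" for z
    unfolding eq gap_set_def pdiff_set_iff using bd successiveD(3) by blast
  then show ?thesis
    using bounded_comprehension[of ?\<theta> ?E e0 "''z''"] E0 assms pdiff_set
    by (simp add: param_free_def image_subset_iff del: sat_BAll_BEx)
qed

text \<open>If k \<le> j', then 2^k - 2^j < 2^k \<le> 2^j' \<le> 2^k' - 2^j'. The converse follows
  because intervals between successive elements are equal or ordered one after the other. Both
  apartness and the analysis of enumerations rest on this comparison.\<close>

lemma gap_less_iff:
  assumes "successive J j k" and "successive J j' k'"
  shows "pdiff j k \<prec> pdiff j' k' \<longleftrightarrow> k \<preceq> j'"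
proof
  have less: "pdiff j k \<prec> pdiff j' k'" if "successive J j k" "successive J j' k'" "k \<preceq> j'" for j k j' k'
  proof -
    have "pdiff j k \<prec> pow2 k" using that(1) by (intro pdiff_less_pow2 less_imp_le successiveD(3))
    also have "\<dots> \<preceq> pow2 j'" using that(3) by (rule pow2_mono)
    also have "\<dots> \<preceq> pdiff j' k'" using that(2) by (intro pow2_le_pdiff successiveD(3))
    finally show ?thesis .
  qed
  show "k \<preceq> j' \<Longrightarrow> pdiff j k \<prec> pdiff j' k'" using assms by (rule less)
  assume *: "pdiff j k \<prec> pdiff j' k'"
  consider "j \<prec> j'" | "j = j'" | "j' \<prec> j" using less_linear by blast
  then show "k \<preceq> j'"
  proof cases
    case 1
    then show ?thesis using assms successiveD by blast
  next
    case 2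
    then have "k = k'" using assms successiveD by (metis order.antisym)
    then show ?thesis using 2 * by simp
  next
    case 3
    then have "k' \<preceq> j" using assms successiveD by blast
    then have "pdiff j' k' \<prec> pdiff j k" by (rule less[OF assms(2,1)])
    then show ?thesis using * less_asym by blast
  qed
qed

end


section \<open>Meaning of the formulas in a model\<close>

definition ExSet :: "name \<Rightarrow> fm \<Rightarrow> fm" where
  "ExSet X \<phi> = (\<^bold>\<exists>\<^sub>sX. \<phi>)"

lemma (in so_structure) sat_ExSet [simp]:
  "sat e E (ExSet X \<phi>) \<longleftrightarrow> (\<exists>A\<in>sets. sat e (E(X := A)) \<phi>)"
  by (simp add: ExSet_def)

context rca0_model
begin

lemma graph_comprehension:
  assumes "bounded_fm \<theta>" and "param_free \<theta>" and "range E \<subseteq> sets" and "''z'' \<notin> free_nvars \<theta>"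
    and eq: "\<And>i v. sat (e(''i'' := i, ''v'' := v)) E \<theta> \<longleftrightarrow> v = f i"
  shows "graph f \<in> sets"
proof -
  let ?\<phi> = "BEx ''i'' (Var ''z'' \<^bold>+ \<^bold>1) (BEx ''v'' (Var ''z'' \<^bold>+ \<^bold>1)
    (And (Var ''z'' \<^bold>= pair (Var ''i'') (Var ''v'')) \<theta>))"
  have "sat (e(''z'' := z, ''i'' := i, ''v'' := v)) E \<theta> \<longleftrightarrow> v = f i" for z i v
    unfolding eq[symmetric] using assms(4) by (intro sat_cong) auto
  then have eq': "sat (e(''z'' := z)) E ?\<phi> \<longleftrightarrow>
      (\<exists>i. i \<prec> z \<oplus> \<one> \<and> (\<exists>v. v \<prec> z \<oplus> \<one> \<and> z = pr i v \<and> v = f i))" for z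
    by simp
  have "sat (e(''z'' := z)) E ?\<phi> \<longleftrightarrow> z \<in> graph f" for z
    unfolding eq'
  proof
    assume "z \<in> graph f"
    then obtain i where "z = pr i (f i)" by (auto simp: graph_def)
    moreover from this have "i \<prec> z \<oplus> \<one>" "f i \<prec> z \<oplus> \<one>" using less_pr_add_one by simp_all
    ultimately show "\<exists>i. i \<prec> z \<oplus> \<one> \<and> (\<exists>v. v \<prec> z \<oplus> \<one> \<and> z = pr i v \<and> v = f i)"
      by blast
  qed auto
  then have "graph f = {z. sat (e(''z'' := z)) E ?\<phi>}" by blast
  also have "\<dots> \<in> sets"
    using assms(1-3) by (intro bounded_comprehension) (simp_all add: param_free_def)
  finally show ?thesis .
qed

lemma graph_eqI:
  assumes "\<And>z. z \<in> X \<Longrightarrow> \<exists>u v. z = pr u v" and "\<And>u. pr u (f u) \<in> X" and "\<And>u w. pr u w \<in> X \<Longrightarrow> w = f u"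
  shows "X = graph f"
proof (rule set_eqI)
  fix z
  show "z \<in> X \<longleftrightarrow> z \<in> graph f"
  proof
    assume "z \<in> X"
    moreover from this obtain u v where "z = pr u v" using assms(1) by blast
    ultimately show "z \<in> graph f" using assms(3) by simp
  next
    assume "z \<in> graph f"
    then obtain u where "z = pr u (f u)" by (auto simp: graph_def)
    then show "z \<in> X" using assms(2) by simp
  qed
qed

definition fun_code :: "('a \<Rightarrow> bool) \<Rightarrow> ('a \<Rightarrow> bool) \<Rightarrow> 'a set \<Rightarrow> bool" where
  "fun_code D R X \<longleftrightarrow> (\<forall>z. z \<in> X \<longrightarrow> (\<exists>u v. D u \<and> R v \<and> z = pr u v)) \<and>
    (\<forall>u. D u \<longrightarrow> (\<exists>v. pr u v \<in> X \<and> R v \<and> (\<forall>w. pr u w \<in> X \<longrightarrow> w = v)))"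

lemma sat_is_function:
  assumes "\<And>e. sat e E (A (Var ''u'')) \<longleftrightarrow> D (e ''u'')" and "\<And>e. sat e E (B (Var ''v'')) \<longleftrightarrow> R (e ''v'')"
  shows "sat e E (is_function A B X) \<longleftrightarrow> fun_code D R (seval E X)"
proof -
  have "is_function A B X =
    And (\<^bold>\<forall>''z''. Var ''z'' \<^bold>\<in> X \<^bold>\<longrightarrow> (\<^bold>\<exists>''u''. \<^bold>\<exists>''v''.
          And (A (Var ''u'')) (And (B (Var ''v'')) (Var ''z'' \<^bold>= pair (Var ''u'') (Var ''v'')))))
      (\<^bold>\<forall>''u''. A (Var ''u'') \<^bold>\<longrightarrow> (\<^bold>\<exists>''v''. And (B (Var ''v'')) (And (maps X (Var ''u'') (Var ''v''))
          (\<^bold>\<forall>''w''. maps X (Var ''u'') (Var ''w'') \<^bold>\<longrightarrow> Var ''w'' \<^bold>= Var ''v''))))"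
    by (simp only: is_function_def And_def)
  then show ?thesis by (simp add: assms maps_def fun_code_def)
qed

lemma fun_code_graph:
  assumes "fun_code (\<lambda>_. True) R X"
  obtains f where "X = graph f" and "\<And>x. R (f x)"
proof -
  have "\<exists>v. R v \<and> pr u v \<in> X \<and> (\<forall>w. pr u w \<in> X \<longrightarrow> w = v)" for u
    using assms unfolding fun_code_def by blast
  then obtain f where f: "\<And>u. R (f u) \<and> pr u (f u) \<in> X \<and> (\<forall>w. pr u w \<in> X \<longrightarrow> w = f u)"
    by metis
  have "X = graph f"
  proof (rule graph_eqI)
    show "\<exists>u v. z = pr u v" if "z \<in> X" for z using assms that unfolding fun_code_def by blast
  qed (use f in simp_all)
  then show ?thesis using that f by blast
qed

lemma sat_is_function_nat:
  "sat e E (is_function is_nat is_nat X) \<longleftrightarrow> (\<exists>f. seval E X = graph f)"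
proof -
  have "sat e E (is_function is_nat is_nat X) \<longleftrightarrow> fun_code (\<lambda>_. True) (\<lambda>_. True) (seval E X)"
    by (rule sat_is_function) (simp_all add: is_nat_def)
  also have "\<dots> \<longleftrightarrow> (\<exists>f. seval E X = graph f)"
  proof
    assume "\<exists>f. seval E X = graph f"
    then obtain f where "seval E X = graph f" by blast
    then show "fun_code (\<lambda>_. True) (\<lambda>_. True) (seval E X)"
      by (auto simp: fun_code_def graph_def)
  qed (erule fun_code_graph, blast)
  finally show ?thesis .
qed

lemma below_2: "below 2 a = (a \<^bold>< \<^bold>0 \<^bold>+ \<^bold>1 \<^bold>+ \<^bold>1)"
  by (simp add: below_def numeral_2_eq_2)

lemma sat_is_colouring:
  assumes "sat e E (is_function is_nat (below 2) X)"
  obtains f where "seval E X = graph f" and "\<And>x. f x \<prec> \<one> \<oplus> \<one>"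
proof -
  have "sat e E (is_function is_nat (below 2) X) \<longleftrightarrow>
      fun_code (\<lambda>_. True) (\<lambda>v. v \<prec> \<one> \<oplus> \<one>) (seval E X)"
    by (rule sat_is_function) (simp_all add: is_nat_def below_2)
  with assms have "fun_code (\<lambda>_. True) (\<lambda>v. v \<prec> \<one> \<oplus> \<one>) (seval E X)" by blast
  then show ?thesis using that by (rule fun_code_graph)
qed

text \<open>Between \<open>a\<close> and \<open>b\<close> the values of \<open>q\<close> are the
  partial sums; elsewhere they are arbitrary. Having the graph of \<open>q\<close> in
  \<open>sets\<close> admits \<open>q\<close> to induction formulas.\<close>

definition sum_is :: "('a \<Rightarrow> 'a) \<Rightarrow> 'a \<Rightarrow> 'a \<Rightarrow> 'a \<Rightarrow> bool" where
  "sum_is f a b r \<longleftrightarrow> a \<preceq> b \<and> (\<exists>q. graph q \<in> sets \<and> q a = f a \<and>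
    (\<forall>m. a \<preceq> m \<longrightarrow> m \<prec> b \<longrightarrow> q (m \<oplus> \<one>) = q m \<oplus> f (m \<oplus> \<one>)) \<and> q b = r)"

lemma sat_is_sum:
  assumes "seval E X = graph f" and "''Q'' \<notin> svars X"
    and "\<And>t. t \<in> {a, b, r} \<Longrightarrow> tvars t \<inter> {''u'', ''v'', ''m''} = {}"
  shows "sat e E (is_sum X a b r) \<longleftrightarrow> sum_is f (teval e a) (teval e b) (teval e r)"
proof -
  have tv: "''u'' \<notin> tvars t" "''v'' \<notin> tvars t" "''m'' \<notin> tvars t" if "t \<in> {a, b, r}" for t
    using assms(3)[OF that] by auto
  note [simp] = tv[of a, simplified] tv[of b, simplified] tv[of r, simplified] assms(2)
  have "is_sum X a b r = And (Or (a \<^bold>< b) (a \<^bold>= b)) (ExSet ''Q''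
      (And (is_function is_nat is_nat (SVar ''Q''))
      (And (\<^bold>\<forall>''u''. maps X a (Var ''u'') \<^bold>\<longrightarrow> maps (SVar ''Q'') a (Var ''u''))
      (And (\<^bold>\<forall>''m''. \<^bold>\<forall>''u''. \<^bold>\<forall>''v''.
        And (Or (a \<^bold>< Var ''m'') (a \<^bold>= Var ''m'')) (And (Var ''m'' \<^bold>< b)
          (And (maps (SVar ''Q'') (Var ''m'') (Var ''u'')) (maps X (Var ''m'' \<^bold>+ \<^bold>1) (Var ''v'')))) \<^bold>\<longrightarrow>
        maps (SVar ''Q'') (Var ''m'' \<^bold>+ \<^bold>1) (Var ''u'' \<^bold>+ Var ''v''))
      (maps (SVar ''Q'') b r)))))"
    by (simp only: is_sum_def And_def Or_def ExSet_def)
  then have "sat e E (is_sum X a b r) \<longleftrightarrow> (teval e a \<prec> teval e b \<or> teval e a = teval e b) \<and>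
    (\<exists>Q\<in>sets. (\<exists>q. Q = graph q) \<and> pr (teval e a) (f (teval e a)) \<in> Q \<and>
      (\<forall>m u. (teval e a \<prec> m \<or> teval e a = m) \<and> m \<prec> teval e b \<and> pr m u \<in> Q \<longrightarrow>
        pr (m \<oplus> \<one>) (u \<oplus> f (m \<oplus> \<one>)) \<in> Q) \<and>
      pr (teval e b) (teval e r) \<in> Q)"
    by (simp add: sat_is_function_nat maps_def assms(1))
  also have "\<dots> \<longleftrightarrow> sum_is f (teval e a) (teval e b) (teval e r)"
  proof -
    let ?R = "\<lambda>Q. pr (teval e a) (f (teval e a)) \<in> Q \<and>
      (\<forall>m u. (teval e a \<prec> m \<or> teval e a = m) \<and> m \<prec> teval e b \<and> pr m u \<in> Q \<longrightarrow>
        pr (m \<oplus> \<one>) (u \<oplus> f (m \<oplus> \<one>)) \<in> Q) \<and>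
      pr (teval e b) (teval e r) \<in> Q"
    have "?R (graph q) \<longleftrightarrow> q (teval e a) = f (teval e a) \<and>
        (\<forall>m. teval e a \<preceq> m \<longrightarrow> m \<prec> teval e b \<longrightarrow> q (m \<oplus> \<one>) = q m \<oplus> f (m \<oplus> \<one>)) \<and>
        q (teval e b) = teval e r" for q
      by (auto simp: le_def)
    moreover have "(\<exists>Q\<in>sets. (\<exists>q. Q = graph q) \<and> ?R Q) \<longleftrightarrow> (\<exists>q. graph q \<in> sets \<and> ?R (graph q))"
      by (rule iffI; elim bexE exE conjE) blast+
    ultimately show ?thesis unfolding sum_is_def le_def by simp
  qed
  finally show ?thesis .
qed

section \<open>Binary digits of a difference of powers, and apartness\<close>

lemma graph_add: "graph (\<lambda>i. j \<oplus> i) \<in> sets"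
  by (rule graph_comprehension[of "Var ''v'' \<^bold>= Var ''j'' \<^bold>+ Var ''i''" E0 "e0(''j'' := j)"])
    (simp_all add: param_free_def E0)

lemma graph_pow2_add: "graph (\<lambda>i. pow2 (j \<oplus> i)) \<in> sets"
  by (rule graph_comprehension[of "pair (Var ''j'' \<^bold>+ Var ''i'') (Var ''v'') \<^bold>\<in> SVar ''P''"
        "E0(''P'' := graph pow2)" "e0(''j'' := j)"])
    (simp_all add: param_free_def E0 graph_pow2 image_subset_iff range_subsetD[OF E0])

lemma graph_pdiff: "graph (\<lambda>m. pdiff j (j \<oplus> m \<oplus> \<one>)) \<in> sets"
proof (rule graph_comprehension)
  let ?\<theta> = "pair (pair (Var ''j'') (Var ''j'' \<^bold>+ Var ''i'' \<^bold>+ \<^bold>1)) (Var ''v'') \<^bold>\<in> SVar ''D''"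
  show "bounded_fm ?\<theta>" "param_free ?\<theta>" "''z'' \<notin> free_nvars ?\<theta>"
    by (simp_all add: param_free_def)
  show "range (E0(''D'' := pdiff_set)) \<subseteq> sets"
    using E0 pdiff_set by auto
  have "j \<prec> j \<oplus> i \<oplus> \<one>" for i by (simp add: less_add_one_iff)
  then show "sat ((e0(''j'' := j))(''i'' := i, ''v'' := v)) (E0(''D'' := pdiff_set)) ?\<theta> \<longleftrightarrow>
      v = pdiff j (j \<oplus> i \<oplus> \<one>)" for i v
    by (simp add: pdiff_set_iff)
qed

text \<open>The partial sums have a closed form whose graph is already a set of the model, so the
  recurrence is verified directly from 2^(n+1) - 2^n = 2^n, without induction.\<close>

lemma sum_pow2: "sum_is (\<lambda>i. pow2 (j \<oplus> i)) \<zero> m (pdiff j (j \<oplus> m \<oplus> \<one>))"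
  unfolding sum_is_def
proof (intro conjI exI[of _ "\<lambda>m. pdiff j (j \<oplus> m \<oplus> \<one>)"] allI impI)
  have step: "pdiff j (n \<oplus> \<one>) = pdiff j n \<oplus> pow2 n" if "j \<preceq> n" for n
  proof -
    have "pdiff n (n \<oplus> \<one>) = pow2 n" by (simp add: pdiff_def pow2_add_one)
    then show ?thesis using pdiff_concat[of j n "n \<oplus> \<one>"] that by simp
  qed
  have "pdiff j j = \<zero>" by (simp add: pdiff_def)
  then show "pdiff j (j \<oplus> \<zero> \<oplus> \<one>) = pow2 (j \<oplus> \<zero>)" using step[of j] by simp
  show "pdiff j (j \<oplus> (n \<oplus> \<one>) \<oplus> \<one>) = pdiff j (j \<oplus> n \<oplus> \<one>) \<oplus> pow2 (j \<oplus> (n \<oplus> \<one>))" for n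
    using step[of "j \<oplus> (n \<oplus> \<one>)"] by (simp add: add_assoc)
qed (simp_all add: graph_pdiff)

lemma sat_is_powers_of_two: "E ''E'' = graph pow2 \<Longrightarrow> sat e E (is_powers_of_two (SVar ''E''))"
proof -
  assume E: "E ''E'' = graph pow2"
  have "is_powers_of_two (SVar ''E'') = And (is_function is_nat is_nat (SVar ''E''))
      (And (maps (SVar ''E'') \<^bold>0 \<^bold>1) (\<^bold>\<forall>''m''. \<^bold>\<forall>''u''. maps (SVar ''E'') (Var ''m'') (Var ''u'') \<^bold>\<longrightarrow>
        maps (SVar ''E'') (Var ''m'' \<^bold>+ \<^bold>1) (numeral_tm 2 \<^bold>* Var ''u'')))"
    by (simp only: is_powers_of_two_def And_def)
  moreover have "\<exists>f. graph pow2 = graph f" by blast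
  ultimately show ?thesis
    using E by (simp add: sat_is_function_nat maps_def numeral_2_eq_2 pow2_add_one mult_2)
qed

text \<open>The exponents are j, ..., j + m, listed by the function i \<mapsto> j + i. The last
  index is \<open>m\<close>, one less than the number of digits. The names allowed for
  \<open>r\<close> are those at which the apartness formula evaluates its digit functions.\<close>

lemma sat_is_binary_expansion:
  assumes "E ''T'' = graph (\<lambda>i. j \<oplus> i)" and "e ''q'' = m" and "e r = pdiff j (j \<oplus> m \<oplus> \<one>)"
    and "r \<in> {''x'', ''y''}"
  shows "sat e E (is_binary_expansion (SVar ''T'') (Var ''q'') (Var r))"
proof -
  let ?T = "SVar ''T''" and ?E = "SVar ''E''" and ?G = "SVar ''G''"
  let ?E' = "E(''E'' := graph pow2, ''G'' := graph (\<lambda>i. pow2 (j \<oplus> i)))"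
  have "is_binary_expansion ?T (Var ''q'') (Var r) = And (is_function is_nat is_nat ?T)
      (And (\<^bold>\<forall>''i''. \<^bold>\<forall>''j''. \<^bold>\<forall>''u''. \<^bold>\<forall>''v''. And (Var ''i'' \<^bold>< Var ''j'')
        (And (Or (Var ''j'' \<^bold>< Var ''q'') (Var ''j'' \<^bold>= Var ''q''))
        (And (maps ?T (Var ''i'') (Var ''u'')) (maps ?T (Var ''j'') (Var ''v'')))) \<^bold>\<longrightarrow> Var ''u'' \<^bold>< Var ''v'')
      (ExSet ''E'' (ExSet ''G'' (And (is_powers_of_two ?E) (And (is_function is_nat is_nat ?G)
        (And (\<^bold>\<forall>''i''. \<^bold>\<forall>''u''. \<^bold>\<forall>''v''. And (maps ?T (Var ''i'') (Var ''u'')) (maps ?E (Var ''u'') (Var ''v'')) \<^bold>\<longrightarrow>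
          maps ?G (Var ''i'') (Var ''v''))
        (is_sum ?G \<^bold>0 (Var ''q'') (Var r))))))))"
    by (simp only: is_binary_expansion_def strictly_increasing_upto_def And_def Or_def ExSet_def)
  moreover have "sat e ?E' (is_powers_of_two ?E)"
    by (rule sat_is_powers_of_two) simp
  moreover have "sat e ?E' (is_function is_nat is_nat ?G)" "sat e E (is_function is_nat is_nat ?T)"
    using assms(1) by (auto simp: sat_is_function_nat)
  moreover have "sat e ?E' (is_sum ?G \<^bold>0 (Var ''q'') (Var r)) \<longleftrightarrow>
      sum_is (\<lambda>i. pow2 (j \<oplus> i)) (teval e \<^bold>0) (teval e (Var ''q'')) (teval e (Var r))"
    using assms(4) by (intro sat_is_sum) auto
  then have "sat e ?E' (is_sum ?G \<^bold>0 (Var ''q'') (Var r))"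
    using sum_pow2[of j m] assms(2,3) by simp
  ultimately show ?thesis
    using assms(1) graph_pow2 graph_pow2_add[of j]
    by (simp add: maps_def)
      (rule bexI[of _ "graph pow2"], rule bexI[of _ "graph (\<lambda>i. pow2 (j \<oplus> i))"], simp_all)
qed

lemma sat_mu_is:
  assumes "e ''x'' = pdiff j (j \<oplus> m \<oplus> \<one>)" and "e ''s'' = j \<oplus> m"
  shows "sat e E (mu_is (Var ''x'') (Var ''s''))"
proof -
  let ?e = "e(''q'' := m)" and ?E = "E(''T'' := graph (\<lambda>i. j \<oplus> i))"
  have "sat ?e ?E (is_binary_expansion (SVar ''T'') (Var ''q'') (Var ''x''))"
    using assms by (intro sat_is_binary_expansion[of _ j _ m]) simp_all
  moreover have "sat ?e ?E (maps (SVar ''T'') (Var ''q'') (Var ''s''))"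
    using assms by (simp add: maps_def)
  ultimately have "sat ?e ?E (is_binary_expansion (SVar ''T'') (Var ''q'') (Var ''x'') \<^bold>\<and>
      maps (SVar ''T'') (Var ''q'') (Var ''s''))"
    by (simp only: sat_abbrevs(2))
  then show ?thesis
    unfolding mu_is_def sat_abbrevs(5,6) using graph_add by blast
qed

lemma sat_lambda_is:
  assumes "e ''y'' = pdiff j (j \<oplus> m \<oplus> \<one>)" and "e ''t'' = j"
  shows "sat e E (lambda_is (Var ''y'') (Var ''t''))"
proof -
  let ?e = "e(''q'' := m)" and ?E = "E(''T'' := graph (\<lambda>i. j \<oplus> i))"
  have "sat ?e ?E (is_binary_expansion (SVar ''T'') (Var ''q'') (Var ''y''))"
    using assms by (intro sat_is_binary_expansion[of _ j _ m]) simp_all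
  moreover have "sat ?e ?E (maps (SVar ''T'') \<^bold>0 (Var ''t''))"
    using assms by (simp add: maps_def)
  ultimately have "sat ?e ?E (is_binary_expansion (SVar ''T'') (Var ''q'') (Var ''y'') \<^bold>\<and>
      maps (SVar ''T'') \<^bold>0 (Var ''t''))"
    by (simp only: sat_abbrevs(2))
  then show ?thesis
    unfolding lambda_is_def sat_abbrevs(5,6) using graph_add by blast
qed

lemma less_elim:
  assumes "a \<prec> b"
  obtains c where "b = a \<oplus> c \<oplus> \<one>"
  using assms unfolding N_less_iff by (auto simp: add_assoc)

lemma sat_is_apart:
  assumes "E ''H'' = gap_set J"
  shows "sat e E (is_apart (SVar ''H''))"
proof -
  have "is_apart (SVar ''H'') = (\<^bold>\<forall>''x''. \<^bold>\<forall>''y''. And (Var ''x'' \<^bold>\<in> SVar ''H'') (And (Var ''y'' \<^bold>\<in> SVar ''H'')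
      (Var ''x'' \<^bold>< Var ''y'')) \<^bold>\<longrightarrow> (\<^bold>\<exists>''s''. \<^bold>\<exists>''t''. And (mu_is (Var ''x'') (Var ''s''))
      (And (lambda_is (Var ''y'') (Var ''t'')) (Var ''s'' \<^bold>< Var ''t''))))"
    by (simp only: is_apart_def And_def)
  moreover have "\<exists>s t. sat (e(''x'' := x, ''y'' := y, ''s'' := s, ''t'' := t)) E (mu_is (Var ''x'') (Var ''s'')) \<and>
      sat (e(''x'' := x, ''y'' := y, ''s'' := s, ''t'' := t)) E (lambda_is (Var ''y'') (Var ''t'')) \<and> s \<prec> t"
    if "x \<in> gap_set J" "y \<in> gap_set J" "x \<prec> y" for x y
  proof -
    obtain j k j' k' where x: "x = pdiff j k" "successive J j k" and y: "y = pdiff j' k'" "successive J j' k'"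
      using \<open>x \<in> gap_set J\<close> \<open>y \<in> gap_set J\<close> unfolding gap_set_def by blast
    obtain m where m: "k = j \<oplus> m \<oplus> \<one>" using successiveD(3)[OF x(2)] by (rule less_elim)
    obtain m' where m': "k' = j' \<oplus> m' \<oplus> \<one>" using successiveD(3)[OF y(2)] by (rule less_elim)
    \<comment> \<open>The top digit of \<open>x\<close> stands at k - 1 = j + m, so the weak
      inequality between \<open>k\<close> and \<open>j'\<close> becomes the strict one required of
      the exponents.\<close>
    have "j \<oplus> m \<prec> j'"
      using \<open>x \<prec> y\<close> gap_less_iff[OF x(2) y(2)] unfolding x(1) y(1) m add_one_le_iff by blast
    moreover let ?e = "e(''x'' := x, ''y'' := y, ''s'' := j \<oplus> m, ''t'' := j')"
    have "sat ?e E (mu_is (Var ''x'') (Var ''s''))"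
      by (rule sat_mu_is[of _ j m]) (simp_all add: x(1) m)
    moreover have "sat ?e E (lambda_is (Var ''y'') (Var ''t''))"
      by (rule sat_lambda_is[of _ j' m']) (simp_all add: y(1) m')
    ultimately show ?thesis by blast
  qed
  ultimately show ?thesis using assms by simp
qed

section \<open>Adjacent sums of gaps\<close>

lemma next_gap:
  assumes "J \<in> sets" and "\<And>x. \<exists>y. y \<in> J \<and> x \<prec> y"
    and mono: "\<And>i j. i \<prec> j \<Longrightarrow> l i \<prec> l j" and range: "\<And>u. u \<in> gap_set J \<longleftrightarrow> (\<exists>i. u = l i)"
    and "successive J a b" and "l m = pdiff a b"
  shows "\<exists>c. successive J b c \<and> l (m \<oplus> \<one>) = pdiff b c"
proof -
  have "l (m \<oplus> \<one>) \<in> gap_set J" using range by blast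
  then obtain a' b' where a': "l (m \<oplus> \<one>) = pdiff a' b'" "successive J a' b'"
    unfolding gap_set_def by blast
  have "l m \<prec> l (m \<oplus> \<one>)" using mono by (simp add: less_add_one_iff)
  then have "b \<preceq> a'" using gap_less_iff[OF assms(5) a'(2)] assms(6) a'(1) by simp
  \<comment> \<open>Otherwise the gap starting at \<open>b\<close> lies strictly between two
    consecutive values of the enumeration. Being a gap it is itself enumerated, at an index strictly
    between \<open>m\<close> and m + 1, which cannot exist.\<close>
  have "a' = b"
  proof (rule ccontr)
    assume "a' \<noteq> b"
    then have "b \<prec> a'" using \<open>b \<preceq> a'\<close> by (simp add: less_le)
    obtain c where c: "successive J b c"
      using successive_exists[OF assms(1,2)] successiveD(2)[OF assms(5)] by blast
    then have "pdiff b c \<in> gap_set J" unfolding gap_set_def by blast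
    then obtain n where n: "pdiff b c = l n" using range by blast
    have "c \<preceq> a'" using c a'(2) \<open>b \<prec> a'\<close> successiveD(1,4) by blast
    then have "l n \<prec> l (m \<oplus> \<one>)" using gap_less_iff[OF c a'(2)] n a'(1) by simp
    moreover have "l m \<prec> l n" using gap_less_iff[OF assms(5) c] n assms(6) by simp
    ultimately have "m \<prec> n \<and> n \<prec> m \<oplus> \<one>"
      using mono not_less_iff_gr_or_eq by (metis less_asym less_irrefl)
    then show False unfolding less_add_one_iff by auto
  qed
  then show ?thesis using a' by blast
qed

text \<open>The induction runs over the number of summands. Knowing that the partial sum has the
  form 2^b - 2^a0 is not enough; the last summand must be known to end at the same \<open>b\<close>,
  so that the next gap starts there and the powers cancel.\<close>

lemma adjacent_sum:
  assumes J: "J \<in> sets" "\<And>x. \<exists>y. y \<in> J \<and> x \<prec> y"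
    and l: "graph l \<in> sets" "\<And>i j. i \<prec> j \<Longrightarrow> l i \<prec> l j" "\<And>u. u \<in> gap_set J \<longleftrightarrow> (\<exists>i. u = l i)"
    and sum: "sum_is l i j s"
  shows "\<exists>a b. a \<in> J \<and> b \<in> J \<and> a \<prec> b \<and> s = pdiff a b"
proof -
  obtain q where "i \<preceq> j" and q: "graph q \<in> sets" "q i = l i" "q j = s"
    and step: "\<And>m. i \<preceq> m \<Longrightarrow> m \<prec> j \<Longrightarrow> q (m \<oplus> \<one>) = q m \<oplus> l (m \<oplus> \<one>)"
    using sum unfolding sum_is_def by blast
  obtain a0 b0 where a0: "l i = pdiff a0 b0" "successive J a0 b0"
    using l(3) unfolding gap_set_def by blast
  define P where "P n \<longleftrightarrow> (i \<oplus> n \<preceq> j \<longrightarrow> (\<exists>b. b \<prec> q (i \<oplus> n) \<oplus> \<one> \<and> a0 \<prec> b \<and> q (i \<oplus> n) = pdiff a0 b \<and>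
    l (i \<oplus> n) \<prec> q (i \<oplus> n) \<oplus> \<one> \<and> (\<exists>a. a \<prec> b \<and> l (i \<oplus> n) = pdiff a b \<and> successive J a b)))" for n
  \<comment> \<open>The bounds in \<open>P\<close> come for free: an upper exponent is at most the
    difference, and the last summand is at most the partial sum.\<close>
  have P_I: "P n" if "i \<oplus> n \<preceq> j \<Longrightarrow> \<exists>a b. successive J a b \<and> a0 \<prec> b \<and> q (i \<oplus> n) = pdiff a0 b \<and>
    l (i \<oplus> n) = pdiff a b \<and> l (i \<oplus> n) \<preceq> q (i \<oplus> n)" for n
    unfolding P_def less_add_one_iff using that snd_le_pdiff successiveD(3) by metis
  let ?n = "Var ''i'' \<^bold>+ Var ''n''"
  \<comment> \<open>\<open>v\<close> names the partial sum and is the single unbounded quantifier;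
    the last summand \<open>h\<close> and the exponents are searched below it. Past the end of the
    sum the formula holds vacuously, so the induction need not stop at \<open>j\<close>.\<close>
  let ?\<theta> = "?n \<^bold>< Var ''j'' \<^bold>+ \<^bold>1 \<^bold>\<longrightarrow> And (pair ?n (Var ''v'') \<^bold>\<in> SVar ''Q'')
    (BEx ''b'' (Var ''v'' \<^bold>+ \<^bold>1) (And (pair (pair (Var ''c'') (Var ''b'')) (Var ''v'') \<^bold>\<in> SVar ''D'')
    (BEx ''h'' (Var ''v'' \<^bold>+ \<^bold>1) (And (pair ?n (Var ''h'') \<^bold>\<in> SVar ''L'')
    (BEx ''a'' (Var ''b'') (And (pair (pair (Var ''a'') (Var ''b'')) (Var ''h'') \<^bold>\<in> SVar ''D'')
      (successive_fm ''a'' ''b'')))))))"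
  let ?e = "e0(''i'' := i, ''j'' := j, ''c'' := a0)"
  let ?E = "E0(''Q'' := graph q, ''L'' := graph l, ''D'' := pdiff_set, ''J'' := J)"
  have sat: "sat (?e(''n'' := n)) ?E (\<^bold>\<exists>''v''. ?\<theta>) \<longleftrightarrow> P n" for n
  proof -
    have "sat (?e(''n'' := n)) ?E (\<^bold>\<exists>''v''. ?\<theta>) \<longleftrightarrow> (\<exists>v. i \<oplus> n \<preceq> j \<longrightarrow> v = q (i \<oplus> n) \<and>
      (\<exists>b. b \<prec> v \<oplus> \<one> \<and> (a0 \<prec> b \<and> v = pdiff a0 b) \<and> (\<exists>h. h \<prec> v \<oplus> \<one> \<and> h = l (i \<oplus> n) \<and>
      (\<exists>a. a \<prec> b \<and> (a \<prec> b \<and> h = pdiff a b) \<and> successive J a b))))"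
      unfolding sat_abbrevs(5) by (simp add: less_add_one_iff pdiff_set_iff)
    also have "\<dots> \<longleftrightarrow> P n" unfolding P_def by (cases "i \<oplus> n \<preceq> j") auto
    finally show ?thesis .
  qed
  have P: "P n" for n
  proof -
    have "sat (?e(''n'' := n)) ?E (\<^bold>\<exists>''v''. ?\<theta>)"
    proof (rule Sigma01_induct)
      show "Sigma01 (\<^bold>\<exists>''v''. ?\<theta>)" by (rule Sigma01.intros) simp
      show "param_free (\<^bold>\<exists>''v''. ?\<theta>)" by (simp add: param_free_def)
      show "range ?E \<subseteq> sets" using E0 pdiff_set J(1) q(1) l(1) by auto
      show "sat (?e(''n'' := \<zero>)) ?E (\<^bold>\<exists>''v''. ?\<theta>)"
        unfolding sat using a0 successiveD(3)[OF a0(2)] q(2) by (intro P_I) auto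
      show "sat (?e(''n'' := n \<oplus> \<one>)) ?E (\<^bold>\<exists>''v''. ?\<theta>)" if hyp: "sat (?e(''n'' := n)) ?E (\<^bold>\<exists>''v''. ?\<theta>)" for n
        unfolding sat
      proof (rule P_I)
        assume "i \<oplus> (n \<oplus> \<one>) \<preceq> j"
        then have le: "i \<oplus> n \<prec> j" by (simp only: add_one_le_iff flip: add_assoc)
        then obtain a b where ab: "a0 \<prec> b" "q (i \<oplus> n) = pdiff a0 b" "l (i \<oplus> n) = pdiff a b" "successive J a b"
          using hyp unfolding sat P_def by (auto simp: less_imp_le)
        obtain c where c: "successive J b c" "l (i \<oplus> n \<oplus> \<one>) = pdiff b c"
          using next_gap[OF J l(2,3) ab(4,3)] by blast
        have qs: "q (i \<oplus> n \<oplus> \<one>) = pdiff a0 b \<oplus> pdiff b c"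
          using step[of "i \<oplus> n"] le ab(2) c(2) by simp
        also have "\<dots> = pdiff a0 c"
          using ab(1) successiveD(3)[OF c(1)] by (intro pdiff_concat less_imp_le)
        finally have "q (i \<oplus> n \<oplus> \<one>) = pdiff a0 c" .
        moreover have "l (i \<oplus> n \<oplus> \<one>) \<preceq> q (i \<oplus> n \<oplus> \<one>)" unfolding qs c(2) by simp
        moreover have "a0 \<prec> c" using ab(1) successiveD(3)[OF c(1)] by (rule less_trans)
        ultimately show "\<exists>a b. successive J a b \<and> a0 \<prec> b \<and> q (i \<oplus> (n \<oplus> \<one>)) = pdiff a0 b \<and>
            l (i \<oplus> (n \<oplus> \<one>)) = pdiff a b \<and> l (i \<oplus> (n \<oplus> \<one>)) \<preceq> q (i \<oplus> (n \<oplus> \<one>))"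
          using c unfolding add_assoc[symmetric] by blast
      qed
    qed
    then show ?thesis unfolding sat .
  qed
  obtain n where n: "j = i \<oplus> n" using \<open>i \<preceq> j\<close> by (rule N_le_elim)
  obtain a b where "a0 \<prec> b" "q j = pdiff a0 b" "successive J a b"
    using P[of n] unfolding P_def n by auto
  then show ?thesis using q(3) successiveD(1)[OF a0(2)] successiveD(2) by blast
qed

section \<open>The colouring of pairs and its homogeneous set\<close>

definition pair_colouring :: "('a \<Rightarrow> 'a) \<Rightarrow> 'a set" where
  "pair_colouring f = {pr (pr x y) (f (pdiff x y)) | x y. x \<prec> y}"

text \<open>The difference d = 2^y - 2^x is exponential in the code of the pair, so no term bounds
  it and a bounded formula is not at hand. As d is determined by the pair, it can be quantified
  existentially or universally, which yields the two forms for comprehension.\<close>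

lemma pair_colouring:
  assumes "graph f \<in> sets"
  shows "pair_colouring f \<in> sets"
proof -
  let ?p = "Var ''z'' \<^bold>= pair (Var ''a'') (Var ''c'')"
  let ?\<theta> = "BEx ''a'' (Var ''z'' \<^bold>+ \<^bold>1) (BEx ''c'' (Var ''z'' \<^bold>+ \<^bold>1) (And ?p
    (And (pair (Var ''a'') (Var ''d'') \<^bold>\<in> SVar ''D'') (pair (Var ''d'') (Var ''c'') \<^bold>\<in> SVar ''C''))))"
  \<comment> \<open>The universal form states separately that \<open>a\<close> codes an increasing
    pair; for any other \<open>a\<close> the implication about \<open>d\<close> would hold
    vacuously.\<close>
  let ?\<theta>' = "BEx ''a'' (Var ''z'' \<^bold>+ \<^bold>1) (BEx ''c'' (Var ''z'' \<^bold>+ \<^bold>1) (And ?p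
    (And (BEx ''x'' (Var ''a'' \<^bold>+ \<^bold>1) (BEx ''y'' (Var ''a'' \<^bold>+ \<^bold>1)
        (And (Var ''a'' \<^bold>= pair (Var ''x'') (Var ''y'')) (Var ''x'' \<^bold>< Var ''y''))))
      (pair (Var ''a'') (Var ''d'') \<^bold>\<in> SVar ''D'' \<^bold>\<longrightarrow> pair (Var ''d'') (Var ''c'') \<^bold>\<in> SVar ''C''))))"
  let ?E = "E0(''D'' := pdiff_set, ''C'' := graph f)"
  have 1: "(\<exists>d. sat (e0(''z'' := z, ''d'' := d)) ?E ?\<theta>) \<longleftrightarrow> z \<in> pair_colouring f" for z
  proof -
    have eq: "(\<exists>d. sat (e0(''z'' := z, ''d'' := d)) ?E ?\<theta>) \<longleftrightarrow> (\<exists>d a. a \<prec> z \<oplus> \<one> \<and> (\<exists>c. c \<prec> z \<oplus> \<one> \<and>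
        z = pr a c \<and> pr a d \<in> pdiff_set \<and> c = f d))"
      by simp
    show ?thesis
    proof
      assume "\<exists>d. sat (e0(''z'' := z, ''d'' := d)) ?E ?\<theta>"
      then obtain d a where "z = pr a (f d)" "pr a d \<in> pdiff_set" unfolding eq by blast
      then show "z \<in> pair_colouring f" unfolding pdiff_set_def pair_colouring_def by auto
    next
      assume "z \<in> pair_colouring f"
      then obtain x y where z: "z = pr (pr x y) (f (pdiff x y))" "x \<prec> y"
        unfolding pair_colouring_def by blast
      then have "pr x y \<prec> z \<oplus> \<one>" "f (pdiff x y) \<prec> z \<oplus> \<one>" using less_pr_add_one by simp_all
      moreover have "pr (pr x y) (pdiff x y) \<in> pdiff_set" using z(2) pdiff_set_iff by blast
      ultimately show "\<exists>d. sat (e0(''z'' := z, ''d'' := d)) ?E ?\<theta>"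
        unfolding eq using z(1) by blast
    qed
  qed
  have 2: "(\<forall>d. sat (e0(''z'' := z, ''d'' := d)) ?E ?\<theta>') \<longleftrightarrow> z \<in> pair_colouring f" for z
  proof -
    have eq: "(\<forall>d. sat (e0(''z'' := z, ''d'' := d)) ?E ?\<theta>') \<longleftrightarrow> (\<forall>d. \<exists>a. a \<prec> z \<oplus> \<one> \<and> (\<exists>c. c \<prec> z \<oplus> \<one> \<and>
        z = pr a c \<and> (\<exists>x. x \<prec> a \<oplus> \<one> \<and> (\<exists>y. y \<prec> a \<oplus> \<one> \<and> a = pr x y \<and> x \<prec> y)) \<and>
        (pr a d \<in> pdiff_set \<longrightarrow> c = f d)))"
      by simp
    show ?thesis
    proof
      assume all: "\<forall>d. sat (e0(''z'' := z, ''d'' := d)) ?E ?\<theta>'"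
      then obtain x y c where z: "z = pr (pr x y) c" "x \<prec> y" unfolding eq by blast
      then have "c = f (pdiff x y)"
        using all[unfolded eq, rule_format, of "pdiff x y"] by (auto simp: pdiff_set_iff)
      then show "z \<in> pair_colouring f" using z unfolding pair_colouring_def by blast
    next
      assume "z \<in> pair_colouring f"
      then obtain x y where z: "z = pr (pr x y) (f (pdiff x y))" "x \<prec> y"
        unfolding pair_colouring_def by blast
      then have bd: "pr x y \<prec> z \<oplus> \<one>" "f (pdiff x y) \<prec> z \<oplus> \<one>" using less_pr_add_one by simp_all
      have "\<exists>x'. x' \<prec> pr x y \<oplus> \<one> \<and> (\<exists>y'. y' \<prec> pr x y \<oplus> \<one> \<and> pr x y = pr x' y' \<and> x' \<prec> y')"
        using less_pr_add_one z(2) by blast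
      moreover have "pr (pr x y) d \<in> pdiff_set \<longrightarrow> f (pdiff x y) = f d" for d
        by (simp add: pdiff_set_iff)
      ultimately show "\<forall>d. sat (e0(''z'' := z, ''d'' := d)) ?E ?\<theta>'"
        unfolding eq using z(1) bd by blast
    qed
  qed
  have "{z. \<exists>d. sat (e0(''z'' := z, ''d'' := d)) ?E ?\<theta>} \<in> sets"
  proof (rule Delta1_comprehension)
    show "range ?E \<subseteq> sets" using E0 pdiff_set assms by auto
    show "(\<exists>b. sat (e0(''z'' := a, ''d'' := b)) ?E ?\<theta>) \<longleftrightarrow> (\<forall>b. sat (e0(''z'' := a, ''d'' := b)) ?E ?\<theta>')" for a
      by (simp only: 1 2)
  qed (simp_all add: param_free_def)
  then show ?thesis unfolding 1 by simp
qed

lemma homogeneous_set: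
  assumes RT: "sat e E (RT2 2)" and f: "graph f \<in> sets" "\<And>x. f x \<prec> \<one> \<oplus> \<one>"
  obtains J c where "J \<in> sets" and "\<And>x. \<exists>y. y \<in> J \<and> x \<prec> y" and "c \<prec> \<one> \<oplus> \<one>"
    and "\<And>x y. x \<in> J \<Longrightarrow> y \<in> J \<Longrightarrow> x \<prec> y \<Longrightarrow> f (pdiff x y) = c"
proof -
  let ?F = "pair_colouring f"
  have "sat e (E(''F'' := ?F)) (is_function is_increasing_pair (below 2) (SVar ''F'')) \<longleftrightarrow>
      fun_code (\<lambda>u. \<exists>x y. x \<prec> y \<and> u = pr x y) (\<lambda>v. v \<prec> \<one> \<oplus> \<one>) (seval (E(''F'' := ?F)) (SVar ''F''))"
    by (rule sat_is_function) (simp_all add: is_increasing_pair_def below_2)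
  moreover have "fun_code (\<lambda>u. \<exists>x y. x \<prec> y \<and> u = pr x y) (\<lambda>v. v \<prec> \<one> \<oplus> \<one>) ?F"
    using f(2) by (auto simp: fun_code_def pair_colouring_def)
  ultimately have col: "sat e (E(''F'' := ?F)) (is_function is_increasing_pair (below 2) (SVar ''F''))"
    by simp
  have "RT2 2 = (\<^bold>\<forall>\<^sub>s''F''. is_function is_increasing_pair (below 2) (SVar ''F'') \<^bold>\<longrightarrow>
      ExSet ''J'' (\<^bold>\<exists>''c''. And (is_infinite (SVar ''J'')) (And (below 2 (Var ''c''))
        (\<^bold>\<forall>''x''. \<^bold>\<forall>''y''. And (Var ''x'' \<^bold>\<in> SVar ''J'') (And (Var ''y'' \<^bold>\<in> SVar ''J'') (Var ''x'' \<^bold>< Var ''y''))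
          \<^bold>\<longrightarrow> maps (SVar ''F'') (pair (Var ''x'') (Var ''y'')) (Var ''c'')))))"
    by (simp only: RT2_def And_def ExSet_def)
  with RT col pair_colouring[OF f(1)] have
    "sat e (E(''F'' := ?F)) (ExSet ''J'' (\<^bold>\<exists>''c''. And (is_infinite (SVar ''J'')) (And (below 2 (Var ''c''))
        (\<^bold>\<forall>''x''. \<^bold>\<forall>''y''. And (Var ''x'' \<^bold>\<in> SVar ''J'') (And (Var ''y'' \<^bold>\<in> SVar ''J'') (Var ''x'' \<^bold>< Var ''y''))
          \<^bold>\<longrightarrow> maps (SVar ''F'') (pair (Var ''x'') (Var ''y'')) (Var ''c'')))))"
    by (simp only: sat.simps(5,7))
  moreover have "is_infinite (SVar ''J'') = (\<^bold>\<forall>''x''. \<^bold>\<exists>''y''. And (Var ''y'' \<^bold>\<in> SVar ''J'') (Var ''x'' \<^bold>< Var ''y''))"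
    by (simp only: is_infinite_def And_def)
  ultimately have "\<exists>J\<in>sets. \<exists>c. c \<prec> \<one> \<oplus> \<one> \<and> (\<forall>x. \<exists>y. y \<in> J \<and> x \<prec> y) \<and>
      (\<forall>x. x \<in> J \<longrightarrow> (\<forall>y. x \<prec> y \<longrightarrow> y \<in> J \<longrightarrow> pr (pr x y) c \<in> ?F))"
    by (simp add: below_2 maps_def)
  then obtain J c where J: "J \<in> sets" "\<And>x. \<exists>y. y \<in> J \<and> x \<prec> y" "c \<prec> \<one> \<oplus> \<one>"
    and hom: "\<And>x y. x \<in> J \<Longrightarrow> y \<in> J \<Longrightarrow> x \<prec> y \<Longrightarrow> pr (pr x y) c \<in> ?F"
    by blast
  have "f (pdiff x y) = c" if "x \<in> J" "y \<in> J" "x \<prec> y" for x y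
    using hom[OF that] by (auto simp: pair_colouring_def)
  with J show ?thesis by (rule that)
qed

lemma gap_set_infinite:
  assumes "J \<in> sets" and "\<And>x. \<exists>y. y \<in> J \<and> x \<prec> y"
  shows "\<exists>y. y \<in> gap_set J \<and> x \<prec> y"
proof -
  obtain j where j: "j \<in> J" "x \<prec> j" using assms(2) by blast
  then obtain k where k: "successive J j k" using successive_exists[OF assms] by blast
  have "x \<prec> pdiff j k"
    using j(2) successiveD(3)[OF k] snd_le_pdiff[OF successiveD(3)[OF k]] by (blast intro: less_trans less_le_trans)
  then show ?thesis using k unfolding gap_set_def by blast
qed

lemma gap_set_pos: "x \<in> gap_set J \<Longrightarrow> \<zero> \<prec> x"
  unfolding gap_set_def using less_le_trans[OF pow2_pos pow2_le_pdiff] successiveD(3) by blast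

lemma sat_in_AS_gap_set:
  assumes "J \<in> sets" and "\<And>x. \<exists>y. y \<in> J \<and> x \<prec> y" and "E ''H'' = gap_set J"
    and "sat e E (in_AS (Var ''s'') (SVar ''H''))"
  shows "\<exists>a b. a \<in> J \<and> b \<in> J \<and> a \<prec> b \<and> e ''s'' = pdiff a b"
proof -
  let ?L = "SVar ''L''" and ?H = "SVar ''H''"
  have "enumerates ?L ?H = And (is_function is_nat is_nat ?L)
      (And (\<^bold>\<forall>''i''. \<^bold>\<forall>''j''. \<^bold>\<forall>''u''. \<^bold>\<forall>''v''. And (Var ''i'' \<^bold>< Var ''j'')
        (And (maps ?L (Var ''i'') (Var ''u'')) (maps ?L (Var ''j'') (Var ''v''))) \<^bold>\<longrightarrow> Var ''u'' \<^bold>< Var ''v'')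
      (\<^bold>\<forall>''u''. And (Var ''u'' \<^bold>\<in> ?H \<^bold>\<longrightarrow> (\<^bold>\<exists>''i''. maps ?L (Var ''i'') (Var ''u'')))
        ((\<^bold>\<exists>''i''. maps ?L (Var ''i'') (Var ''u'')) \<^bold>\<longrightarrow> Var ''u'' \<^bold>\<in> ?H)))"
    by (simp only: enumerates_def And_def)
  moreover have "in_AS (Var ''s'') ?H =
      ExSet ''L'' (And (enumerates ?L ?H) (\<^bold>\<exists>''i''. \<^bold>\<exists>''j''. is_sum ?L (Var ''i'') (Var ''j'') (Var ''s'')))"
    by (simp only: in_AS_def And_def ExSet_def)
  ultimately have "\<exists>A\<in>sets. (\<exists>l. A = graph l) \<and>
      (\<forall>i j u v. i \<prec> j \<and> pr i u \<in> A \<and> pr j v \<in> A \<longrightarrow> u \<prec> v) \<and>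
      (\<forall>u. (u \<in> gap_set J \<longrightarrow> (\<exists>i. pr i u \<in> A)) \<and> ((\<exists>i. pr i u \<in> A) \<longrightarrow> u \<in> gap_set J)) \<and>
      (\<exists>i j. sat (e(''i'' := i, ''j'' := j)) (E(''L'' := A)) (is_sum ?L (Var ''i'') (Var ''j'') (Var ''s'')))"
    using assms(3,4) by (simp add: sat_is_function_nat maps_def)
  \<comment> \<open>The enumeration comes from the assumed membership in \<open>in_AS\<close>.
    Nothing is known of it beyond monotonicity and range, and \<open>adjacent_sum\<close> asks for
    no more.\<close>
  then obtain l i j where l: "graph l \<in> sets" "\<And>i j. i \<prec> j \<Longrightarrow> l i \<prec> l j"
      "\<And>u. u \<in> gap_set J \<longleftrightarrow> (\<exists>i. u = l i)"
    and sum: "sat (e(''i'' := i, ''j'' := j)) (E(''L'' := graph l)) (is_sum ?L (Var ''i'') (Var ''j'') (Var ''s''))"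
    by (elim bexE exE conjE) (simp, blast)
  have "sat (e(''i'' := i, ''j'' := j)) (E(''L'' := graph l)) (is_sum ?L (Var ''i'') (Var ''j'') (Var ''s'')) \<longleftrightarrow>
      sum_is l (teval (e(''i'' := i, ''j'' := j)) (Var ''i'')) (teval (e(''i'' := i, ''j'' := j)) (Var ''j''))
        (teval (e(''i'' := i, ''j'' := j)) (Var ''s''))"
    by (rule sat_is_sum) auto
  with sum have "sum_is l i j (e ''s'')" by simp
  with assms(1,2) l show ?thesis by (rule adjacent_sum)
qed

lemma RT2_imp_AHT: "sat e E (RT2 2 \<^bold>\<longrightarrow> AHT 2)"
proof -
  have "sat e E (AHT 2)" if RT: "sat e E (RT2 2)"
  proof -
    let ?H = "SVar ''H''" and ?C = "SVar ''C''"
    have AHT: "AHT 2 = (\<^bold>\<forall>\<^sub>s''C''. is_function is_nat (below 2) ?C \<^bold>\<longrightarrow>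
        ExSet ''H'' (And (is_infinite ?H) (And (\<^bold>\<forall>''x''. Var ''x'' \<^bold>\<in> ?H \<^bold>\<longrightarrow> \<^bold>0 \<^bold>< Var ''x'') (And (is_apart ?H)
          (\<^bold>\<exists>''c''. And (below 2 (Var ''c'')) (\<^bold>\<forall>''s''. in_AS (Var ''s'') ?H \<^bold>\<longrightarrow> maps ?C (Var ''s'') (Var ''c'')))))))"
      by (simp only: AHT_def And_def ExSet_def)
    have inf: "is_infinite ?H = (\<^bold>\<forall>''x''. \<^bold>\<exists>''y''. And (Var ''y'' \<^bold>\<in> ?H) (Var ''x'' \<^bold>< Var ''y''))"
      by (simp only: is_infinite_def And_def)
    show ?thesis
      unfolding AHT sat.simps(7) sat.simps(5)
    proof (intro ballI impI)
      fix C
      assume "C \<in> sets" "sat e (E(''C'' := C)) (is_function is_nat (below 2) ?C)"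
      then obtain f where f: "graph f \<in> sets" "C = graph f" "\<And>x. f x \<prec> \<one> \<oplus> \<one>"
        using sat_is_colouring[of e "E(''C'' := C)" ?C] by auto
      obtain J c where J: "J \<in> sets" "\<And>x. \<exists>y. y \<in> J \<and> x \<prec> y" "c \<prec> \<one> \<oplus> \<one>"
        and hom: "\<And>x y. x \<in> J \<Longrightarrow> y \<in> J \<Longrightarrow> x \<prec> y \<Longrightarrow> f (pdiff x y) = c"
        by (rule homogeneous_set[OF RT f(1,3)]) blast
      let ?E = "E(''C'' := C, ''H'' := gap_set J)"
      have "sat e ?E (is_infinite ?H)"
        unfolding inf using gap_set_infinite[OF J(1,2)] by simp
      moreover have "sat e ?E (\<^bold>\<forall>''x''. Var ''x'' \<^bold>\<in> ?H \<^bold>\<longrightarrow> \<^bold>0 \<^bold>< Var ''x'')"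
        using gap_set_pos by simp
      moreover have "sat e ?E (is_apart ?H)"
        by (rule sat_is_apart) simp
      moreover have "f s = c" if AS: "sat (e(''c'' := c, ''s'' := s)) ?E (in_AS (Var ''s'') ?H)" for s
      proof -
        have "\<exists>a b. a \<in> J \<and> b \<in> J \<and> a \<prec> b \<and> (e(''c'' := c, ''s'' := s)) ''s'' = pdiff a b"
          by (rule sat_in_AS_gap_set[OF J(1,2) _ AS]) simp
        then show ?thesis using hom by auto
      qed
      then have "sat (e(''c'' := c)) ?E (And (below 2 (Var ''c''))
          (\<^bold>\<forall>''s''. in_AS (Var ''s'') ?H \<^bold>\<longrightarrow> maps ?C (Var ''s'') (Var ''c'')))"
        using J(3) f(2) by (simp add: below_2 maps_def)
      then have "sat e ?E (\<^bold>\<exists>''c''. And (below 2 (Var ''c''))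
          (\<^bold>\<forall>''s''. in_AS (Var ''s'') ?H \<^bold>\<longrightarrow> maps ?C (Var ''s'') (Var ''c'')))"
        unfolding sat_abbrevs(5) by blast
      ultimately have "sat e ?E (And (is_infinite ?H) (And (\<^bold>\<forall>''x''. Var ''x'' \<^bold>\<in> ?H \<^bold>\<longrightarrow> \<^bold>0 \<^bold>< Var ''x'') (And (is_apart ?H)
          (\<^bold>\<exists>''c''. And (below 2 (Var ''c'')) (\<^bold>\<forall>''s''. in_AS (Var ''s'') ?H \<^bold>\<longrightarrow> maps ?C (Var ''s'') (Var ''c''))))))"
        by (simp only: sat_And_Or)
      then show "sat e (E(''C'' := C)) (ExSet ''H'' (And (is_infinite ?H)
          (And (\<^bold>\<forall>''x''. Var ''x'' \<^bold>\<in> ?H \<^bold>\<longrightarrow> \<^bold>0 \<^bold>< Var ''x'') (And (is_apart ?H)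
          (\<^bold>\<exists>''c''. And (below 2 (Var ''c'')) (\<^bold>\<forall>''s''. in_AS (Var ''s'') ?H \<^bold>\<longrightarrow> maps ?C (Var ''s'') (Var ''c'')))))))"
        unfolding sat_ExSet using gap_set[OF J(1)] by blast
    qed
  qed
  then show ?thesis unfolding sat.simps(5) by (rule impI)
qed

end

theorem proposition1:
  shows "RCA\<^sub>0 \<turnstile> (RT2 2 \<^bold>\<longrightarrow> AHT 2)"
proof (rule RCA0_completeness)
  show "is_sentence (RT2 2 \<^bold>\<longrightarrow> AHT 2)"
    by (auto simp: is_sentence_def RT2_def AHT_def is_function_def is_nat_def is_increasing_pair_def below_def
        is_infinite_def is_apart_def mu_is_def lambda_is_def is_binary_expansion_def is_powers_of_two_def
        strictly_increasing_upto_def is_sum_def in_AS_def enumerates_def maps_def pair_def numeral_2_eq_2)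
qed (rule rca0_model.RT2_imp_AHT)

end
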